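(* Let $g\in L^2(\mathbb{R})$ be a function with $g(x)=0$ for $x<0$ whose restriction to $[0,\infty)$ is stably decreasing. Let $x_0\in[0,\infty]$ be the supremum (taken in $[0,\infty]$) of all $x\ge 0$ such that $g(x)>0$. Let $\alpha,\beta>0$. (1) If $x_0=\infty$, then the Gabor system $\mathcal{G}(g;\alpha,\beta)$ is a frame in $L^2(\mathbb{R})$ if and only if $\alpha\beta\le 1$. (2) If $x_0<\infty$ and $\lim_{x\to x_0-}g(x)>0$, then $\mathcal{G}(g;\alpha,\beta)$ is a frame in $L^2(\mathbb{R})$ if and only if $\alpha\beta\le 1$ and $\alpha\le x_0$. (3) If $x_0<\infty$ and $\lim_{x\to x_0-}g(x)=0$, then $\mathcal{G}(g;\alpha,\beta)$ is a frame in $L^2(\mathbb{R})$ if and only if $\alpha\beta\le 1$ and $\alpha<x_0$.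
   Context: A function $g:[0,\infty)\to[0,\infty)$ is called stably decreasing if for every $t>0$ there exists $q(t)$ with $0<q(t)<1$ such that $g(x)q(t)\ge g(x+t)$ for all $x\ge 0$. For $g\in L^2(\mathbb{R})$ and $t,\omega\in\mathbb{R}$ put $\pi_{t,\omega}g(x)=e^{2\pi i\omega x}g(x-t)$. For $\alpha,\beta>0$ the Gabor system is $\mathcal{G}(g;\alpha,\beta)=\{\pi_{\alpha m,\beta n}g\}_{m,n\in\mathbb{Z}}$. It is a frame in $L^2(\mathbb{R})$ if there are constants $A,B>0$ such that for all $h\in L^2(\mathbb{R})$, $A\|h\|^2\le\sum_{m,n\in\mathbb{Z}}|(h,\pi_{\alpha m,\beta n}g)|^2\le B\|h\|^2$, where $(\cdot,\cdot)$ and $\|\cdot\|$ are the inner product and norm of $L^2(\mathbb{R})$. The notation $\lim_{x\to x_0-}$ denotes the left-hand limit. *)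

theory Defs
  imports "HOL-Analysis.Analysis"
begin

text \<open>
  \<open>L\<^sup>2(\<real>)\<close> is modelled by its representatives, without passing to the quotient modulo
  equality almost everywhere; inner product, norm and the frame property below depend only on
  the class.
\<close>

definition L2 :: "(real \<Rightarrow> complex) set" where
  "L2 = {h. h \<in> borel_measurable lebesgue \<and> integrable lebesgue (\<lambda>x. (cmod (h x))\<^sup>2)}"

definition L2_inner :: "(real \<Rightarrow> complex) \<Rightarrow> (real \<Rightarrow> complex) \<Rightarrow> complex" where
  "L2_inner h f = (LINT x|lebesgue. h x * cnj (f x))"

definition L2_norm :: "(real \<Rightarrow> complex) \<Rightarrow> real" where
  "L2_norm h = sqrt (LINT x|lebesgue. (cmod (h x))\<^sup>2)"

text \<open>Translation by \<open>t\<close> followed by modulation by \<open>\<omega>\<close>; recall that \<open>cis y = exp (\<i> * y)\<close>.\<close>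

definition tf_shift :: "real \<Rightarrow> real \<Rightarrow> (real \<Rightarrow> complex) \<Rightarrow> real \<Rightarrow> complex" where
  "tf_shift t \<omega> g = (\<lambda>x. cis (2 * pi * \<omega> * x) * g (x - t))"

definition gabor_system :: "(real \<Rightarrow> complex) \<Rightarrow> real \<Rightarrow> real \<Rightarrow> int \<times> int \<Rightarrow> real \<Rightarrow> complex" where
  "gabor_system g \<alpha> \<beta> = (\<lambda>(m, n). tf_shift (\<alpha> * of_int m) (\<beta> * of_int n) g)"

text \<open>
  Frames are indexed families, so repeated members count with multiplicity. Summability is required
  explicitly because \<^const>\<open>infsum\<close> is 0 on families that are not summable.
\<close>

definition L2_frame :: "('i \<Rightarrow> real \<Rightarrow> complex) \<Rightarrow> bool" where
  "L2_frame e \<longleftrightarrow> (\<exists>A>0. \<exists>B>0. \<forall>h\<in>L2.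
     (\<lambda>i. (cmod (L2_inner h (e i)))\<^sup>2) summable_on UNIV \<and>
     A * (L2_norm h)\<^sup>2 \<le> (\<Sum>\<^sub>\<infinity>i. (cmod (L2_inner h (e i)))\<^sup>2) \<and>
     (\<Sum>\<^sub>\<infinity>i. (cmod (L2_inner h (e i)))\<^sup>2) \<le> B * (L2_norm h)\<^sup>2)"

text \<open>Only the restriction of \<open>g\<close> to \<open>[0,\<infinity>)\<close> matters; the first conjunct is its codomain \<open>[0,\<infinity>)\<close>.\<close>

definition stably_decreasing :: "(real \<Rightarrow> real) \<Rightarrow> bool" where
  "stably_decreasing g \<longleftrightarrow>
     (\<forall>x\<ge>0. 0 \<le> g x) \<and>
     (\<forall>t>0. \<exists>q. 0 < q \<and> q < 1 \<and> (\<forall>x\<ge>0. g x * q \<ge> g (x + t)))"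

text \<open>In \<^typ>\<open>ennreal\<close> the supremum of the empty set is 0, as it is in \<open>[0,\<infinity>]\<close>.\<close>

definition support_end :: "(real \<Rightarrow> real) \<Rightarrow> ennreal" where
  "support_end g = (SUP x\<in>{x. 0 \<le> x \<and> g x > 0}. ennreal x)"

end

theory Submission
  imports Defs
begin

text \<open>
  Put \<open>M = 1/\<beta>\<close>. For fixed \<open>m\<close> the numbers \<open>(h, \<pi>\<^bsub>\<alpha>m,\<beta>n\<^esub> g)\<close>, \<open>n \<in> \<int>\<close>, are the Fourier
  coefficients of the \<open>M\<close>-periodization of \<open>h(x) g(x - \<alpha>m)\<close>, so Parseval's identity turns the sum
  over all \<open>(m, n)\<close> into
  \<open>M \<integral>\<^sub>0\<^sup>M \<Sum>\<^sub>m |\<Sum>\<^sub>k h(x + kM) g(x + kM - \<alpha>m)|\<^sup>2 dx\<close>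
  (\<open>gabor_coefficients_has_sum\<close>). The Gabor system is therefore a frame exactly when the infinite
  matrices \<open>(g(x + kM - \<alpha>m))\<^bsub>m,k\<^esub>\<close> are bounded above and below on \<open>\<ell>\<^sup>2\<close>, uniformly
  in almost every \<open>x\<close>. It suffices to look at \<open>h\<close> with bounded support, for which \<open>k\<close> ranges over a
  finite set; the bounds pass to all \<open>h\<close> by truncation.

  Stable decrease makes \<open>g\<close> decay geometrically along every arithmetic progression, so the upper
  bound always holds, by Schur's test (\<open>sampled_upper_bound\<close>). The whole theorem is then the
  equivalence \<open>gabor_frame_iff\<close>: the system is a frame if and only if \<open>\<alpha>\<beta> \<le> 1\<close> and \<open>g\<close> is bounded
  away from \<open>0\<close> on \<open>[0,\<alpha>)\<close>.

  Sufficiency: as \<open>\<alpha> \<le> M\<close>, the last multiple \<open>\<alpha>m\<^sub>k\<close> of \<open>\<alpha>\<close> that is at most \<open>x + kM\<close> lies beyond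
  \<open>x + (k - 1)M\<close>. The rows \<open>m\<^sub>k\<close> form an upper triangular matrix whose diagonal entries are values of
  \<open>g\<close> on \<open>[0,\<alpha>)\<close> and whose rows decrease by a factor \<open>q < 1\<close> at each step. Since \<open>q\<close> may be close to
  \<open>1\<close>, the diagonal need not dominate; but after the weights \<open>q\<^sup>j\<close> are absorbed into the unknowns
  the rows are nonincreasing, and summation by parts, as in the Enestroem-Kakeya theorem on zeros of
  polynomials with monotone coefficients, inverts the matrix with exponentially decaying inverse
  (\<open>decreasing_weights_bound\<close>, \<open>triangular_lower_bound\<close>).

  Necessity is tested on \<open>h\<close> that are constant on short intervals with spacing \<open>M\<close>
  (\<open>frame_fiber_test\<close>). A single short interval to the right of \<open>s < \<alpha>\<close> sees only the values of \<open>g\<close>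
  beyond \<open>s\<close>, which forces \<open>g(s)\<close> to be bounded below. If \<open>\<alpha>\<beta> > 1\<close>, then among \<open>N\<close> consecutive
  columns fewer than \<open>N\<close> rows have entries that are neither zero nor exponentially small, so a
  nonzero vector is annihilated by all of these rows at a point \<open>x\<close> of continuity, and nearly
  annihilated close to \<open>x\<close> (\<open>frame_imp_density\<close>).
\<close>

section \<open>Polynomials in the square mean\<close>

lemma cmod_diff_square_triangle:
  fixes a b c :: complex
  shows "(cmod (a - c))\<^sup>2 \<le> 2 * (cmod (a - b))\<^sup>2 + 2 * (cmod (b - c))\<^sup>2"
proof -
  have "cmod (a - c) \<le> cmod (a - b) + cmod (b - c)"
    using norm_triangle_ineq[of "a - b" "b - c"] by simp
  then have "(cmod (a - c))\<^sup>2 \<le> (cmod (a - b) + cmod (b - c))\<^sup>2"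
    by (rule power_mono) simp
  also have "\<dots> \<le> 2 * (cmod (a - b))\<^sup>2 + 2 * (cmod (b - c))\<^sup>2"
    using sum_squares_bound[of "cmod (a - b)" "cmod (b - c)"] by (simp add: power2_sum)
  finally show ?thesis .
qed

text \<open>
Stated with \<open>\<epsilon>/4\<close> on the right because \<open>|u + v|\<^sup>2 \<le> 2|u|\<^sup>2 + 2|v|\<^sup>2\<close>. Nonnegative integrals spare all
integrability conditions in the approximation arguments.
\<close>

lemma nn_integral_square_triangle:
  fixes F G :: "'a \<Rightarrow> complex"
  assumes [measurable]: "F \<in> borel_measurable N" "G \<in> borel_measurable N"
    and F: "(\<integral>\<^sup>+z. ennreal ((cmod (F z))\<^sup>2) \<partial>N) < ennreal (\<epsilon> / 4)"
    and G: "(\<integral>\<^sup>+z. ennreal ((cmod (G z))\<^sup>2) \<partial>N) < ennreal (\<epsilon> / 4)"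
  shows "(\<integral>\<^sup>+z. ennreal ((cmod (F z + G z))\<^sup>2) \<partial>N) < ennreal \<epsilon>"
proof -
  have "(\<integral>\<^sup>+z. ennreal ((cmod (F z + G z))\<^sup>2) \<partial>N)
      \<le> (\<integral>\<^sup>+z. 2 * ennreal ((cmod (F z))\<^sup>2) + 2 * ennreal ((cmod (G z))\<^sup>2) \<partial>N)"
  proof (intro nn_integral_mono)
    fix z
    have "ennreal ((cmod (F z + G z))\<^sup>2) \<le> ennreal (2 * (cmod (F z))\<^sup>2 + 2 * (cmod (G z))\<^sup>2)"
      using cmod_diff_square_triangle[of "F z" "- G z" 0] by (intro ennreal_leI) simp
    then show "ennreal ((cmod (F z + G z))\<^sup>2)
        \<le> 2 * ennreal ((cmod (F z))\<^sup>2) + 2 * ennreal ((cmod (G z))\<^sup>2)"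
      by (simp add: ennreal_mult)
  qed
  also have "\<dots> = 2 * (\<integral>\<^sup>+z. ennreal ((cmod (F z))\<^sup>2) \<partial>N) + 2 * (\<integral>\<^sup>+z. ennreal ((cmod (G z))\<^sup>2) \<partial>N)"
    by (subst nn_integral_add) (auto simp: nn_integral_cmult)
  also have "\<dots> < ennreal \<epsilon>"
  proof -
    obtain s where s: "(\<integral>\<^sup>+z. ennreal ((cmod (F z))\<^sup>2) \<partial>N) = ennreal s" "s \<ge> 0"
      using F by (cases "\<integral>\<^sup>+z. ennreal ((cmod (F z))\<^sup>2) \<partial>N") auto
    obtain t where t: "(\<integral>\<^sup>+z. ennreal ((cmod (G z))\<^sup>2) \<partial>N) = ennreal t" "t \<ge> 0"
      using G by (cases "\<integral>\<^sup>+z. ennreal ((cmod (G z))\<^sup>2) \<partial>N") auto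
    have "s < \<epsilon> / 4" "t < \<epsilon> / 4"
      using F G s t by (simp_all add: ennreal_less_iff)
    moreover have "2 * ennreal s + 2 * ennreal t = ennreal (2 * s + 2 * t)"
      using s t by (simp add: ennreal_mult)
    moreover have "ennreal (2 * s + 2 * t) < ennreal \<epsilon>"
      using calculation s t by (intro ennreal_lessI) auto
    ultimately show ?thesis
      unfolding s(1) t(1) by simp
  qed
  finally show ?thesis .
qed

definition polynomial_approximable :: "'a::euclidean_space measure \<Rightarrow> ('a \<Rightarrow> complex) \<Rightarrow> bool" where
  "polynomial_approximable N \<phi> \<longleftrightarrow> \<phi> \<in> borel_measurable N \<and>
     (\<forall>\<epsilon>>0. \<exists>p. polynomial_function p \<and>
        (\<integral>\<^sup>+z. ennreal ((cmod (\<phi> z - p z))\<^sup>2) \<partial>N) < ennreal \<epsilon>)"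

lemma polynomial_function_borel_measurable:
  fixes p :: "'a::euclidean_space \<Rightarrow> 'b::euclidean_space"
  assumes "polynomial_function p" "sets N = sets borel"
  shows "p \<in> borel_measurable N"
  using borel_measurable_continuous_onI[OF continuous_on_polymonial_function[OF assms(1)]] assms(2)
    measurable_cong_sets by blast

lemma polynomial_approximable_add:
  assumes N: "sets N = sets borel" and "polynomial_approximable N \<phi>" "polynomial_approximable N \<psi>"
  shows "polynomial_approximable N (\<lambda>z. \<phi> z + \<psi> z)"
  unfolding polynomial_approximable_def
proof (intro conjI allI impI)
  have [measurable]: "\<phi> \<in> borel_measurable N" "\<psi> \<in> borel_measurable N"
    using assms by (auto simp: polynomial_approximable_def)
  show "(\<lambda>z. \<phi> z + \<psi> z) \<in> borel_measurable N" by simp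
  fix \<epsilon> :: real assume "\<epsilon> > 0"
  then have "\<epsilon> / 4 > 0" by simp
  then obtain p q where p: "polynomial_function p"
      "(\<integral>\<^sup>+z. ennreal ((cmod (\<phi> z - p z))\<^sup>2) \<partial>N) < ennreal (\<epsilon> / 4)"
    and q: "polynomial_function q"
      "(\<integral>\<^sup>+z. ennreal ((cmod (\<psi> z - q z))\<^sup>2) \<partial>N) < ennreal (\<epsilon> / 4)"
    using assms unfolding polynomial_approximable_def by meson
  have [measurable]: "p \<in> borel_measurable N" "q \<in> borel_measurable N"
    using p q N by (auto intro: polynomial_function_borel_measurable)
  have "(\<integral>\<^sup>+z. ennreal ((cmod ((\<phi> z - p z) + (\<psi> z - q z)))\<^sup>2) \<partial>N) < ennreal \<epsilon>"
    by (rule nn_integral_square_triangle) (use p q in auto)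
  then have "(\<integral>\<^sup>+z. ennreal ((cmod ((\<phi> z + \<psi> z) - (p z + q z)))\<^sup>2) \<partial>N) < ennreal \<epsilon>"
    by (simp add: algebra_simps)
  then show "\<exists>p. polynomial_function p \<and>
      (\<integral>\<^sup>+z. ennreal ((cmod ((\<phi> z + \<psi> z) - p z))\<^sup>2) \<partial>N) < ennreal \<epsilon>"
    using p q by (intro exI[of _ "\<lambda>z. p z + q z"]) (auto intro: polynomial_function_add)
qed

lemma polynomial_approximable_limit:
  assumes N: "sets N = sets borel" and [measurable]: "\<phi> \<in> borel_measurable N"
    and lim: "\<And>\<epsilon>. \<epsilon> > 0 \<Longrightarrow> \<exists>\<psi>. polynomial_approximable N \<psi> \<and>
        (\<integral>\<^sup>+z. ennreal ((cmod (\<phi> z - \<psi> z))\<^sup>2) \<partial>N) < ennreal \<epsilon>"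
  shows "polynomial_approximable N \<phi>"
  unfolding polynomial_approximable_def
proof (intro conjI allI impI)
  fix \<epsilon> :: real assume "\<epsilon> > 0"
  then have "\<epsilon> / 4 > 0" by simp
  then obtain p \<psi> where psi: "polynomial_approximable N \<psi>"
      "(\<integral>\<^sup>+z. ennreal ((cmod (\<phi> z - \<psi> z))\<^sup>2) \<partial>N) < ennreal (\<epsilon> / 4)"
    and p: "polynomial_function p"
      "(\<integral>\<^sup>+z. ennreal ((cmod (\<psi> z - p z))\<^sup>2) \<partial>N) < ennreal (\<epsilon> / 4)"
    using lim unfolding polynomial_approximable_def by meson
  have [measurable]: "p \<in> borel_measurable N" "\<psi> \<in> borel_measurable N"
    using p psi N by (auto intro: polynomial_function_borel_measurable simp: polynomial_approximable_def)
  have "(\<integral>\<^sup>+z. ennreal ((cmod ((\<phi> z - \<psi> z) + (\<psi> z - p z)))\<^sup>2) \<partial>N) < ennreal \<epsilon>"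
    by (rule nn_integral_square_triangle) (use p psi in auto)
  then show "\<exists>p. polynomial_function p \<and>
      (\<integral>\<^sup>+z. ennreal ((cmod (\<phi> z - p z))\<^sup>2) \<partial>N) < ennreal \<epsilon>"
    using p by auto
qed (use assms in simp)

lemma polynomial_approximable_cmult:
  assumes N: "sets N = sets borel" and "polynomial_approximable N \<phi>"
  shows "polynomial_approximable N (\<lambda>z. c * \<phi> z)"
  unfolding polynomial_approximable_def
proof (intro conjI allI impI)
  have [measurable]: "\<phi> \<in> borel_measurable N"
    using assms by (auto simp: polynomial_approximable_def)
  show "(\<lambda>z. c * \<phi> z) \<in> borel_measurable N" by simp
  fix \<epsilon> :: real assume \<epsilon>: "\<epsilon> > 0"
  have pos: "(cmod c)\<^sup>2 + 1 > 0" by (simp add: add_nonneg_pos)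
  then obtain p where p: "polynomial_function p"
      "(\<integral>\<^sup>+z. ennreal ((cmod (\<phi> z - p z))\<^sup>2) \<partial>N) < ennreal (\<epsilon> / ((cmod c)\<^sup>2 + 1))"
    using assms \<epsilon> unfolding polynomial_approximable_def by (meson divide_pos_pos)
  have [measurable]: "p \<in> borel_measurable N"
    using p N by (auto intro: polynomial_function_borel_measurable)
  obtain s where s: "(\<integral>\<^sup>+z. ennreal ((cmod (\<phi> z - p z))\<^sup>2) \<partial>N) = ennreal s" "s \<ge> 0"
    using p by (cases "\<integral>\<^sup>+z. ennreal ((cmod (\<phi> z - p z))\<^sup>2) \<partial>N") auto
  have "s < \<epsilon> / ((cmod c)\<^sup>2 + 1)" using p s by (simp add: ennreal_less_iff)
  then have "((cmod c)\<^sup>2 + 1) * s < \<epsilon>" using pos by (simp add: field_simps)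
  then have le: "(cmod c)\<^sup>2 * s < \<epsilon>" using s(2) by (simp add: distrib_right)
  have "(\<integral>\<^sup>+z. ennreal ((cmod (c * \<phi> z - c * p z))\<^sup>2) \<partial>N)
      = (\<integral>\<^sup>+z. ennreal ((cmod c)\<^sup>2) * ennreal ((cmod (\<phi> z - p z))\<^sup>2) \<partial>N)"
    by (simp flip: right_diff_distrib ennreal_mult add: norm_mult power_mult_distrib)
  also have "\<dots> = ennreal ((cmod c)\<^sup>2) * ennreal s"
    by (simp add: nn_integral_cmult s)
  also have "\<dots> < ennreal \<epsilon>"
    using le s(2) by (simp flip: ennreal_mult add: ennreal_less_iff)
  finally have "(\<integral>\<^sup>+z. ennreal ((cmod (c * \<phi> z - c * p z))\<^sup>2) \<partial>N) < ennreal \<epsilon>" .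
  moreover have "polynomial_function (\<lambda>z. c * p z)"
    unfolding polynomial_function_def
  proof (intro allI impI)
    fix f :: "complex \<Rightarrow> real" assume "bounded_linear f"
    then have "bounded_linear (\<lambda>z. f (c * z))"
      using bounded_linear_compose bounded_linear_mult_right by blast
    then have "real_polynomial_function ((\<lambda>z. f (c * z)) \<circ> p)"
      using p(1) unfolding polynomial_function_def by blast
    then show "real_polynomial_function (f \<circ> (\<lambda>z. c * p z))" by (simp add: comp_def)
  qed
  ultimately show "\<exists>p. polynomial_function p \<and>
      (\<integral>\<^sup>+z. ennreal ((cmod (c * \<phi> z - p z))\<^sup>2) \<partial>N) < ennreal \<epsilon>"
    by (intro exI[of _ "\<lambda>z. c * p z"]) auto
qed

text \<open>
Regularity of \<open>N\<close> places \<open>B\<close> between a compact and an open set of nearly equal measure, Urysohn's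
lemma replaces the indicator by a continuous function between these sets, and the
Stone-Weierstrass theorem on \<open>K\<close> replaces that function by a polynomial.
\<close>

lemma polynomial_approximable_indicator:
  fixes B :: "'a::euclidean_space set"
  assumes fin: "finite_measure N" and N: "sets N = sets borel"
    and K: "compact K" "AE z in N. z \<in> K" and B: "B \<in> sets borel"
  shows "polynomial_approximable N (indicator B)"
  unfolding polynomial_approximable_def
proof (intro conjI allI impI)
  interpret finite_measure N by fact
  note [measurable_cong] = N
  have [measurable]: "B \<in> sets borel" by (fact B)
  show "(indicator B :: 'a \<Rightarrow> complex) \<in> borel_measurable N"
    by measurable
  fix \<epsilon> :: real assume \<epsilon>: "\<epsilon> > 0"
  define m where "m = measure N B"
  have m: "emeasure N B = ennreal m" "m \<ge> 0" by (simp_all add: m_def emeasure_eq_measure)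
  \<comment> \<open>\<open>U - C\<close> gets measure below \<open>2e\<close>, which has to be at most \<open>\<epsilon>/4\<close>.\<close>
  define e where "e = \<epsilon> / 8"
  have e: "e > 0" using \<epsilon> by (simp add: e_def)
  obtain C where C: "compact C" "C \<subseteq> B" "measure N C > m - e"
  proof (cases "m - e < 0")
    case True
    then have "measure N {} > m - e" by simp
    then show ?thesis using that[of "{}"] by auto
  next
    case False
    have "(SUP C \<in> {C. C \<subseteq> B \<and> compact C}. emeasure N C) = emeasure N B"
      using inner_regular[OF N _ B] by simp
    moreover have "ennreal (m - e) < ennreal m"
      using e False by (intro ennreal_lessI) auto
    ultimately have "ennreal (m - e) < (SUP C \<in> {C. C \<subseteq> B \<and> compact C}. emeasure N C)"
      by (simp add: m)
    then obtain C where "C \<subseteq> B" "compact C" "ennreal (m - e) < emeasure N C"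
      unfolding less_SUP_iff by auto
    then show ?thesis using that[of C] False
      by (simp add: emeasure_eq_measure ennreal_less_iff)
  qed
  obtain U where U: "open U" "B \<subseteq> U" "measure N U < m + e"
  proof -
    have "(INF U \<in> {U. B \<subseteq> U \<and> open U}. emeasure N U) = emeasure N B"
      using outer_regular[OF N _ B] by simp
    moreover have "ennreal m < ennreal (m + e)"
      using e m by (intro ennreal_lessI) auto
    ultimately have "(INF U \<in> {U. B \<subseteq> U \<and> open U}. emeasure N U) < ennreal (m + e)"
      by (simp add: m)
    then obtain U where "B \<subseteq> U" "open U" "emeasure N U < ennreal (m + e)"
      unfolding INF_less_iff by auto
    then show ?thesis using that[of U]
      by (simp add: emeasure_eq_measure ennreal_less_iff)
  qed
  have [measurable]: "C \<in> sets borel" "U \<in> sets borel"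
    using C U by (auto intro: borel_compact borel_open)
  have "measure N (U - C) = measure N U - measure N C"
    using C U N by (intro finite_measure_Diff) auto
  then have UC: "measure N (U - C) < 2 * e" using C U by linarith
  obtain f :: "'a \<Rightarrow> complex" where f: "continuous_on UNIV f" "\<And>x. f x \<in> closed_segment 1 0"
    "\<And>x. x \<in> C \<Longrightarrow> f x = 1" "\<And>x. x \<in> - U \<Longrightarrow> f x = 0"
    using Urysohn[of C "- U" "1::complex" 0] C U by (metis Compl_disjoint closed_Compl
        compact_imp_closed disjoint_eq_subset_Compl double_complement order_trans)
  have f1: "cmod (indicator B z - f z) \<le> indicator (U - C) z" for z
  proof -
    obtain u where u: "0 \<le> u" "u \<le> 1" "f z = of_real (1 - u)"
      using f(2)[of z] by (auto simp: in_segment scaleR_conv_of_real)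
    have "cmod (1 - f z) = u"
    proof -
      have "1 - f z = of_real u" by (simp add: u)
      then show ?thesis using u(1) by simp
    qed
    moreover have "cmod (f z) = \<bar>1 - u\<bar>" unfolding u(3) by (rule norm_of_real)
    ultimately show ?thesis
      using f(3)[of z] f(4)[of z] C U u(1,2) by (auto simp: indicator_def)
  qed
  define M0 where "M0 = measure N UNIV"
  have M0: "M0 \<ge> 0" "emeasure N UNIV = ennreal M0" by (simp_all add: M0_def emeasure_eq_measure)
  \<comment> \<open>A uniform error \<open>d\<close> costs \<open>d\<^sup>2\<close> times the total mass; the \<open>+ 1\<close> covers total mass \<open>0\<close>.\<close>
  define d where "d = sqrt (e / (M0 + 1))"
  have d: "d > 0" "d\<^sup>2 * M0 < 2 * e"
  proof -
    show "d > 0" using e M0 by (simp add: d_def)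
    have "d\<^sup>2 * M0 = e * (M0 / (M0 + 1))" using e M0 by (simp add: d_def)
    also have "\<dots> \<le> e * 1" using e M0 by (intro mult_left_mono) auto
    finally show "d\<^sup>2 * M0 < 2 * e" using e by linarith
  qed
  obtain p where p: "polynomial_function p" "\<And>z. z \<in> K \<Longrightarrow> cmod (f z - p z) < d"
    using Stone_Weierstrass_polynomial_function[OF K(1) continuous_on_subset[OF f(1)] d(1)] by auto
  have [measurable]: "p \<in> borel_measurable N"
    using p N polynomial_function_borel_measurable by blast
  have [measurable]: "f \<in> borel_measurable N"
    using borel_measurable_continuous_onI[OF f(1)] N measurable_cong_sets by blast
  have "(\<integral>\<^sup>+z. ennreal ((cmod ((indicator B z - f z) + (f z - p z)))\<^sup>2) \<partial>N) < ennreal \<epsilon>"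
  proof (rule nn_integral_square_triangle)
    have "(\<integral>\<^sup>+z. ennreal ((cmod (indicator B z - f z))\<^sup>2) \<partial>N) \<le> (\<integral>\<^sup>+z. indicator (U - C) z \<partial>N)"
    proof (intro nn_integral_mono)
      fix z
      have "ennreal ((cmod (indicator B z - f z))\<^sup>2) \<le> ennreal ((indicator (U - C) z)\<^sup>2)"
        by (intro ennreal_leI power_mono f1) simp
      then show "ennreal ((cmod (indicator B z - f z))\<^sup>2) \<le> indicator (U - C) z"
        by (auto simp: indicator_def split: if_splits intro: power_le_one)
    qed
    also have "\<dots> = emeasure N (U - C)" using N by (intro nn_integral_indicator) auto
    also have "\<dots> < ennreal (\<epsilon> / 4)"
      using UC \<epsilon> by (simp add: emeasure_eq_measure ennreal_less_iff e_def)
    finally show "(\<integral>\<^sup>+z. ennreal ((cmod (indicator B z - f z))\<^sup>2) \<partial>N) < ennreal (\<epsilon> / 4)" .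
    have "(\<integral>\<^sup>+z. ennreal ((cmod (f z - p z))\<^sup>2) \<partial>N) \<le> (\<integral>\<^sup>+z. ennreal (d\<^sup>2) \<partial>N)"
    proof (intro nn_integral_mono_AE)
      show "AE z in N. ennreal ((cmod (f z - p z))\<^sup>2) \<le> ennreal (d\<^sup>2)"
        using K(2)
      proof eventually_elim
        case (elim z)
        then show ?case using p(2)[of z] by (intro ennreal_leI power_mono) auto
      qed
    qed
    also have "\<dots> = ennreal (d\<^sup>2 * M0)"
      using sets_eq_imp_space_eq[OF N] M0 by (simp add: ennreal_mult)
    also have "\<dots> < ennreal (\<epsilon> / 4)"
      using d M0 \<epsilon> by (simp add: e_def ennreal_less_iff)
    finally show "(\<integral>\<^sup>+z. ennreal ((cmod (f z - p z))\<^sup>2) \<partial>N) < ennreal (\<epsilon> / 4)" .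
  qed measurable
  then show "\<exists>p. polynomial_function p \<and>
      (\<integral>\<^sup>+z. ennreal ((cmod (indicator B z - p z))\<^sup>2) \<partial>N) < ennreal \<epsilon>"
    using p by auto
qed

text \<open>
Polynomials are dense in \<open>L\<^sup>2\<close> of a finite measure carried by a compact set: simple functions
are combinations of indicators, and they approximate every \<open>\<phi>\<close> with domination by \<open>2|\<phi>|\<close>.
\<close>

lemma polynomial_approximable_if_square_integrable:
  fixes N :: "'a::euclidean_space measure"
  assumes fin: "finite_measure N" and N: "sets N = sets borel"
    and K: "compact K" "AE z in N. z \<in> K"
    and phi[measurable]: "\<phi> \<in> borel_measurable N"
    and int: "(\<integral>\<^sup>+z. ennreal ((cmod (\<phi> z))\<^sup>2) \<partial>N) < \<infinity>"
  shows "polynomial_approximable N \<phi>"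
proof (rule polynomial_approximable_limit[OF N phi])
  have sp: "space N = UNIV" using sets_eq_imp_space_eq[OF N] by simp
  note ind = polynomial_approximable_indicator[OF fin N K]
  obtain s where s: "\<And>i. simple_function N (s i)" "\<And>z. (\<lambda>i. s i z) \<longlonglongrightarrow> \<phi> z"
      "\<And>i z. cmod (s i z) \<le> 2 * cmod (\<phi> z)"
    using borel_measurable_implies_sequence_metric[OF phi, of 0] sp by auto
  have s_approx: "polynomial_approximable N (s i)" for i
  proof -
    have "polynomial_approximable N (\<lambda>z. \<Sum>y\<in>Y. y * indicator (s i -` {y}) z)" if "finite Y" for Y
      using that
    proof (induction Y rule: finite_induct)
      case empty
      show ?case using polynomial_approximable_cmult[OF N ind, of "{}" 0] by simp
    next
      case (insert y Y)
      have "s i -` {y} \<in> sets borel"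
        using simple_functionD(2)[OF s(1), of i "{y}"] sp N by simp
      from polynomial_approximable_add[OF N polynomial_approximable_cmult[OF N ind[OF this], of y] insert.IH]
      show ?case
        by (simp only: sum.insert[OF insert.hyps])
    qed
    from this[of "s i ` UNIV"] have
      "polynomial_approximable N (\<lambda>z. \<Sum>y\<in>range (s i). y * indicator (s i -` {y}) z)"
      using simple_functionD(1)[OF s(1), of i] sp by simp
    moreover have "(\<Sum>y\<in>range (s i). y * indicator (s i -` {y}) z) = s i z" for z
    proof -
      have "(\<Sum>y\<in>range (s i). y * indicator (s i -` {y}) z) = (\<Sum>y\<in>range (s i). if s i z = y then y else 0)"
        by (intro sum.cong) (auto simp: indicator_def)
      then show ?thesis using simple_functionD(1)[OF s(1), of i] sp by simp
    qed
    ultimately show ?thesis by simp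
  qed
  have [measurable]: "s i \<in> borel_measurable N" for i
    using s_approx by (auto simp: polynomial_approximable_def)
  have "(\<lambda>i. \<integral>\<^sup>+z. ennreal ((cmod (\<phi> z - s i z))\<^sup>2) \<partial>N) \<longlonglongrightarrow> (\<integral>\<^sup>+z. 0 \<partial>N)"
  proof (rule nn_integral_dominated_convergence[where w = "\<lambda>z. 9 * ennreal ((cmod (\<phi> z))\<^sup>2)"])
    show "AE z in N. ennreal ((cmod (\<phi> z - s j z))\<^sup>2) \<le> 9 * ennreal ((cmod (\<phi> z))\<^sup>2)" for j
    proof (intro AE_I2)
      fix z
      have "cmod (\<phi> z - s j z) \<le> 3 * cmod (\<phi> z)"
        using norm_triangle_ineq4[of "\<phi> z" "s j z"] s(3)[of j z] by linarith
      then have "(cmod (\<phi> z - s j z))\<^sup>2 \<le> (3 * cmod (\<phi> z))\<^sup>2" by (rule power_mono) simp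
      then have "ennreal ((cmod (\<phi> z - s j z))\<^sup>2) \<le> ennreal (9 * (cmod (\<phi> z))\<^sup>2)"
        by (intro ennreal_leI) (simp add: power_mult_distrib)
      then show "ennreal ((cmod (\<phi> z - s j z))\<^sup>2) \<le> 9 * ennreal ((cmod (\<phi> z))\<^sup>2)"
        by (simp add: ennreal_mult)
    qed
    show "(\<integral>\<^sup>+z. 9 * ennreal ((cmod (\<phi> z))\<^sup>2) \<partial>N) < \<infinity>"
      using int by (simp add: nn_integral_cmult ennreal_mult_less_top)
    show "AE z in N. (\<lambda>i. ennreal ((cmod (\<phi> z - s i z))\<^sup>2)) \<longlonglongrightarrow> 0"
    proof (intro AE_I2)
      fix z
      have "(\<lambda>i. (cmod (\<phi> z - s i z))\<^sup>2) \<longlonglongrightarrow> (cmod (\<phi> z - \<phi> z))\<^sup>2"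
        by (intro tendsto_intros s)
      then have "(\<lambda>i. ennreal ((cmod (\<phi> z - s i z))\<^sup>2)) \<longlonglongrightarrow> ennreal ((cmod (\<phi> z - \<phi> z))\<^sup>2)"
        by (rule tendsto_ennrealI)
      then show "(\<lambda>i. ennreal ((cmod (\<phi> z - s i z))\<^sup>2)) \<longlonglongrightarrow> 0" by simp
    qed
  qed measurable
  then have lim: "(\<lambda>i. \<integral>\<^sup>+z. ennreal ((cmod (\<phi> z - s i z))\<^sup>2) \<partial>N) \<longlonglongrightarrow> 0" by simp
  fix \<epsilon> :: real assume "\<epsilon> > 0"
  then have "eventually (\<lambda>i. (\<integral>\<^sup>+z. ennreal ((cmod (\<phi> z - s i z))\<^sup>2) \<partial>N) < ennreal \<epsilon>) sequentially"
    by (intro order_tendstoD(2)[OF lim]) simp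
  then obtain i where "(\<integral>\<^sup>+z. ennreal ((cmod (\<phi> z - s i z))\<^sup>2) \<partial>N) < ennreal \<epsilon>"
    by (auto simp: eventually_sequentially)
  then show "\<exists>\<psi>. polynomial_approximable N \<psi> \<and>
        (\<integral>\<^sup>+z. ennreal ((cmod (\<phi> z - \<psi> z))\<^sup>2) \<partial>N) < ennreal \<epsilon>"
    using s_approx by blast
qed

section \<open>Trigonometric polynomials\<close>

definition wave :: "real \<Rightarrow> int \<Rightarrow> real \<Rightarrow> complex" where
  "wave \<beta> n x = cis (2 * pi * (\<beta> * of_int n) * x)"

inductive trig_polynomial :: "real \<Rightarrow> (real \<Rightarrow> complex) \<Rightarrow> bool" for \<beta> where
  zero: "trig_polynomial \<beta> (\<lambda>x. 0)"
| step: "trig_polynomial \<beta> p \<Longrightarrow> trig_polynomial \<beta> (\<lambda>x. p x + c * wave \<beta> n x)"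

lemma wave_mult: "wave \<beta> m x * wave \<beta> n x = wave \<beta> (m + n) x"
  by (simp add: wave_def cis_mult algebra_simps)

lemma wave_zero [simp]: "wave \<beta> 0 x = 1"
  by (simp add: wave_def)

lemma cmod_wave [simp]: "cmod (wave \<beta> n x) = 1"
  by (simp add: wave_def)

lemma cnj_wave: "cnj (wave \<beta> n x) = wave \<beta> (- n) x"
  by (simp add: wave_def cis_cnj)

lemma trig_polynomial_monomial: "trig_polynomial \<beta> (\<lambda>x. c * wave \<beta> n x)"
  using trig_polynomial.step[OF trig_polynomial.zero, of \<beta> c n] by simp

lemma trig_polynomial_const: "trig_polynomial \<beta> (\<lambda>x. c)"
  using trig_polynomial_monomial[of \<beta> c 0] by simp

lemma trig_polynomial_add:
  assumes "trig_polynomial \<beta> p" "trig_polynomial \<beta> q"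
  shows "trig_polynomial \<beta> (\<lambda>x. p x + q x)"
  using assms(2)
proof induction
  case zero
  then show ?case using assms(1) by simp
next
  case (step q c n)
  show ?case
    using trig_polynomial.step[OF step.IH, of c n] by (simp add: add.assoc)
qed

lemma trig_polynomial_mult_monomial:
  assumes "trig_polynomial \<beta> p"
  shows "trig_polynomial \<beta> (\<lambda>x. p x * (c * wave \<beta> n x))"
  using assms
proof induction
  case zero
  then show ?case using trig_polynomial.zero by simp
next
  case (step p d m)
  have "(p x + d * wave \<beta> m x) * (c * wave \<beta> n x) = p x * (c * wave \<beta> n x) + (d * c) * wave \<beta> (m + n) x" for x
    by (simp add: algebra_simps flip: wave_mult)
  then show ?case
    using trig_polynomial.step[OF step.IH, of "d * c" "m + n"] by simp
qed

lemma trig_polynomial_mult: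
  assumes "trig_polynomial \<beta> p" "trig_polynomial \<beta> q"
  shows "trig_polynomial \<beta> (\<lambda>x. p x * q x)"
  using assms(2)
proof induction
  case zero
  then show ?case using trig_polynomial.zero by simp
next
  case (step q c n)
  show ?case
    using trig_polynomial_add[OF step.IH trig_polynomial_mult_monomial[OF assms(1), of c n]]
    by (simp add: distrib_left)
qed

text \<open>
On the unit circle \<open>cnj z = 1/z\<close>, so both real coordinates of \<open>z = exp (2\<pi>i\<beta>x)\<close>, and with them all
polynomials in the coordinates, are trigonometric polynomials in \<open>x\<close>.
\<close>

lemma trig_polynomial_of_real_polynomial:
  fixes f :: "complex \<Rightarrow> real"
  assumes "real_polynomial_function f"
  shows "trig_polynomial \<beta> (\<lambda>x. of_real (f (wave \<beta> 1 x)))"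
  using assms
proof induction
  case (linear f)
  interpret bounded_linear f by fact
  have "complex_of_real (f (wave \<beta> 1 x)) = (f 1 / 2 - \<i> * (f \<i> / 2)) * wave \<beta> 1 x
      + (f 1 / 2 + \<i> * (f \<i> / 2)) * wave \<beta> (-1) x" for x
  proof -
    define z where "z = wave \<beta> 1 x"
    have "f z = f (Re z *\<^sub>R 1 + Im z *\<^sub>R \<i>)"
      by (rule arg_cong[where f = f]) (simp add: complex_eq_iff)
    also have "\<dots> = Re z * f 1 + Im z * f \<i>" by (simp only: add scale real_scaleR_def)
    finally have fz: "f z = Re z * f 1 + Im z * f \<i>" .
    have w: "wave \<beta> (-1) x = cnj z" by (simp add: z_def cnj_wave)
    show ?thesis unfolding w z_def[symmetric] fz
      by (simp add: complex_eq_iff algebra_simps)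
  qed
  then show ?case
    using trig_polynomial_add[OF trig_polynomial_monomial trig_polynomial_monomial] by simp
qed (simp_all add: trig_polynomial_const trig_polynomial_add trig_polynomial_mult)

lemma trig_polynomial_of_polynomial:
  fixes p :: "complex \<Rightarrow> complex"
  assumes "polynomial_function p"
  shows "trig_polynomial \<beta> (\<lambda>x. p (wave \<beta> 1 x))"
proof -
  have "real_polynomial_function (Re \<circ> p)" "real_polynomial_function (Im \<circ> p)"
    using assms bounded_linear_Re bounded_linear_Im unfolding polynomial_function_def by auto
  then have "trig_polynomial \<beta> (\<lambda>x. of_real ((Re \<circ> p) (wave \<beta> 1 x)) + \<i> * of_real ((Im \<circ> p) (wave \<beta> 1 x)))"
    by (intro trig_polynomial_add trig_polynomial_mult trig_polynomial_const
        trig_polynomial_of_real_polynomial)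
  then show ?thesis by (simp flip: complex_eq)
qed

lemma trig_polynomial_eq_finite_sum:
  assumes "trig_polynomial \<beta> p"
  shows "\<exists>I c. finite I \<and> p = (\<lambda>x. \<Sum>n\<in>I. c n * wave \<beta> n x)"
  using assms
proof induction
  case zero
  show ?case by (intro exI[of _ "{}"]) simp
next
  case (step p d m)
  then obtain I c where I: "finite I" and p: "p = (\<lambda>x. \<Sum>n\<in>I. c n * wave \<beta> n x)" by auto
  define c' where "c' n = (if n \<in> I then c n else 0) + (if n = m then d else 0)" for n
  have "(\<Sum>n\<in>insert m I. c' n * wave \<beta> n x) = p x + d * wave \<beta> m x" for x
  proof -
    have "(\<Sum>n\<in>insert m I. c' n * wave \<beta> n x)
        = (\<Sum>n\<in>insert m I. (if n \<in> I then c n * wave \<beta> n x else 0) + (if n = m then d * wave \<beta> n x else 0))"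
      by (intro sum.cong) (auto simp: c'_def algebra_simps)
    also have "\<dots> = (\<Sum>n\<in>insert m I. if n \<in> I then c n * wave \<beta> n x else 0) + d * wave \<beta> m x"
      using I by (simp add: sum.distrib)
    also have "(\<Sum>n\<in>insert m I. if n \<in> I then c n * wave \<beta> n x else 0) = p x"
      unfolding p using I by (intro sum.mono_neutral_cong_right) auto
    finally show ?thesis .
  qed
  then show ?case using I by (intro exI[of _ "insert m I"] exI[of _ c']) auto
qed

text \<open>
A density with respect to Lebesgue measure, rather than a restricted space, so that measurability
stays measurability on the whole line.
\<close>

definition period_measure :: "real \<Rightarrow> real \<Rightarrow> real measure" where
  "period_measure a \<beta> = density lborel (\<lambda>x. ennreal (indicator {a..<a + 1 / \<beta>} x))"

lemma sets_period_measure [simp, measurable_cong]: "sets (period_measure a \<beta>) = sets borel"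
  by (simp add: period_measure_def)

lemma space_period_measure [simp]: "space (period_measure a \<beta>) = UNIV"
  by (simp add: period_measure_def)

lemma finite_measure_period:
  assumes "\<beta> > 0"
  shows "finite_measure (period_measure a \<beta>)"
proof
  have "emeasure (period_measure a \<beta>) UNIV = (\<integral>\<^sup>+x. indicator {a..<a + 1 / \<beta>} x \<partial>lborel)"
    unfolding period_measure_def by (subst emeasure_density) (auto simp: ennreal_indicator)
  also have "\<dots> = ennreal (1 / \<beta>)" using assms by simp
  finally show "emeasure (period_measure a \<beta>) (space (period_measure a \<beta>)) \<noteq> \<infinity>" by simp
qed

lemma measure_period:
  assumes "\<beta> > 0"
  shows "measure (period_measure a \<beta>) UNIV = 1 / \<beta>"
proof -
  have "emeasure (period_measure a \<beta>) UNIV = (\<integral>\<^sup>+x. indicator {a..<a + 1 / \<beta>} x \<partial>lborel)"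
    unfolding period_measure_def by (subst emeasure_density) (auto simp: ennreal_indicator)
  also have "\<dots> = ennreal (1 / \<beta>)" using assms by simp
  finally show ?thesis using assms by (simp add: measure_def)
qed

lemma AE_period: "AE x in period_measure a \<beta>. x \<in> {a..<a + 1 / \<beta>}"
  unfolding period_measure_def by (subst AE_density) (auto simp: indicator_def)

lemma Arg2pi_borel_measurable [measurable]: "Arg2pi \<in> borel_measurable borel"
  by (rule borel_measurable_iff_greater[THEN iffD2]) (auto intro: borel_open open_Arg2pi2pi_gt)

lemma wave_measurable [measurable]: "wave \<beta> n \<in> borel_measurable borel"
  unfolding wave_def by (intro borel_measurable_continuous_onI continuous_intros)

text \<open>
A Borel inverse of \<open>x \<mapsto> exp (2\<pi>i\<beta>x)\<close> on the half-open period. It carries functions on the period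
to functions on the circle, where polynomials are available.
\<close>

lemma Arg2pi_wave:
  assumes "\<beta> > 0" "x \<in> {a..<a + 1 / \<beta>}"
  shows "a + Arg2pi (wave \<beta> 1 x * cnj (wave \<beta> 1 a)) / (2 * pi * \<beta>) = x"
proof -
  have "wave \<beta> 1 x * cnj (wave \<beta> 1 a) = cis (2 * pi * \<beta> * (x - a))"
    by (simp add: wave_def cis_cnj cis_mult algebra_simps)
  also have "Arg2pi \<dots> = 2 * pi * \<beta> * (x - a)"
  proof (rule Arg2pi_unique)
    show "of_real 1 * exp (\<i> * of_real (2 * pi * \<beta> * (x - a))) = cis (2 * pi * \<beta> * (x - a))"
      by (simp add: cis_conv_exp)
    have "\<beta> * (x - a) < 1" using assms by (simp add: field_simps)
    then have "2 * pi * (\<beta> * (x - a)) < 2 * pi * 1" by (intro mult_strict_left_mono) auto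
    then show "2 * pi * \<beta> * (x - a) < 2 * pi" by (simp add: mult.assoc)
  qed (use assms in auto)
  finally show ?thesis using assms by (simp add: field_simps)
qed

text \<open>
The image of Lebesgue measure on a period under \<open>x \<mapsto> exp (2\<pi>i\<beta>x)\<close> is a finite measure on the
circle, and polynomials on the circle pull back to trigonometric polynomials.
\<close>

lemma trig_polynomials_dense:
  assumes \<beta>: "\<beta> > 0" and [measurable]: "f \<in> borel_measurable borel"
    and int: "(\<integral>\<^sup>+x. ennreal ((cmod (f x))\<^sup>2) \<partial>period_measure a \<beta>) < \<infinity>" and \<epsilon>: "\<epsilon> > 0"
  shows "\<exists>I c. finite I \<and>
    (\<integral>\<^sup>+x. ennreal ((cmod (f x - (\<Sum>n\<in>I. c n * wave \<beta> n x)))\<^sup>2) \<partial>period_measure a \<beta>) < ennreal \<epsilon>"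
proof -
  interpret finite_measure "period_measure a \<beta>" using \<beta> by (rule finite_measure_period)
  let ?N = "distr (period_measure a \<beta>) borel (wave \<beta> 1)"
  define \<phi> where "\<phi> z = f (a + Arg2pi (z * cnj (wave \<beta> 1 a)) / (2 * pi * \<beta>))" for z
  have [measurable]: "\<phi> \<in> borel_measurable borel"
    unfolding \<phi>_def by measurable
  have \<phi>: "AE x in period_measure a \<beta>. \<phi> (wave \<beta> 1 x) = f x"
    using AE_period[of a \<beta>] by eventually_elim (use \<beta> in \<open>simp add: \<phi>_def Arg2pi_wave\<close>)
  have "polynomial_approximable ?N \<phi>"
  proof (rule polynomial_approximable_if_square_integrable)
    show "finite_measure ?N" by (rule finite_measure_distr) simp
    show "compact (sphere 0 1 :: complex set)" by simp
    show "AE z in ?N. z \<in> sphere 0 1" by (subst AE_distr_iff) auto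
    have "(\<integral>\<^sup>+z. ennreal ((cmod (\<phi> z))\<^sup>2) \<partial>?N)
        = (\<integral>\<^sup>+x. ennreal ((cmod (\<phi> (wave \<beta> 1 x)))\<^sup>2) \<partial>period_measure a \<beta>)"
      by (subst nn_integral_distr) auto
    also have "\<dots> = (\<integral>\<^sup>+x. ennreal ((cmod (f x))\<^sup>2) \<partial>period_measure a \<beta>)"
      using \<phi> by (intro nn_integral_cong_AE) auto
    finally show "(\<integral>\<^sup>+z. ennreal ((cmod (\<phi> z))\<^sup>2) \<partial>?N) < \<infinity>" using int by simp
  qed auto
  then obtain p where p: "polynomial_function p"
      "(\<integral>\<^sup>+z. ennreal ((cmod (\<phi> z - p z))\<^sup>2) \<partial>?N) < ennreal \<epsilon>"
    using \<epsilon> unfolding polynomial_approximable_def by auto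
  have [measurable]: "p \<in> borel_measurable borel"
    using p(1) by (rule polynomial_function_borel_measurable) simp
  obtain I c where I: "finite I" "(\<lambda>x. p (wave \<beta> 1 x)) = (\<lambda>x. \<Sum>n\<in>I. c n * wave \<beta> n x)"
    using trig_polynomial_eq_finite_sum[OF trig_polynomial_of_polynomial[OF p(1), of \<beta>]] by auto
  have "(\<integral>\<^sup>+x. ennreal ((cmod (f x - (\<Sum>n\<in>I. c n * wave \<beta> n x)))\<^sup>2) \<partial>period_measure a \<beta>)
      = (\<integral>\<^sup>+x. ennreal ((cmod (\<phi> (wave \<beta> 1 x) - p (wave \<beta> 1 x)))\<^sup>2) \<partial>period_measure a \<beta>)"
  proof (intro nn_integral_cong_AE)
    show "AE x in period_measure a \<beta>. ennreal ((cmod (f x - (\<Sum>n\<in>I. c n * wave \<beta> n x)))\<^sup>2)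
        = ennreal ((cmod (\<phi> (wave \<beta> 1 x) - p (wave \<beta> 1 x)))\<^sup>2)"
      using \<phi> by eventually_elim (simp add: fun_cong[OF I(2)])
  qed
  also have "\<dots> = (\<integral>\<^sup>+z. ennreal ((cmod (\<phi> z - p z))\<^sup>2) \<partial>?N)"
    by (subst nn_integral_distr) auto
  finally show ?thesis using p(2) I(1) by (intro exI[of _ I] exI[of _ c]) simp
qed

section \<open>Parseval's identity on a period of arbitrary position\<close>

lemma cnj_borel_measurable [measurable]: "cnj \<in> borel_measurable borel"
  by (intro borel_measurable_continuous_onI continuous_intros)

lemma integral_period_measure:
  fixes f :: "real \<Rightarrow> 'b::{banach, second_countable_topology}"
  assumes "f \<in> borel_measurable borel"
  shows "integral\<^sup>L (period_measure a \<beta>) f = (LINT x|lborel. indicator {a..<a + 1 / \<beta>} x *\<^sub>R f x)"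
  unfolding period_measure_def using assms by (subst integral_density) auto

lemma integrable_period_measure:
  fixes f :: "real \<Rightarrow> 'b::{banach, second_countable_topology}"
  assumes "f \<in> borel_measurable borel"
  shows "integrable (period_measure a \<beta>) f \<longleftrightarrow> integrable lborel (\<lambda>x. indicator {a..<a + 1 / \<beta>} x *\<^sub>R f x)"
  unfolding period_measure_def using assms by (subst integrable_density) auto

lemma integral_wave_period:
  assumes \<beta>: "\<beta> > 0"
  shows "(LINT x|period_measure a \<beta>. wave \<beta> n x) = (if n = 0 then of_real (1 / \<beta>) else 0)"
proof (cases "n = 0")
  case True
  have "(LINT x|period_measure a \<beta>. wave \<beta> n x) = (LINT x|period_measure a \<beta>. (1::complex))"
    by (simp add: True)
  also have "\<dots> = of_real (1 / \<beta>)"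
    using measure_period[OF \<beta>, of a] by (simp add: scaleR_conv_of_real)
  finally show ?thesis using True by simp
next
  case False
  define w where "w = 2 * pi * (\<beta> * of_int n)"
  have w: "w \<noteq> 0" using \<beta> False by (simp add: w_def)
  let ?F = "\<lambda>x. cis (w * x) / (\<i> * of_real w)"
  have wave: "wave \<beta> n x = cis (w * x)" for x by (simp add: wave_def w_def)
  have "(LINT x|period_measure a \<beta>. wave \<beta> n x)
      = (LINT x|lborel. indicator {a..<a + 1 / \<beta>} x *\<^sub>R wave \<beta> n x)"
    by (rule integral_period_measure) simp
  also have "\<dots> = (LINT x|lborel. indicator {a..a + 1 / \<beta>} x *\<^sub>R wave \<beta> n x)"
    using AE_lborel_singleton[of "a + 1 / \<beta>"]
    by (intro integral_cong_AE) (auto elim!: eventually_mono simp: indicator_def)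
  also have "\<dots> = ?F (a + 1 / \<beta>) - ?F a"
  proof (rule integral_FTC_atLeastAtMost)
    fix x
    show "(?F has_vector_derivative wave \<beta> n x) (at x within {a..a + 1 / \<beta>})"
      unfolding wave cis_conv_exp of_real_mult
      by (rule has_vector_derivative_real_field) (use w in \<open>auto intro!: derivative_eq_intros simp: algebra_simps\<close>)
  qed (use \<beta> in \<open>auto simp: wave intro!: continuous_intros\<close>)
  also have "\<dots> = 0"
  proof -
    have "w * (a + 1 / \<beta>) = w * a + 2 * pi * of_int n"
      using \<beta> by (simp add: w_def field_simps)
    then have "cis (w * (a + 1 / \<beta>)) = cis (w * a)"
      using cis_multiple_2pi[of "of_int n"] by (simp add: cis_mult[symmetric])
    then show ?thesis by simp
  qed
  finally show ?thesis using False by simp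
qed

lemma square_integrable_period_imp_integrable:
  fixes f :: "real \<Rightarrow> complex"
  assumes \<beta>: "\<beta> > 0" and [measurable]: "f \<in> borel_measurable borel"
    and int: "integrable (period_measure a \<beta>) (\<lambda>x. (cmod (f x))\<^sup>2)"
  shows "integrable (period_measure a \<beta>) f"
proof (rule Bochner_Integration.integrable_bound)
  interpret finite_measure "period_measure a \<beta>" using \<beta> by (rule finite_measure_period)
  show "integrable (period_measure a \<beta>) (\<lambda>x. 1 + (cmod (f x))\<^sup>2)"
    using int by simp
  have "t \<le> 1 + t\<^sup>2" for t :: real
    using sum_squares_bound[of 1 t] zero_le_power2[of t] by (simp only: mult_1_right one_power2)
  then show "AE x in period_measure a \<beta>. norm (f x) \<le> norm (1 + (cmod (f x))\<^sup>2)"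
    by auto
qed simp

definition fourier_coeff :: "real \<Rightarrow> real \<Rightarrow> (real \<Rightarrow> complex) \<Rightarrow> int \<Rightarrow> complex" where
  "fourier_coeff a \<beta> f n = (LINT x|period_measure a \<beta>. f x * cnj (wave \<beta> n x))"

text \<open>
Completing the square: the optimal coefficient is \<open>\<beta>\<close> times the Fourier coefficient, since the
waves have square norm \<open>1/\<beta>\<close> on the period.
\<close>

lemma square_distance_to_monomial:
  assumes \<beta>: "\<beta> > 0" and [measurable]: "f \<in> borel_measurable borel"
    and int: "integrable (period_measure a \<beta>) (\<lambda>x. (cmod (f x))\<^sup>2)"
  shows "integrable (period_measure a \<beta>) (\<lambda>x. (cmod (f x - c * wave \<beta> n x))\<^sup>2)"
    and "(LINT x|period_measure a \<beta>. (cmod (f x - c * wave \<beta> n x))\<^sup>2)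
      = (LINT x|period_measure a \<beta>. (cmod (f x))\<^sup>2) - \<beta> * (cmod (fourier_coeff a \<beta> f n))\<^sup>2
        + (cmod (c - of_real \<beta> * fourier_coeff a \<beta> f n))\<^sup>2 / \<beta>"
proof -
  interpret finite_measure "period_measure a \<beta>" using \<beta> by (rule finite_measure_period)
  let ?P = "period_measure a \<beta>"
  let ?C = "fourier_coeff a \<beta> f n"
  define R where "R x = Re (cnj c * (f x * cnj (wave \<beta> n x)))" for x
  have expand: "(cmod (f x - c * wave \<beta> n x))\<^sup>2 = (cmod (f x))\<^sup>2 - 2 * R x + (cmod c)\<^sup>2" for x
  proof -
    have "(cmod (f x - c * wave \<beta> n x))\<^sup>2
        = (cmod (f x))\<^sup>2 - 2 * Re (f x * cnj (c * wave \<beta> n x)) + (cmod (c * wave \<beta> n x))\<^sup>2"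
      unfolding cmod_power2 by (simp add: power2_eq_square algebra_simps)
    then show ?thesis unfolding R_def by (simp add: norm_mult mult.left_commute)
  qed
  have "integrable ?P f"
    using \<beta> _ int by (rule square_integrable_period_imp_integrable) simp
  then have i1: "integrable ?P (\<lambda>x. f x * cnj (wave \<beta> n x))"
    by (rule Bochner_Integration.integrable_bound) (auto simp: norm_mult)
  then have i2: "integrable ?P (\<lambda>x. cnj c * (f x * cnj (wave \<beta> n x)))" by simp
  then have i3: "integrable ?P R"
    unfolding R_def by (rule integrable_Re)
  have "integral\<^sup>L ?P R = Re (cnj c * ?C)"
    unfolding R_def using integral_Re[OF i2] i1 by (simp add: fourier_coeff_def)
  moreover have "(LINT x|?P. (cmod c)\<^sup>2) = (cmod c)\<^sup>2 / \<beta>"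
    using measure_period[OF \<beta>, of a] by simp
  ultimately have "(LINT x|?P. (cmod (f x - c * wave \<beta> n x))\<^sup>2)
      = (LINT x|?P. (cmod (f x))\<^sup>2) - 2 * Re (cnj c * ?C) + (cmod c)\<^sup>2 / \<beta>"
    unfolding expand using int i3 by simp
  moreover have "- 2 * Re (cnj c * ?C) + (cmod c)\<^sup>2 / \<beta>
      = - \<beta> * (cmod ?C)\<^sup>2 + (cmod (c - of_real \<beta> * ?C))\<^sup>2 / \<beta>"
    unfolding cmod_power2 using \<beta> by (simp add: power2_eq_square field_simps)
  ultimately show "(LINT x|?P. (cmod (f x - c * wave \<beta> n x))\<^sup>2)
      = (LINT x|?P. (cmod (f x))\<^sup>2) - \<beta> * (cmod ?C)\<^sup>2 + (cmod (c - of_real \<beta> * ?C))\<^sup>2 / \<beta>"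
    by linarith
  show "integrable ?P (\<lambda>x. (cmod (f x - c * wave \<beta> n x))\<^sup>2)"
    unfolding expand using int i3 by simp
qed

lemma fourier_coeff_diff_monomial:
  assumes \<beta>: "\<beta> > 0" and f: "integrable (period_measure a \<beta>) f" and "m \<noteq> n"
  shows "fourier_coeff a \<beta> (\<lambda>x. f x - c * wave \<beta> n x) m = fourier_coeff a \<beta> f m"
proof -
  interpret finite_measure "period_measure a \<beta>" using \<beta> by (rule finite_measure_period)
  let ?P = "period_measure a \<beta>"
  have [measurable]: "f \<in> borel_measurable ?P" using f by auto
  have i1: "integrable ?P (\<lambda>x. f x * cnj (wave \<beta> m x))"
    using f by (rule Bochner_Integration.integrable_bound) (auto simp: norm_mult)
  have i2: "integrable ?P (\<lambda>x. wave \<beta> (n - m) x)"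
    by (rule integrable_const_bound[where B = 1]) auto
  have "(f x - c * wave \<beta> n x) * cnj (wave \<beta> m x)
      = f x * cnj (wave \<beta> m x) - c * wave \<beta> (n - m) x" for x
    using wave_mult[of \<beta> n x "- m"] by (simp add: cnj_wave algebra_simps)
  then have "fourier_coeff a \<beta> (\<lambda>x. f x - c * wave \<beta> n x) m
      = fourier_coeff a \<beta> f m - c * (LINT x|?P. wave \<beta> (n - m) x)"
    unfolding fourier_coeff_def using i1 i2 by simp
  then show ?thesis using assms(3) by (simp add: integral_wave_period[OF \<beta>])
qed

text \<open>
One exact formula serves twice: the choice \<open>c = \<beta> * fourier_coeff\<close> makes the last sum vanish and
gives Bessel's inequality, and a good trigonometric approximation \<open>c\<close> of \<open>f\<close> shows that nothing is
lost. The statement on coefficients outside \<open>I\<close> carries the induction.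
\<close>

lemma square_distance_to_trig_polynomial:
  assumes \<beta>: "\<beta> > 0" and [measurable]: "f \<in> borel_measurable borel"
    and int: "integrable (period_measure a \<beta>) (\<lambda>x. (cmod (f x))\<^sup>2)" and "finite I"
  shows "integrable (period_measure a \<beta>) (\<lambda>x. (cmod (f x - (\<Sum>n\<in>I. c n * wave \<beta> n x)))\<^sup>2) \<and>
    (\<forall>m. m \<notin> I \<longrightarrow> fourier_coeff a \<beta> (\<lambda>x. f x - (\<Sum>n\<in>I. c n * wave \<beta> n x)) m = fourier_coeff a \<beta> f m) \<and>
    (LINT x|period_measure a \<beta>. (cmod (f x - (\<Sum>n\<in>I. c n * wave \<beta> n x)))\<^sup>2)
      = (LINT x|period_measure a \<beta>. (cmod (f x))\<^sup>2) - \<beta> * (\<Sum>n\<in>I. (cmod (fourier_coeff a \<beta> f n))\<^sup>2)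
        + (\<Sum>n\<in>I. (cmod (c n - of_real \<beta> * fourier_coeff a \<beta> f n))\<^sup>2) / \<beta>"
  using \<open>finite I\<close>
proof induction
  case empty
  then show ?case using int by simp
next
  case (insert k I)
  let ?P = "period_measure a \<beta>"
  let ?F = "\<lambda>x. f x - (\<Sum>n\<in>I. c n * wave \<beta> n x)"
  have [measurable]: "?F \<in> borel_measurable borel" by measurable
  have F: "integrable ?P (\<lambda>x. (cmod (?F x))\<^sup>2)" using insert by blast
  have F': "integrable ?P ?F"
    using \<beta> _ F by (rule square_integrable_period_imp_integrable) simp
  have eq: "f x - (\<Sum>n\<in>insert k I. c n * wave \<beta> n x) = ?F x - c k * wave \<beta> k x" for x
    using insert by simp
  note step = square_distance_to_monomial[OF \<beta> _ F, of "c k" k]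
  have Ck: "fourier_coeff a \<beta> ?F k = fourier_coeff a \<beta> f k" using insert by blast
  have "\<forall>m. m \<notin> insert k I \<longrightarrow> fourier_coeff a \<beta> (\<lambda>x. ?F x - c k * wave \<beta> k x) m = fourier_coeff a \<beta> f m"
    using insert fourier_coeff_diff_monomial[OF \<beta> F', of _ k "c k"] by auto
  moreover have "(LINT x|?P. (cmod (?F x - c k * wave \<beta> k x))\<^sup>2)
      = (LINT x|?P. (cmod (f x))\<^sup>2) - \<beta> * (\<Sum>n\<in>insert k I. (cmod (fourier_coeff a \<beta> f n))\<^sup>2)
        + (\<Sum>n\<in>insert k I. (cmod (c n - of_real \<beta> * fourier_coeff a \<beta> f n))\<^sup>2) / \<beta>"
    using insert step(2) Ck by (simp add: algebra_simps add_divide_distrib)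
  ultimately show ?case unfolding eq using step(1) by simp
qed

theorem parseval:
  assumes \<beta>: "\<beta> > 0" and f[measurable]: "f \<in> borel_measurable borel"
    and int: "integrable (period_measure a \<beta>) (\<lambda>x. (cmod (f x))\<^sup>2)"
  shows "((\<lambda>n. (cmod (fourier_coeff a \<beta> f n))\<^sup>2) has_sum
    (LINT x|period_measure a \<beta>. (cmod (f x))\<^sup>2) / \<beta>) UNIV"
proof -
  let ?P = "period_measure a \<beta>"
  let ?s = "\<lambda>n. (cmod (fourier_coeff a \<beta> f n))\<^sup>2"
  let ?T = "LINT x|?P. (cmod (f x))\<^sup>2"
  note dist = square_distance_to_trig_polynomial[OF \<beta> f int]
  have upper: "sum ?s I \<le> ?T / \<beta>" if "finite I" for I
  proof -
    have "0 \<le> (LINT x|?P. (cmod (f x - (\<Sum>n\<in>I. of_real \<beta> * fourier_coeff a \<beta> f n * wave \<beta> n x)))\<^sup>2)"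
      by simp
    also have "\<dots> = ?T - \<beta> * sum ?s I"
      using dist[OF that, of "\<lambda>n. of_real \<beta> * fourier_coeff a \<beta> f n"] by simp
    finally show ?thesis using \<beta> by (simp add: field_simps)
  qed
  have lower: "\<exists>I. finite I \<and> ?T / \<beta> - \<epsilon> < sum ?s I" if \<epsilon>: "\<epsilon> > 0" for \<epsilon>
  proof -
    have "(\<integral>\<^sup>+x. ennreal ((cmod (f x))\<^sup>2) \<partial>?P) < \<infinity>"
      using int by (simp add: nn_integral_eq_integral)
    then obtain I c where I: "finite I"
      "(\<integral>\<^sup>+x. ennreal ((cmod (f x - (\<Sum>n\<in>I. c n * wave \<beta> n x)))\<^sup>2) \<partial>?P) < ennreal (\<beta> * \<epsilon>)"
      using trig_polynomials_dense[OF \<beta> f, of a "\<beta> * \<epsilon>"] \<beta> \<epsilon> by auto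
    have "(LINT x|?P. (cmod (f x - (\<Sum>n\<in>I. c n * wave \<beta> n x)))\<^sup>2) < \<beta> * \<epsilon>"
      using I(2) conjunct1[OF dist[OF I(1), of c]] by (simp add: nn_integral_eq_integral ennreal_less_iff)
    moreover have "?T - \<beta> * sum ?s I \<le> (LINT x|?P. (cmod (f x - (\<Sum>n\<in>I. c n * wave \<beta> n x)))\<^sup>2)"
      using dist[OF I(1), of c] \<beta> by (simp add: sum_nonneg)
    ultimately have "?T - \<beta> * sum ?s I < \<beta> * \<epsilon>" by linarith
    then have "?T / \<beta> - \<epsilon> < sum ?s I" using \<beta> by (simp add: field_simps)
    then show ?thesis using I(1) by blast
  qed
  show ?thesis
    unfolding has_sum_def
  proof (rule order_tendstoI)
    fix y assume "y < ?T / \<beta>"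
    then obtain I where I: "finite I" "y < sum ?s I" using lower[of "?T / \<beta> - y"] by auto
    show "\<forall>\<^sub>F J in finite_subsets_at_top UNIV. y < sum ?s J"
      unfolding eventually_finite_subsets_at_top
    proof (intro exI[of _ I] conjI allI impI)
      fix J assume "finite J \<and> I \<subseteq> J \<and> J \<subseteq> UNIV"
      then have "sum ?s I \<le> sum ?s J" by (intro sum_mono2) auto
      then show "y < sum ?s J" using I(2) by simp
    qed (use I in auto)
  next
    fix y assume "?T / \<beta> < y"
    then show "\<forall>\<^sub>F J in finite_subsets_at_top UNIV. sum ?s J < y"
      unfolding eventually_finite_subsets_at_top
      using upper by (intro exI[of _ "{}"]) (auto intro: le_less_trans)
  qed
qed

section \<open>Periodization and the fibers of a function\<close>

lemma integral_period_shift: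
  fixes F :: "real \<Rightarrow> 'b::{banach, second_countable_topology}"
  assumes \<beta>: "\<beta> > 0" and F: "integrable lborel F"
  shows "integrable (period_measure a \<beta>) (\<lambda>x. F (x + t))"
    and "(LINT x|lborel. indicator {a + t..<a + t + 1 / \<beta>} x *\<^sub>R F x) = (LINT x|period_measure a \<beta>. F (x + t))"
proof -
  have [measurable]: "F \<in> borel_measurable borel" using F by auto
  have "integrable lborel (\<lambda>x. F (t + 1 * x))"
    using F by (rule lborel_integrable_real_affine) simp
  then show "integrable (period_measure a \<beta>) (\<lambda>x. F (x + t))"
    by (subst integrable_period_measure) (auto simp: add.commute intro!: integrable_real_mult_indicator integrable_mult_indicator)
  have "(LINT x|lborel. indicator {a + t..<a + t + 1 / \<beta>} x *\<^sub>R F x)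
      = (LINT x|lborel. indicator {a + t..<a + t + 1 / \<beta>} (t + 1 * x) *\<^sub>R F (t + 1 * x))"
    by (subst lborel_integral_real_affine[of 1 _ t]) auto
  also have "\<dots> = (LINT x|lborel. indicator {a..<a + 1 / \<beta>} x *\<^sub>R F (x + t))"
    by (intro Bochner_Integration.integral_cong) (auto simp: indicator_def add.commute)
  also have "\<dots> = (LINT x|period_measure a \<beta>. F (x + t))"
    by (subst integral_period_measure) auto
  finally show "(LINT x|lborel. indicator {a + t..<a + t + 1 / \<beta>} x *\<^sub>R F x) = (LINT x|period_measure a \<beta>. F (x + t))" .
qed

lemma integral_periodize:
  fixes F :: "real \<Rightarrow> 'b::{banach, second_countable_topology}"
  assumes \<beta>: "\<beta> > 0" and F: "integrable lborel F"
    and supp: "\<And>x. x \<notin> {a..<a + real N / \<beta>} \<Longrightarrow> F x = 0"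
  shows "integral\<^sup>L lborel F = (LINT x|period_measure a \<beta>. (\<Sum>k<N. F (x + real k / \<beta>)))"
proof -
  let ?C = "\<lambda>k. {a + real k / \<beta>..<a + real k / \<beta> + 1 / \<beta>}"
  have C: "?C k = {a + real k / \<beta>..<a + real (Suc k) / \<beta>}" for k
    using \<beta> by (simp add: field_simps)
  have cell: "(\<Sum>k<n. indicator (?C k) x *\<^sub>R F x) = indicator {a..<a + real n / \<beta>} x *\<^sub>R F x" for n x
  proof (induction n)
    case (Suc n)
    have "a \<le> a + real n / \<beta>" "a + real n / \<beta> \<le> a + real (Suc n) / \<beta>"
      using \<beta> by (auto simp: field_simps)
    then have "indicator {a..<a + real (Suc n) / \<beta>} x
        = (indicator {a..<a + real n / \<beta>} x + indicator {a + real n / \<beta>..<a + real (Suc n) / \<beta>} x :: real)"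
      by (auto simp: indicator_def)
    then show ?case using Suc.IH unfolding C by (simp add: scaleR_add_left)
  qed simp
  have "integral\<^sup>L lborel F = (LINT x|lborel. (\<Sum>k<N. indicator (?C k) x *\<^sub>R F x))"
    unfolding cell using supp by (intro Bochner_Integration.integral_cong) (auto simp: indicator_def)
  also have "\<dots> = (\<Sum>k<N. LINT x|lborel. indicator (?C k) x *\<^sub>R F x)"
    using F by (intro Bochner_Integration.integral_sum integrable_mult_indicator) auto
  also have "\<dots> = (\<Sum>k<N. LINT x|period_measure a \<beta>. F (x + real k / \<beta>))"
    using integral_period_shift(2)[OF \<beta> F] by simp
  also have "\<dots> = (LINT x|period_measure a \<beta>. (\<Sum>k<N. F (x + real k / \<beta>)))"
    using integral_period_shift(1)[OF \<beta> F] by (simp add: Bochner_Integration.integral_sum)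
  finally show ?thesis .
qed

text \<open>
Row \<open>m\<close> of the matrix \<open>(g(x + k/\<beta> - \<alpha>m))\<^bsub>m,k\<^esub>\<close>, applied to the vector of the values \<open>h(x + k/\<beta>)\<close>,
\<open>k < N\<close>.
\<close>

definition fiber :: "(real \<Rightarrow> real) \<Rightarrow> real \<Rightarrow> real \<Rightarrow> nat \<Rightarrow> (real \<Rightarrow> complex) \<Rightarrow> int \<Rightarrow> real \<Rightarrow> complex" where
  "fiber g \<alpha> \<beta> N h m x =
     (\<Sum>k<N. h (x + real k / \<beta>) * of_real (g (x + real k / \<beta> - \<alpha> * of_int m)))"

lemma wave_periodic:
  assumes "\<beta> > 0"
  shows "wave \<beta> n (x + real k / \<beta>) = wave \<beta> n x"
proof -
  have "2 * pi * (\<beta> * real_of_int n) * (x + real k / \<beta>)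
      = 2 * pi * (\<beta> * real_of_int n) * x + 2 * pi * real_of_int (n * int k)"
    using assms by (simp add: field_simps)
  then show ?thesis
    unfolding wave_def using cis_multiple_2pi[OF Ints_of_int, of "n * int k"]
    by (simp only: cis_mult[symmetric] mult_1_right)
qed

lemma cmod_sum_squared_le:
  fixes c :: "nat \<Rightarrow> complex"
  shows "(cmod (\<Sum>k<N. c k))\<^sup>2 \<le> real N * (\<Sum>k<N. (cmod (c k))\<^sup>2)"
proof -
  have "(cmod (\<Sum>k<N. c k))\<^sup>2 \<le> (\<Sum>k<N. cmod (c k))\<^sup>2"
    by (intro power_mono norm_sum) simp
  also have "\<dots> \<le> (\<Sum>k<N. (cmod (c k))\<^sup>2) * card {..<N}"
    by (rule sum_squared_le_sum_of_squares)
  finally show ?thesis by (simp add: mult.commute)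
qed

context
  fixes g :: "real \<Rightarrow> real" and G \<alpha> \<beta> a :: real and N :: nat and h :: "real \<Rightarrow> complex"
  assumes \<beta>: "\<beta> > 0"
    and g[measurable]: "g \<in> borel_measurable borel" and G: "\<And>x. \<bar>g x\<bar> \<le> G"
    and h[measurable]: "h \<in> borel_measurable borel"
    and h2: "integrable lborel (\<lambda>x. (cmod (h x))\<^sup>2)"
    and supp: "\<And>x. x \<notin> {a..<a + real N / \<beta>} \<Longrightarrow> h x = 0"
begin

lemma fiber_measurable [measurable]: "fiber g \<alpha> \<beta> N h m \<in> borel_measurable borel"
  unfolding fiber_def by measurable

lemma L2_norm_fiber:
  "(L2_norm h)\<^sup>2 = (LINT x|period_measure a \<beta>. (\<Sum>k<N. (cmod (h (x + real k / \<beta>)))\<^sup>2))"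
proof -
  have "(L2_norm h)\<^sup>2 = (LINT x|lborel. (cmod (h x))\<^sup>2)"
    unfolding L2_norm_def by (subst integral_completion) auto
  also have "\<dots> = (LINT x|period_measure a \<beta>. (\<Sum>k<N. (cmod (h (x + real k / \<beta>)))\<^sup>2))"
    using supp by (intro integral_periodize[OF \<beta> h2]) auto
  finally show ?thesis .
qed

lemma integrable_fiber_norm:
  "integrable (period_measure a \<beta>) (\<lambda>x. \<Sum>k<N. (cmod (h (x + real k / \<beta>)))\<^sup>2)"
  using integral_period_shift(1)[OF \<beta> h2] by (intro Bochner_Integration.integrable_sum) auto

lemma integrable_fiber_square:
  "integrable (period_measure a \<beta>) (\<lambda>x. (cmod (fiber g \<alpha> \<beta> N h m x))\<^sup>2)"
proof (rule Bochner_Integration.integrable_bound)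
  show "integrable (period_measure a \<beta>) (\<lambda>x. real N * G\<^sup>2 * (\<Sum>k<N. (cmod (h (x + real k / \<beta>)))\<^sup>2))"
    using integrable_fiber_norm by simp
  have G2: "(g x)\<^sup>2 \<le> G\<^sup>2" for x
    using G[of x] by (simp add: abs_le_square_iff[symmetric])
  have "(cmod (fiber g \<alpha> \<beta> N h m x))\<^sup>2 \<le> real N * G\<^sup>2 * (\<Sum>k<N. (cmod (h (x + real k / \<beta>)))\<^sup>2)" for x
  proof -
    have "(cmod (fiber g \<alpha> \<beta> N h m x))\<^sup>2 \<le> real N *
        (\<Sum>k<N. (cmod (h (x + real k / \<beta>) * of_real (g (x + real k / \<beta> - \<alpha> * of_int m))))\<^sup>2)"
      unfolding fiber_def by (rule cmod_sum_squared_le)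
    also have "\<dots> \<le> real N * (\<Sum>k<N. G\<^sup>2 * (cmod (h (x + real k / \<beta>)))\<^sup>2)"
    proof (intro mult_left_mono sum_mono)
      fix k
      show "(cmod (h (x + real k / \<beta>) * of_real (g (x + real k / \<beta> - \<alpha> * of_int m))))\<^sup>2
          \<le> G\<^sup>2 * (cmod (h (x + real k / \<beta>)))\<^sup>2"
        using mult_right_mono[OF G2[of "x + real k / \<beta> - \<alpha> * of_int m"] zero_le_power2[of "cmod (h (x + real k / \<beta>))"]]
        by (simp add: norm_mult power_mult_distrib mult.commute)
    qed simp
    finally show ?thesis by (simp add: sum_distrib_left mult.assoc)
  qed
  then show "AE x in period_measure a \<beta>. norm ((cmod (fiber g \<alpha> \<beta> N h m x))\<^sup>2)
      \<le> norm (real N * G\<^sup>2 * (\<Sum>k<N. (cmod (h (x + real k / \<beta>)))\<^sup>2))"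
    by (auto simp: sum_nonneg)
qed measurable

text \<open>
Modulation by \<open>\<beta>n\<close> has period \<open>1/\<beta>\<close>, so it factors out of the periodization.
\<close>

lemma L2_inner_gabor_eq_fourier_coeff:
  "L2_inner h (gabor_system (\<lambda>x. of_real (g x)) \<alpha> \<beta> (m, n)) = fourier_coeff a \<beta> (fiber g \<alpha> \<beta> N h m) n"
proof -
  let ?F = "\<lambda>x. h x * of_real (g (x - \<alpha> * of_int m)) * cnj (wave \<beta> n x)"
  have int: "integrable lborel ?F"
  proof (rule Bochner_Integration.integrable_bound)
    have "emeasure lborel {a..<a + real N / \<beta>} < \<infinity>" using \<beta> by simp
    then have "integrable lborel (indicator {a..<a + real N / \<beta>} :: real \<Rightarrow> real)"
      by (intro integrable_real_indicator) auto
    then show "integrable lborel (\<lambda>x. G * (indicator {a..<a + real N / \<beta>} x + (cmod (h x))\<^sup>2))"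
      using h2 by simp
    have G0: "0 \<le> G" using G[of 0] abs_ge_zero order_trans by blast
    have "cmod (?F x) \<le> G * (indicator {a..<a + real N / \<beta>} x + (cmod (h x))\<^sup>2)" for x
    proof -
      have "cmod (h x) \<le> indicator {a..<a + real N / \<beta>} x + (cmod (h x))\<^sup>2"
      proof (cases "x \<in> {a..<a + real N / \<beta>}")
        case True
        have "2 * cmod (h x) \<le> 1 + (cmod (h x))\<^sup>2"
          using sum_squares_bound[of 1 "cmod (h x)"] by simp
        then have "cmod (h x) \<le> 1 + (cmod (h x))\<^sup>2" using norm_ge_zero[of "h x"] by linarith
        then show ?thesis using True by simp
      qed (simp add: supp)
      then have "cmod (h x) * \<bar>g (x - \<alpha> * of_int m)\<bar>
          \<le> (indicator {a..<a + real N / \<beta>} x + (cmod (h x))\<^sup>2) * G"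
        using G by (intro mult_mono) (auto intro: order_trans[OF norm_ge_zero])
      then show ?thesis by (simp add: norm_mult mult.commute)
    qed
    then show "AE x in lborel. cmod (?F x) \<le> norm (G * (indicator {a..<a + real N / \<beta>} x + (cmod (h x))\<^sup>2))"
      using G0 by (auto intro!: always_eventually order_trans[OF _ abs_ge_self])
  qed measurable
  have "L2_inner h (gabor_system (\<lambda>x. of_real (g x)) \<alpha> \<beta> (m, n))
      = (LINT x|lebesgue. ?F x)"
    unfolding L2_inner_def gabor_system_def tf_shift_def wave_def by (simp add: algebra_simps)
  also have "\<dots> = (LINT x|lborel. ?F x)"
    by (subst integral_completion) auto
  also have "\<dots> = (LINT x|period_measure a \<beta>. (\<Sum>k<N. ?F (x + real k / \<beta>)))"
    by (rule integral_periodize[OF \<beta> int]) (simp add: supp)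
  also have "\<dots> = fourier_coeff a \<beta> (fiber g \<alpha> \<beta> N h m) n"
    unfolding fourier_coeff_def fiber_def wave_periodic[OF \<beta>] by (simp add: sum_distrib_right)
  finally show ?thesis .
qed

theorem gabor_coefficients_has_sum:
  "((\<lambda>n. (cmod (L2_inner h (gabor_system (\<lambda>x. of_real (g x)) \<alpha> \<beta> (m, n))))\<^sup>2) has_sum
     (LINT x|period_measure a \<beta>. (cmod (fiber g \<alpha> \<beta> N h m x))\<^sup>2) / \<beta>) UNIV"
  unfolding L2_inner_gabor_eq_fourier_coeff
  by (intro parseval \<beta> integrable_fiber_square) measurable

end

section \<open>Matrices with monotone decaying rows\<close>

lemma schur_test:
  fixes K :: "'a \<Rightarrow> 'b \<Rightarrow> real" and u :: "'b \<Rightarrow> real"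
  assumes fin: "finite I" "finite J" and K: "\<And>i j. i \<in> I \<Longrightarrow> j \<in> J \<Longrightarrow> 0 \<le> K i j"
    and R: "\<And>i. i \<in> I \<Longrightarrow> (\<Sum>j\<in>J. K i j) \<le> R" and C: "\<And>j. j \<in> J \<Longrightarrow> (\<Sum>i\<in>I. K i j) \<le> C"
    and "0 \<le> R"
  shows "(\<Sum>i\<in>I. (\<Sum>j\<in>J. K i j * u j)\<^sup>2) \<le> R * C * (\<Sum>j\<in>J. (u j)\<^sup>2)"
proof -
  have row: "(\<Sum>j\<in>J. K i j * u j)\<^sup>2 \<le> R * (\<Sum>j\<in>J. K i j * (u j)\<^sup>2)" if i: "i \<in> I" for i
  proof -
    have "(\<Sum>j\<in>J. K i j * u j) = (\<Sum>j\<in>J. sqrt (K i j) * (sqrt (K i j) * u j))"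
      using K[OF i]
      by (intro sum.cong) (simp_all only: mult.assoc[symmetric] real_sqrt_mult_self abs_of_nonneg)
    then have "(\<Sum>j\<in>J. K i j * u j)\<^sup>2 = (\<Sum>j\<in>J. sqrt (K i j) * (sqrt (K i j) * u j))\<^sup>2" by simp
    also have "\<dots> \<le> (\<Sum>j\<in>J. (sqrt (K i j))\<^sup>2) * (\<Sum>j\<in>J. (sqrt (K i j) * u j)\<^sup>2)"
      by (rule Cauchy_Schwarz_ineq_sum)
    also have "\<dots> = (\<Sum>j\<in>J. K i j) * (\<Sum>j\<in>J. K i j * (u j)\<^sup>2)"
      using K[OF i] by (simp add: power_mult_distrib)
    also have "\<dots> \<le> R * (\<Sum>j\<in>J. K i j * (u j)\<^sup>2)"
      using K[OF i] by (intro mult_right_mono R i sum_nonneg) auto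
    finally show ?thesis .
  qed
  have "(\<Sum>i\<in>I. (\<Sum>j\<in>J. K i j * u j)\<^sup>2) \<le> (\<Sum>i\<in>I. R * (\<Sum>j\<in>J. K i j * (u j)\<^sup>2))"
    by (intro sum_mono row)
  also have "\<dots> = R * (\<Sum>j\<in>J. (\<Sum>i\<in>I. K i j) * (u j)\<^sup>2)"
    by (subst sum_distrib_left[symmetric], subst sum.swap) (simp add: sum_distrib_right)
  also have "\<dots> \<le> R * (\<Sum>j\<in>J. C * (u j)\<^sup>2)"
    using \<open>0 \<le> R\<close> by (intro mult_left_mono sum_mono mult_right_mono C) auto
  finally show ?thesis by (simp add: sum_distrib_left mult.assoc)
qed

lemma sum_power_le:
  fixes q :: real and \<phi> :: "'a \<Rightarrow> nat"
  assumes "finite I" "inj_on \<phi> I" "0 \<le> q" "q < 1"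
  shows "(\<Sum>i\<in>I. q ^ \<phi> i) \<le> 1 / (1 - q)"
proof -
  have "(\<Sum>i\<in>I. q ^ \<phi> i) = (\<Sum>n\<in>\<phi> ` I. q ^ n)"
    using assms(2) by (simp add: sum.reindex)
  also have "\<dots> \<le> (\<Sum>n. q ^ n)"
    using assms by (intro sum_le_suminf summable_geometric) auto
  also have "\<dots> = 1 / (1 - q)" using assms by (intro suminf_geometric) auto
  finally show ?thesis .
qed

text \<open>
The mechanism of the Enestroem-Kakeya theorem. Write \<open>d\<^sub>j\<close> for the tail sums of \<open>c\<close> and \<open>f\<^sub>j\<close> for the
weighted ones. Summation by parts gives \<open>d\<^sub>i = f\<^sub>i + \<Sum>\<^bsub>j>i\<^esub> (b\<^bsub>i,j-1\<^esub> - b\<^bsub>i,j\<^esub>) d\<^sub>j\<close>. The coefficients on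
the right are nonnegative and telescope to at most \<open>b\<^bsub>i,i\<^esub> = 1\<close>, so \<open>|d\<^sub>i|\<close> exceeds the largest later
\<open>|d\<^sub>j|\<close> by at most \<open>|f\<^sub>i|\<close>.
\<close>

lemma decreasing_weights_bound:
  fixes b :: "nat \<Rightarrow> nat \<Rightarrow> real" and c :: "nat \<Rightarrow> complex"
  assumes diag: "\<And>i. i < N \<Longrightarrow> b i i = 1"
    and nonneg: "\<And>i j. i \<le> j \<Longrightarrow> j < N \<Longrightarrow> 0 \<le> b i j"
    and dec: "\<And>i j. i \<le> j \<Longrightarrow> Suc j < N \<Longrightarrow> b i (Suc j) \<le> b i j"
    and "i \<le> N"
  shows "cmod (\<Sum>j=i..<N. c j) \<le> (\<Sum>j=i..<N. cmod (\<Sum>l=j..<N. of_real (b j l) * c l))"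
  using \<open>i \<le> N\<close>
proof (induction "N - i" arbitrary: i rule: less_induct)
  case less
  define d where "d j = (\<Sum>l=j..<N. c l)" for j
  define f where "f j = (\<Sum>l=j..<N. of_real (b j l) * c l)" for j
  show ?case
  proof (cases "i = N")
    case False
    then have i: "i < N" using less.prems by simp
    define E where "E = (\<Sum>j=Suc i..<N. cmod (f j))"
    have dE: "cmod (d l) \<le> E" if "i < l" "l \<le> N" for l
    proof -
      have "cmod (d l) \<le> (\<Sum>j=l..<N. cmod (f j))"
        unfolding d_def f_def using that i by (intro less.hyps) auto
      also have "\<dots> \<le> E" unfolding E_def using that by (intro sum_mono2) auto
      finally show ?thesis .
    qed
    have dSuc: "d p = c p + d (Suc p)" if "p < N" for p
      using that unfolding d_def by (simp add: sum.atLeast_Suc_lessThan)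
    \<comment> \<open>Partial summation up to \<open>p\<close>; the correction terms so far use up the decrease \<open>1 - b i p\<close> of the weights.\<close>
    have "p < N \<longrightarrow> cmod (d i - (\<Sum>l=i..<Suc p. of_real (b i l) * c l) - of_real (b i p) * d (Suc p))
        \<le> (1 - b i p) * E" if "i \<le> p" for p
      using that
    proof (induction p rule: dec_induct)
      case base
      show ?case using diag[OF i] dSuc[OF i] by simp
    next
      case (step p)
      show ?case
      proof
        assume p: "Suc p < N"
        define D where "D p = d i - (\<Sum>l=i..<Suc p. of_real (b i l) * c l) - of_real (b i p) * d (Suc p)" for p
        have "D (Suc p) = D p + of_real (b i p - b i (Suc p)) * d (Suc p)"
          using step.hyps dSuc[OF p] by (simp add: D_def algebra_simps)
        then have "cmod (D (Suc p)) \<le> cmod (D p) + \<bar>b i p - b i (Suc p)\<bar> * cmod (d (Suc p))"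
          using norm_triangle_ineq[of "D p" "of_real (b i p - b i (Suc p)) * d (Suc p)"]
          by (simp only: norm_mult norm_of_real)
        also have "\<dots> \<le> (1 - b i p) * E + (b i p - b i (Suc p)) * E"
          using step p dec[of i p] dE[of "Suc p"] by (intro add_mono mult_mono) (auto simp: D_def)
        finally have "cmod (D (Suc p)) \<le> (1 - b i (Suc p)) * E" by (simp add: algebra_simps)
        then show "cmod (d i - (\<Sum>l=i..<Suc (Suc p). of_real (b i l) * c l) - of_real (b i (Suc p)) * d (Suc (Suc p)))
            \<le> (1 - b i (Suc p)) * E" by (simp only: D_def)
      qed
    qed
    from this[of "N - 1"] have "cmod (d i - f i) \<le> (1 - b i (N - 1)) * E"
      using i by (simp add: f_def d_def)
    also have "\<dots> \<le> 1 * E"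
      using nonneg[of i "N - 1"] i by (intro mult_right_mono) (auto simp: E_def sum_nonneg)
    finally have "cmod (d i) \<le> cmod (f i) + E"
      using norm_triangle_ineq[of "f i" "d i - f i"] by simp
    also have "\<dots> = (\<Sum>j=i..<N. cmod (f j))"
      unfolding E_def using i by (simp add: sum.atLeast_Suc_lessThan)
    finally show ?thesis unfolding d_def f_def .
  qed simp
qed

text \<open>
Dividing the entry \<open>(i,j)\<close> by \<open>r\<^bsub>i,i\<^esub> q\<^bsup>j-i\<^esup>\<close> and replacing \<open>c\<^sub>j\<close> by \<open>q\<^sup>j c\<^sub>j\<close> makes the rows nonincreasing from \<open>1\<close>.
As \<open>c\<^sub>i\<close> is a difference of two tail sums, \<open>decreasing_weights_bound\<close> yields
\<open>|c\<^sub>i| \<le> (2/\<delta>) \<Sum>\<^bsub>j\<ge>i\<^esub> q\<^bsup>j-i\<^esup> |f\<^sub>j|\<close> for the image \<open>f\<close> of \<open>c\<close>, and Schur's test with geometric row and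
column sums finishes. The constant depends neither on \<open>N\<close> nor on the entries, which is what makes
the bound uniform in \<open>x\<close>.
\<close>

theorem triangular_lower_bound:
  fixes r :: "nat \<Rightarrow> nat \<Rightarrow> real" and c :: "nat \<Rightarrow> complex"
  assumes q: "0 < q" "q < 1" and \<delta>: "\<delta> > 0"
    and diag: "\<And>i. i < N \<Longrightarrow> \<delta> \<le> r i i"
    and nonneg: "\<And>i j. i \<le> j \<Longrightarrow> j < N \<Longrightarrow> 0 \<le> r i j"
    and dec: "\<And>i j. i \<le> j \<Longrightarrow> Suc j < N \<Longrightarrow> r i (Suc j) \<le> q * r i j"
  shows "(\<Sum>k<N. (cmod (c k))\<^sup>2)
    \<le> (2 / (\<delta> * (1 - q)))\<^sup>2 * (\<Sum>i<N. (cmod (\<Sum>j=i..<N. of_real (r i j) * c j))\<^sup>2)"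
proof -
  define f where "f i = (\<Sum>j=i..<N. of_real (r i j) * c j)" for i
  define b where "b i j = r i j / (r i i * q ^ (j - i))" for i j
  define c' where "c' j = of_real (q ^ j) * c j" for j
  have pos: "0 < r i i" if "i < N" for i using diag[OF that] \<delta> by linarith
  have f': "cmod (\<Sum>l=j..<N. of_real (b j l) * c' l) \<le> q ^ j * cmod (f j) / \<delta>" if j: "j < N" for j
  proof -
    have "(\<Sum>l=j..<N. of_real (b j l) * c' l) = (\<Sum>l=j..<N. of_real (q ^ j / r j j) * (of_real (r j l) * c l))"
    proof (intro sum.cong refl)
      fix l assume l: "l \<in> {j..<N}"
      have "q ^ l = q ^ j * q ^ (l - j)" using l by (simp flip: power_add)
      then have "b j l * q ^ l = q ^ j / r j j * r j l"
        using q pos[OF j] by (simp add: b_def field_simps)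
      then show "of_real (b j l) * c' l = of_real (q ^ j / r j j) * (of_real (r j l) * c l)"
        unfolding c'_def by (metis mult.assoc of_real_mult)
    qed
    also have "\<dots> = of_real (q ^ j / r j j) * f j" by (simp add: f_def sum_distrib_left)
    finally have "cmod (\<Sum>l=j..<N. of_real (b j l) * c' l) = \<bar>q ^ j / r j j\<bar> * cmod (f j)"
      by (simp only: norm_mult norm_of_real)
    also have "\<dots> = q ^ j * cmod (f j) / r j j"
      using q pos[OF j] by simp
    also have "\<dots> \<le> q ^ j * cmod (f j) / \<delta>"
      using q \<delta> diag[OF j] by (intro divide_left_mono) (auto intro: mult_pos_pos pos[OF j])
    finally show ?thesis .
  qed
  have tail: "cmod (\<Sum>j=i..<N. c' j) \<le> (\<Sum>j=i..<N. q ^ j * cmod (f j) / \<delta>)" if "i \<le> N" for i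
  proof -
    have "cmod (\<Sum>j=i..<N. c' j) \<le> (\<Sum>j=i..<N. cmod (\<Sum>l=j..<N. of_real (b j l) * c' l))"
    proof (rule decreasing_weights_bound[OF _ _ _ that])
      show "b i i = 1" if "i < N" for i using pos[OF that] by (simp add: b_def)
      show "0 \<le> b i j" if "i \<le> j" "j < N" for i j
        unfolding b_def using nonneg[OF that] pos[of i] that q by (intro divide_nonneg_nonneg) auto
      show "b i (Suc j) \<le> b i j" if "i \<le> j" "Suc j < N" for i j
      proof -
        have "r i (Suc j) / (r i i * q ^ (Suc j - i)) \<le> q * r i j / (r i i * q ^ (Suc j - i))"
          using dec[OF that] pos[of i] that q by (intro divide_right_mono) auto
        also have "\<dots> = b i j" using that q by (simp add: b_def Suc_diff_le)
        finally show ?thesis by (simp add: b_def)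
      qed
    qed
    also have "\<dots> \<le> (\<Sum>j=i..<N. q ^ j * cmod (f j) / \<delta>)"
      by (intro sum_mono f') auto
    finally show ?thesis .
  qed
  define K where "K i j = (if i \<le> j then q ^ (j - i) else 0)" for i j
  have c: "cmod (c i) \<le> 2 / \<delta> * (\<Sum>j<N. K i j * cmod (f j))" if i: "i < N" for i
  proof -
    let ?S = "\<Sum>j=i..<N. q ^ j * cmod (f j) / \<delta>"
    have "c' i = (\<Sum>j=i..<N. c' j) - (\<Sum>j=Suc i..<N. c' j)"
      using i by (simp add: sum.atLeast_Suc_lessThan)
    then have "cmod (c' i) \<le> cmod (\<Sum>j=i..<N. c' j) + cmod (\<Sum>j=Suc i..<N. c' j)"
      using norm_triangle_ineq4 by metis
    also have "\<dots> \<le> ?S + (\<Sum>j=Suc i..<N. q ^ j * cmod (f j) / \<delta>)"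
      using i by (intro add_mono tail) auto
    also have "(\<Sum>j=Suc i..<N. q ^ j * cmod (f j) / \<delta>) \<le> ?S"
      using q \<delta> by (intro sum_mono2) auto
    finally have "q ^ i * cmod (c i) \<le> 2 * ?S"
      using q by (simp add: c'_def norm_mult norm_power)
    also have "?S = (\<Sum>j=i..<N. q ^ i * (q ^ (j - i) * cmod (f j) / \<delta>))"
    proof (intro sum.cong refl)
      fix j assume "j \<in> {i..<N}"
      then have "q ^ j = q ^ i * q ^ (j - i)" by (simp flip: power_add)
      then show "q ^ j * cmod (f j) / \<delta> = q ^ i * (q ^ (j - i) * cmod (f j) / \<delta>)" by simp
    qed
    also have "2 * \<dots> = q ^ i * (2 * (\<Sum>j=i..<N. q ^ (j - i) * cmod (f j) / \<delta>))"
      by (simp add: sum_distrib_left mult.left_commute)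
    finally have "cmod (c i) \<le> 2 * (\<Sum>j=i..<N. q ^ (j - i) * cmod (f j) / \<delta>)"
      using q by simp
    also have "(\<Sum>j=i..<N. q ^ (j - i) * cmod (f j) / \<delta>) = (\<Sum>j<N. K i j * cmod (f j) / \<delta>)"
      by (intro sum.mono_neutral_cong_left) (auto simp: K_def)
    finally show ?thesis by (simp flip: sum_divide_distrib)
  qed
  have "(\<Sum>i<N. (\<Sum>j<N. K i j * cmod (f j))\<^sup>2) \<le> 1 / (1 - q) * (1 / (1 - q)) * (\<Sum>j<N. (cmod (f j))\<^sup>2)"
  proof (rule schur_test)
    show "0 \<le> K i j" for i j using q by (simp add: K_def)
    show "(\<Sum>j<N. K i j) \<le> 1 / (1 - q)" for i
    proof -
      have "(\<Sum>j<N. K i j) = (\<Sum>j\<in>{i..<N}. q ^ (j - i))"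
        by (intro sum.mono_neutral_cong_right) (auto simp: K_def)
      also have "\<dots> \<le> 1 / (1 - q)"
        using q by (intro sum_power_le) (auto simp: inj_on_def)
      finally show ?thesis .
    qed
    show "(\<Sum>i<N. K i j) \<le> 1 / (1 - q)" if "j \<in> {..<N}" for j
    proof -
      have "(\<Sum>i<N. K i j) = (\<Sum>i\<in>{..j}. q ^ (j - i))"
        using that by (intro sum.mono_neutral_cong_right) (auto simp: K_def)
      also have "\<dots> \<le> 1 / (1 - q)"
        using q by (intro sum_power_le) (auto simp: inj_on_def)
      finally show ?thesis .
    qed
  qed (use q in auto)
  then have schur: "(\<Sum>i<N. (\<Sum>j<N. K i j * cmod (f j))\<^sup>2) \<le> (1 / (1 - q))\<^sup>2 * (\<Sum>j<N. (cmod (f j))\<^sup>2)"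
    by (simp add: power2_eq_square)
  have "(\<Sum>k<N. (cmod (c k))\<^sup>2) \<le> (\<Sum>k<N. (2 / \<delta> * (\<Sum>j<N. K k j * cmod (f j)))\<^sup>2)"
    by (intro sum_mono power_mono c) auto
  also have "\<dots> = (2 / \<delta>)\<^sup>2 * (\<Sum>k<N. (\<Sum>j<N. K k j * cmod (f j))\<^sup>2)"
    unfolding power_mult_distrib by (rule sum_distrib_left[symmetric])
  also have "\<dots> \<le> (2 / \<delta>)\<^sup>2 * ((1 / (1 - q))\<^sup>2 * (\<Sum>j<N. (cmod (f j))\<^sup>2))"
    by (intro mult_left_mono schur) simp
  also have "\<dots> = (2 / (\<delta> * (1 - q)))\<^sup>2 * (\<Sum>j<N. (cmod (f j))\<^sup>2)"
    by (simp add: power_divide power_mult_distrib)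
  finally show ?thesis unfolding f_def .
qed

section \<open>Samples of a stably decreasing window\<close>

lemma geometric_decay_iterate:
  fixes \<gamma> :: "real \<Rightarrow> real"
  assumes t: "t > 0" and q: "0 \<le> q" and step: "\<And>x. 0 \<le> x \<Longrightarrow> \<gamma> (x + t) \<le> q * \<gamma> x"
    and x: "0 \<le> x"
  shows "\<gamma> (x + t * real n) \<le> q ^ n * \<gamma> x"
proof (induction n)
  case (Suc n)
  have "\<gamma> (x + t * real (Suc n)) = \<gamma> ((x + t * real n) + t)" by (simp add: algebra_simps)
  also have "\<dots> \<le> q * \<gamma> (x + t * real n)" using x t by (intro step) simp
  also have "\<dots> \<le> q * (q ^ n * \<gamma> x)" using Suc q by (intro mult_left_mono) auto
  finally show ?case by (simp add: mult.assoc)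
qed simp

text \<open>
The first nonnegative point of the progression contributes at most \<open>G\<close>, each later one at most \<open>q\<close>
times its predecessor. The index map \<open>\<kappa>\<close> allows progressions in either direction.
\<close>

lemma sum_progression_le:
  fixes \<gamma> :: "real \<Rightarrow> real" and \<kappa> :: "'a \<Rightarrow> int"
  assumes neg: "\<And>x. x < 0 \<Longrightarrow> \<gamma> x = 0" and nonneg: "\<And>x. 0 \<le> \<gamma> x" and G: "\<And>x. \<gamma> x \<le> G"
    and t: "t > 0" and q: "0 \<le> q" "q < 1" and step: "\<And>x. 0 \<le> x \<Longrightarrow> \<gamma> (x + t) \<le> q * \<gamma> x"
    and I: "finite I" "inj_on \<kappa> I"
  shows "(\<Sum>i\<in>I. \<gamma> (y + t * of_int (\<kappa> i))) \<le> G / (1 - q)"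
proof -
  define k0 where "k0 = \<lceil>- y / t\<rceil>"
  define J where "J = {i \<in> I. k0 \<le> \<kappa> i}"
  have k0: "0 \<le> y + t * of_int k0"
  proof -
    have "- y / t \<le> of_int k0" by (simp add: k0_def)
    then have "- y \<le> of_int k0 * t" by (simp only: pos_divide_le_eq[OF t])
    then show ?thesis by (simp add: mult.commute)
  qed
  have G0: "0 \<le> G" using nonneg G order_trans by blast
  have "(\<Sum>i\<in>I. \<gamma> (y + t * of_int (\<kappa> i))) = (\<Sum>i\<in>J. \<gamma> (y + t * of_int (\<kappa> i)))"
  proof (rule sum.mono_neutral_right)
    show "\<forall>i\<in>I - J. \<gamma> (y + t * of_int (\<kappa> i)) = 0"
    proof
      fix i assume "i \<in> I - J"
      then have "\<kappa> i < k0" by (auto simp: J_def)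
      then have "of_int (\<kappa> i) < - y / t" unfolding k0_def less_ceiling_iff .
      then have "of_int (\<kappa> i) * t < - y" by (simp only: pos_less_divide_eq[OF t])
      then show "\<gamma> (y + t * of_int (\<kappa> i)) = 0" by (intro neg) (simp add: mult.commute)
    qed
  qed (use I in \<open>auto simp: J_def\<close>)
  also have "\<dots> \<le> (\<Sum>i\<in>J. q ^ nat (\<kappa> i - k0) * G)"
  proof (intro sum_mono)
    fix i assume i: "i \<in> J"
    define n where "n = nat (\<kappa> i - k0)"
    have "of_int (\<kappa> i) = of_int k0 + real n" using i by (simp add: n_def J_def)
    then have "\<gamma> (y + t * of_int (\<kappa> i)) = \<gamma> ((y + t * of_int k0) + t * real n)"
      by (simp add: algebra_simps)
    also have "\<dots> \<le> q ^ n * \<gamma> (y + t * of_int k0)" by (rule geometric_decay_iterate[where \<gamma> = \<gamma>, OF t q(1) step k0])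
    also have "\<dots> \<le> q ^ n * G" using q by (intro mult_left_mono G) auto
    finally show "\<gamma> (y + t * of_int (\<kappa> i)) \<le> q ^ nat (\<kappa> i - k0) * G" by (simp add: n_def)
  qed
  also have "\<dots> = (\<Sum>i\<in>J. q ^ nat (\<kappa> i - k0)) * G" by (simp add: sum_distrib_right)
  also have "\<dots> \<le> 1 / (1 - q) * G"
    using I q G0 by (intro mult_right_mono sum_power_le) (auto simp: J_def inj_on_def nat_eq_iff)
  finally show ?thesis by simp
qed

text \<open>
Schur's test: columns are progressions with step \<open>\<alpha>\<close>, rows are progressions with step \<open>1/\<beta>\<close>.
Stated for any \<open>\<gamma>\<close> with the decay of \<open>g\<close>, because it is applied to translates of \<open>g\<close> cut off at \<open>0\<close>
as well.
\<close>

lemma sampled_upper_bound: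
  fixes \<gamma> :: "real \<Rightarrow> real" and c :: "nat \<Rightarrow> complex"
  assumes neg: "\<And>x. x < 0 \<Longrightarrow> \<gamma> x = 0" and nonneg: "\<And>x. 0 \<le> \<gamma> x" and G: "\<And>x. \<gamma> x \<le> G"
    and q: "0 \<le> q" "q < 1" and q': "0 \<le> q'" "q' < 1"
    and \<alpha>: "\<alpha> > 0" and step: "\<And>x. 0 \<le> x \<Longrightarrow> \<gamma> (x + \<alpha>) \<le> q * \<gamma> x"
    and \<beta>: "\<beta> > 0" and step': "\<And>x. 0 \<le> x \<Longrightarrow> \<gamma> (x + 1 / \<beta>) \<le> q' * \<gamma> x"
    and I: "finite I"
  shows "(\<Sum>m\<in>I. (cmod (\<Sum>k<N. c k * of_real (\<gamma> (y + real k / \<beta> - \<alpha> * of_int m))))\<^sup>2)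
    \<le> G\<^sup>2 / ((1 - q) * (1 - q')) * (\<Sum>k<N. (cmod (c k))\<^sup>2)"
proof -
  define K where "K m k = \<gamma> (y + real k / \<beta> - \<alpha> * of_int m)" for m :: int and k :: nat
  have G0: "0 \<le> G" using nonneg G order_trans by blast
  have "(\<Sum>m\<in>I. (\<Sum>k<N. K m k * cmod (c k))\<^sup>2)
      \<le> G / (1 - q') * (G / (1 - q)) * (\<Sum>k<N. (cmod (c k))\<^sup>2)"
  proof (rule schur_test)
    show "(\<Sum>k<N. K m k) \<le> G / (1 - q')" for m
      using sum_progression_le[of \<gamma> G "1 / \<beta>" q' "{..<N}" int "y - \<alpha> * of_int m", OF neg nonneg G _ q' step']
        \<beta> by (simp add: K_def algebra_simps)
    show "(\<Sum>m\<in>I. K m k) \<le> G / (1 - q)" for k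
      using sum_progression_le[of \<gamma> G "\<alpha>" q I uminus "y + real k / \<beta>", OF neg nonneg G \<alpha> q step] I
      by (simp add: K_def)
  qed (use I nonneg G0 q' in \<open>auto simp: K_def\<close>)
  moreover have "(\<Sum>m\<in>I. (cmod (\<Sum>k<N. c k * of_real (K m k)))\<^sup>2)
      \<le> (\<Sum>m\<in>I. (\<Sum>k<N. K m k * cmod (c k))\<^sup>2)"
  proof (intro sum_mono power_mono)
    fix m
    have "cmod (\<Sum>k<N. c k * of_real (K m k)) \<le> (\<Sum>k<N. cmod (c k * of_real (K m k)))"
      by (rule norm_sum)
    also have "\<dots> = (\<Sum>k<N. K m k * cmod (c k))"
      using nonneg by (simp add: norm_mult K_def mult.commute)
    finally show "cmod (\<Sum>k<N. c k * of_real (K m k)) \<le> (\<Sum>k<N. K m k * cmod (c k))" .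
  qed simp
  ultimately show ?thesis unfolding K_def by (simp add: power2_eq_square mult.commute)
qed

locale decaying_window =
  fixes g :: "real \<Rightarrow> real"
  assumes zero: "x < 0 \<Longrightarrow> g x = 0"
    and stable: "stably_decreasing g"
    and in_L2: "(\<lambda>x. complex_of_real (g x)) \<in> L2"
begin

lemma nonneg: "0 \<le> g x"
  using zero[of x] stable by (cases "x < 0") (auto simp: stably_decreasing_def)

lemma decay:
  assumes "t > 0"
  obtains q where "0 < q" "q < 1" "\<And>x. 0 \<le> x \<Longrightarrow> g (x + t) \<le> q * g x"
  using stable assms unfolding stably_decreasing_def by (metis mult.commute)

lemma antimono:
  assumes "0 \<le> x" "x \<le> y"
  shows "g y \<le> g x"
proof (cases "x = y")
  case False
  then obtain q where "0 < q" "q < 1" "g (x + (y - x)) \<le> q * g x"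
    using decay[of "y - x"] assms by (metis diff_gt_0_iff_gt order_less_le)
  then show ?thesis using mult_right_mono[of q 1 "g x"] nonneg[of x] by simp
qed simp

lemma bounded: "g x \<le> g 0"
  using antimono[of 0 x] zero[of x] nonneg[of 0] by (cases "x < 0") auto

lemma abs_bounded: "\<bar>g x\<bar> \<le> g 0"
  using nonneg bounded by (simp add: abs_of_nonneg)

lemma measurable [measurable]: "g \<in> borel_measurable borel"
proof -
  have "mono (\<lambda>x. - g (max 0 x))"
    by (intro monoI) (auto intro!: antimono)
  then have [measurable]: "(\<lambda>x. - g (max 0 x)) \<in> borel_measurable borel"
    by (rule borel_measurable_mono)
  have "(\<lambda>x. indicator {0..} x * - (- g (max 0 x))) \<in> borel_measurable borel"
    by measurable
  moreover have "(\<lambda>x. indicator {0..} x * - (- g (max 0 x))) = g"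
    by (auto simp: indicator_def zero)
  ultimately show ?thesis by simp
qed

lemma square_integrable: "integrable lborel (\<lambda>x. (g x)\<^sup>2)"
proof -
  have "integrable lebesgue (\<lambda>x. (g x)\<^sup>2)" using in_L2 by (simp add: L2_def)
  then show ?thesis by (subst (asm) integrable_completion) simp_all
qed

text \<open>
Row \<open>\<mu>\<^sub>k = \<lfloor>(y + k/\<beta>)/\<alpha>\<rfloor>\<close> samples \<open>g\<close> on \<open>[0,\<alpha>)\<close> in column \<open>k\<close>. Neighbouring columns are \<open>1/\<beta> \<ge> \<alpha>\<close>
apart, so the chosen rows are distinct and the earlier columns meet the negative half-line, where
\<open>g\<close> vanishes: the selected matrix is upper triangular.
\<close>

lemma sampled_lower_bound:
  fixes c :: "nat \<Rightarrow> complex"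
  assumes \<alpha>: "\<alpha> > 0" and \<beta>: "\<beta> > 0" and dens: "\<alpha> \<le> 1 / \<beta>"
    and \<delta>: "\<delta> > 0" "\<And>x. 0 \<le> x \<Longrightarrow> x < \<alpha> \<Longrightarrow> \<delta> \<le> g x"
    and q: "0 < q" "q < 1" and step: "\<And>x. 0 \<le> x \<Longrightarrow> g (x + 1 / \<beta>) \<le> q * g x"
    and I: "finite I" "\<And>k. k < N \<Longrightarrow> \<lfloor>(y + real k / \<beta>) / \<alpha>\<rfloor> \<in> I"
  shows "(\<Sum>k<N. (cmod (c k))\<^sup>2) \<le> (2 / (\<delta> * (1 - q)))\<^sup>2 *
    (\<Sum>m\<in>I. (cmod (\<Sum>k<N. c k * of_real (g (y + real k / \<beta> - \<alpha> * of_int m))))\<^sup>2)"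
proof -
  define Y where "Y k = y + real k / \<beta>" for k :: nat
  define \<mu> where "\<mu> k = \<lfloor>Y k / \<alpha>\<rfloor>" for k
  define r where "r i j = g (Y j - \<alpha> * of_int (\<mu> i))" for i j
  have \<mu>: "\<alpha> * of_int (\<mu> k) \<le> Y k" "Y k < \<alpha> * of_int (\<mu> k) + \<alpha>" for k
    using floor_divide_lower[OF \<alpha>, of "Y k"] floor_divide_upper[OF \<alpha>, of "Y k"]
    by (simp_all add: \<mu>_def algebra_simps)
  have Y_Suc: "Y (Suc k) = Y k + 1 / \<beta>" for k by (simp add: Y_def add_divide_distrib)
  have Y_mono: "Y i + real (j - i) / \<beta> = Y j" if "i \<le> j" for i j
    using that by (simp add: Y_def of_nat_diff diff_divide_distrib)
  have gap: "Y i + \<alpha> \<le> Y j" if "i < j" for i j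
  proof -
    have "1 / \<beta> \<le> real (j - i) / \<beta>" using that \<beta> by (intro divide_right_mono) auto
    then show ?thesis using Y_mono[of i j] that dens by linarith
  qed
  have inj: "inj_on \<mu> {..<N}"
  proof (rule inj_onI)
    have "\<mu> i \<noteq> \<mu> j" if "i < j" for i j
      using gap[OF that] \<mu>[of i] \<mu>[of j] by auto
    then show "i = j" if "\<mu> i = \<mu> j" "i \<in> {..<N}" "j \<in> {..<N}" for i j
      using that by (metis linorder_neqE_nat)
  qed
  have triangular: "(\<Sum>k<N. (cmod (c k))\<^sup>2) \<le> (2 / (\<delta> * (1 - q)))\<^sup>2 *
      (\<Sum>i<N. (cmod (\<Sum>j=i..<N. of_real (r i j) * c j))\<^sup>2)"
  proof (rule triangular_lower_bound[OF q \<delta>(1)])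
    show "\<delta> \<le> r i i" for i
      unfolding r_def using \<mu>[of i] by (intro \<delta>(2)) auto
    show "0 \<le> r i j" for i j by (simp add: r_def nonneg)
    show "r i (Suc j) \<le> q * r i j" if "i \<le> j" for i j
    proof -
      have "0 \<le> Y j - \<alpha> * of_int (\<mu> i)"
        using \<mu>(1)[of i] Y_mono[OF that] \<beta> by (smt (verit) divide_nonneg_nonneg of_nat_0_le_iff)
      from step[OF this] show ?thesis unfolding r_def Y_Suc by (simp add: algebra_simps)
    qed
  qed
  have "(\<Sum>i<N. (cmod (\<Sum>j=i..<N. of_real (r i j) * c j))\<^sup>2)
      = (\<Sum>i<N. (cmod (\<Sum>k<N. c k * of_real (g (Y k - \<alpha> * of_int (\<mu> i)))))\<^sup>2)"
  proof (intro sum.cong refl)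
    fix i assume "i \<in> {..<N}"
    have "g (Y k - \<alpha> * of_int (\<mu> i)) = 0" if "k < i" for k
      using gap[OF that] \<mu>[of i] by (intro zero) linarith
    then have "(\<Sum>j=i..<N. of_real (r i j) * c j) = (\<Sum>k<N. c k * of_real (g (Y k - \<alpha> * of_int (\<mu> i))))"
      by (intro sum.mono_neutral_cong_left) (auto simp: r_def not_le)
    then show "(cmod (\<Sum>j=i..<N. of_real (r i j) * c j))\<^sup>2
        = (cmod (\<Sum>k<N. c k * of_real (g (Y k - \<alpha> * of_int (\<mu> i)))))\<^sup>2" by simp
  qed
  also have "\<dots> = (\<Sum>m\<in>\<mu> ` {..<N}. (cmod (\<Sum>k<N. c k * of_real (g (Y k - \<alpha> * of_int m))))\<^sup>2)"
    by (simp add: sum.reindex[OF inj])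
  also have "\<dots> \<le> (\<Sum>m\<in>I. (cmod (\<Sum>k<N. c k * of_real (g (Y k - \<alpha> * of_int m))))\<^sup>2)"
    using I by (intro sum_mono2) (auto simp: \<mu>_def Y_def)
  finally show ?thesis
    unfolding Y_def[symmetric]
    by (intro order_trans[OF triangular] mult_left_mono) auto
qed

end

section \<open>Borel representatives\<close>

lemma lebesgue_ex_borel_complex:
  fixes h :: "real \<Rightarrow> complex"
  assumes "h \<in> borel_measurable lebesgue"
  shows "\<exists>h'\<in>borel_measurable borel. AE x in lebesgue. h x = h' x"
proof -
  have "(\<lambda>x. Re (h x)) \<in> borel_measurable lebesgue" "(\<lambda>x. Im (h x)) \<in> borel_measurable lebesgue"
    using assms by auto
  from this[THEN completion_ex_borel_measurable_real]
  obtain u v where [measurable]: "u \<in> borel_measurable lborel" "v \<in> borel_measurable lborel"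
    and uv: "AE x in lborel. Re (h x) = u x" "AE x in lborel. Im (h x) = v x"
    by blast
  have "AE x in lborel. h x = Complex (u x) (v x)"
    using uv by eventually_elim (auto simp: complex_eq_iff)
  then have "AE x in lebesgue. h x = of_real (u x) + \<i> * of_real (v x)"
    by (intro AE_completion) (simp add: complex_eq_iff complex_eq)
  then show ?thesis
    by (intro bexI[of _ "\<lambda>x. of_real (u x) + \<i> * of_real (v x)"]) auto
qed

text \<open>
Inner product and norm see only the class of \<open>h\<close>, so all estimates may be proved for Borel functions
and Lebesgue measure on the Borel sets.
\<close>

lemma L2_ex_borel:
  assumes "h \<in> L2"
  obtains h' where "h' \<in> borel_measurable borel" "integrable lborel (\<lambda>x. (cmod (h' x))\<^sup>2)"
    "L2_norm h = L2_norm h'" "\<forall>f\<in>borel_measurable borel. L2_inner h f = L2_inner h' f"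
proof -
  have h[measurable]: "h \<in> borel_measurable lebesgue"
    and int: "integrable lebesgue (\<lambda>x. (cmod (h x))\<^sup>2)"
    using assms by (auto simp: L2_def)
  obtain h' where h'[measurable]: "h' \<in> borel_measurable borel" and ae: "AE x in lebesgue. h x = h' x"
    using lebesgue_ex_borel_complex[OF h] by auto
  have m'[measurable]: "h' \<in> borel_measurable lebesgue"
    using h' by (intro measurable_completion) simp
  have "integrable lebesgue (\<lambda>x. (cmod (h' x))\<^sup>2)"
    using int ae by (subst integrable_cong_AE[symmetric]) auto
  then have "integrable lborel (\<lambda>x. (cmod (h' x))\<^sup>2)"
    by (subst (asm) integrable_completion) auto
  moreover have "L2_norm h = L2_norm h'"
    unfolding L2_norm_def using ae by (intro arg_cong[where f = sqrt] integral_cong_AE) auto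
  moreover have "L2_inner h f = L2_inner h' f" if f: "f \<in> borel_measurable borel" for f
  proof -
    have [measurable]: "f \<in> borel_measurable lebesgue"
      using f by (intro measurable_completion) simp
    have [measurable]: "(\<lambda>x. cnj (f x)) \<in> borel_measurable lebesgue"
      by (intro measurable_compose[OF _ cnj_borel_measurable]) simp
    show ?thesis
      unfolding L2_inner_def using ae by (intro integral_cong_AE) auto
  qed
  ultimately show ?thesis using that h' by blast
qed

lemma borel_in_L2:
  assumes [measurable]: "h \<in> borel_measurable borel" and "integrable lborel (\<lambda>x. (cmod (h x))\<^sup>2)"
  shows "h \<in> L2"
  unfolding L2_def using assms
  by (auto intro!: measurable_completion) (subst integrable_completion, auto)

lemma L2_norm_square_borel:
  assumes [measurable]: "h \<in> borel_measurable borel"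
  shows "(L2_norm h)\<^sup>2 = (LINT x|lborel. (cmod (h x))\<^sup>2)"
  unfolding L2_norm_def by (subst integral_completion) auto

lemma L2_inner_borel:
  assumes [measurable]: "h \<in> borel_measurable borel" "f \<in> borel_measurable borel"
  shows "L2_inner h f = (LINT x|lborel. h x * cnj (f x))"
  unfolding L2_inner_def by (subst integral_completion) auto

lemma integrable_L2_product:
  assumes [measurable]: "h \<in> borel_measurable borel" "f \<in> borel_measurable borel"
    and "integrable lborel (\<lambda>x. (cmod (h x))\<^sup>2)" "integrable lborel (\<lambda>x. (cmod (f x))\<^sup>2)"
  shows "integrable lborel (\<lambda>x. h x * cnj (f x))"
proof (rule Bochner_Integration.integrable_bound)
  show "integrable lborel (\<lambda>x. (cmod (h x))\<^sup>2 + (cmod (f x))\<^sup>2)" using assms by simp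
  have "cmod (h x * cnj (f x)) \<le> (cmod (h x))\<^sup>2 + (cmod (f x))\<^sup>2" for x
  proof -
    have "2 * (cmod (h x) * cmod (f x)) \<le> (cmod (h x))\<^sup>2 + (cmod (f x))\<^sup>2"
      using sum_squares_bound[of "cmod (h x)" "cmod (f x)"] by simp
    moreover have "0 \<le> cmod (h x) * cmod (f x)" by simp
    ultimately show ?thesis unfolding norm_mult complex_mod_cnj by linarith
  qed
  then show "AE x in lborel. cmod (h x * cnj (f x)) \<le> norm ((cmod (h x))\<^sup>2 + (cmod (f x))\<^sup>2)"
    by (auto intro!: always_eventually order_trans[OF _ abs_ge_self])
qed measurable

section \<open>The frame sum of functions with bounded support\<close>

context decaying_window
begin

definition gabor :: "real \<Rightarrow> real \<Rightarrow> int \<times> int \<Rightarrow> real \<Rightarrow> complex" where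
  "gabor \<alpha> \<beta> = gabor_system (\<lambda>x. of_real (g x)) \<alpha> \<beta>"

definition energy :: "real \<Rightarrow> real \<Rightarrow> (real \<Rightarrow> complex) \<Rightarrow> int \<times> int \<Rightarrow> real" where
  "energy \<alpha> \<beta> h i = (cmod (L2_inner h (gabor \<alpha> \<beta> i)))\<^sup>2"

lemma energy_nonneg: "0 \<le> energy \<alpha> \<beta> h i"
  by (simp add: energy_def)

lemma gabor_measurable [measurable]: "gabor \<alpha> \<beta> i \<in> borel_measurable borel"
proof -
  have "gabor \<alpha> \<beta> i = (\<lambda>x. wave \<beta> (snd i) x * of_real (g (x - \<alpha> * of_int (fst i))))"
    by (auto simp: gabor_def gabor_system_def tf_shift_def wave_def split: prod.splits)
  then show ?thesis by simp
qed

lemma gabor_square_integrable: "integrable lborel (\<lambda>x. (cmod (gabor \<alpha> \<beta> i x))\<^sup>2)"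
proof -
  have "integrable lborel (\<lambda>x. (g (- (\<alpha> * of_int (fst i)) + 1 * x))\<^sup>2)"
    by (rule lborel_integrable_real_affine[OF square_integrable]) simp
  then show ?thesis
    by (simp add: gabor_def gabor_system_def tf_shift_def norm_mult case_prod_beta)
qed

context
  fixes \<alpha> \<beta> a :: real and N :: nat and h :: "real \<Rightarrow> complex"
  assumes \<beta>: "\<beta> > 0"
    and h[measurable]: "h \<in> borel_measurable borel"
    and h2: "integrable lborel (\<lambda>x. (cmod (h x))\<^sup>2)"
    and supp: "\<And>x. x \<notin> {a..<a + real N / \<beta>} \<Longrightarrow> h x = 0"
begin

lemma energy_has_sum:
  "((\<lambda>n. energy \<alpha> \<beta> h (m, n)) has_sum
     (LINT x|period_measure a \<beta>. (cmod (fiber g \<alpha> \<beta> N h m x))\<^sup>2) / \<beta>) UNIV"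
  using gabor_coefficients_has_sum[OF \<beta> measurable abs_bounded h h2 supp]
  unfolding energy_def gabor_def .

lemma integral_sum_fiber:
  "(\<Sum>m\<in>I. LINT x|period_measure a \<beta>. (cmod (fiber g \<alpha> \<beta> N h m x))\<^sup>2)
    = (LINT x|period_measure a \<beta>. (\<Sum>m\<in>I. (cmod (fiber g \<alpha> \<beta> N h m x))\<^sup>2))"
  using integrable_fiber_square[OF \<beta> measurable abs_bounded h h2 supp]
  by (subst Bochner_Integration.integral_sum) auto

lemma integrable_sum_fiber:
  "integrable (period_measure a \<beta>) (\<lambda>x. \<Sum>m\<in>I. (cmod (fiber g \<alpha> \<beta> N h m x))\<^sup>2)"
  using integrable_fiber_square[OF \<beta> measurable abs_bounded h h2 supp]
  by (intro Bochner_Integration.integrable_sum) auto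

lemma energy_finite_sum_le:
  assumes V: "\<And>I. finite I \<Longrightarrow>
      (LINT x|period_measure a \<beta>. (\<Sum>m\<in>I. (cmod (fiber g \<alpha> \<beta> N h m x))\<^sup>2)) \<le> V"
    and J: "finite J"
  shows "sum (energy \<alpha> \<beta> h) J \<le> V / \<beta>"
proof -
  have "sum (energy \<alpha> \<beta> h) J \<le> sum (energy \<alpha> \<beta> h) (fst ` J \<times> snd ` J)"
    using J by (intro sum_mono2) (auto simp: energy_nonneg intro: rev_image_eqI)
  also have "\<dots> = (\<Sum>m\<in>fst ` J. \<Sum>n\<in>snd ` J. energy \<alpha> \<beta> h (m, n))"
    by (simp add: sum.cartesian_product)
  also have "\<dots> \<le> (\<Sum>m\<in>fst ` J. (LINT x|period_measure a \<beta>. (cmod (fiber g \<alpha> \<beta> N h m x))\<^sup>2) / \<beta>)"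
  proof (intro sum_mono)
    fix m :: int
    show "(\<Sum>n\<in>snd ` J. energy \<alpha> \<beta> h (m, n))
        \<le> (LINT x|period_measure a \<beta>. (cmod (fiber g \<alpha> \<beta> N h m x))\<^sup>2) / \<beta>"
      using J by (intro finite_sum_le_has_sum[OF energy_has_sum[of m]]) (auto simp: energy_nonneg)
  qed
  also have "\<dots> \<le> V / \<beta>"
    unfolding sum_divide_distrib[symmetric] integral_sum_fiber
    using J \<beta> by (intro divide_right_mono V) auto
  finally show ?thesis .
qed

text \<open>
Finitely many translations \<open>m\<close> suffice for the lower frame bound of a function with bounded support,
which avoids any interchange of an infinite sum with the integral.
\<close>

lemma energy_finite_shifts_has_sum:
  assumes "finite I" "energy \<alpha> \<beta> h summable_on UNIV"
  shows "(energy \<alpha> \<beta> h has_sum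
    (LINT x|period_measure a \<beta>. (\<Sum>m\<in>I. (cmod (fiber g \<alpha> \<beta> N h m x))\<^sup>2)) / \<beta>) (I \<times> UNIV)"
proof (rule has_sum_SigmaI)
  show "((\<lambda>n. energy \<alpha> \<beta> h (m, n)) has_sum
      (LINT x|period_measure a \<beta>. (cmod (fiber g \<alpha> \<beta> N h m x))\<^sup>2) / \<beta>) UNIV" for m
    by (rule energy_has_sum)
  show "((\<lambda>m. (LINT x|period_measure a \<beta>. (cmod (fiber g \<alpha> \<beta> N h m x))\<^sup>2) / \<beta>) has_sum
      (LINT x|period_measure a \<beta>. (\<Sum>m\<in>I. (cmod (fiber g \<alpha> \<beta> N h m x))\<^sup>2)) / \<beta>) I"
    unfolding integral_sum_fiber[symmetric] sum_divide_distrib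
    using assms(1) by (rule has_sum_finite)
  show "energy \<alpha> \<beta> h summable_on I \<times> UNIV"
    using assms(2) by (rule summable_on_subset_banach) simp
qed

end

lemma localized_energy_upper:
  assumes \<alpha>: "\<alpha> > 0" and \<beta>: "\<beta> > 0"
  obtains B where "B > 0"
    "\<And>a N h J. \<lbrakk>h \<in> borel_measurable borel; integrable lborel (\<lambda>x. (cmod (h x))\<^sup>2);
       \<And>x. x \<notin> {a..<a + real N / \<beta>} \<Longrightarrow> h x = 0; finite J\<rbrakk>
     \<Longrightarrow> sum (energy \<alpha> \<beta> h) J \<le> B * (L2_norm h)\<^sup>2"
proof -
  obtain q where q: "0 < q" "q < 1" "\<And>x. 0 \<le> x \<Longrightarrow> g (x + \<alpha>) \<le> q * g x"
    using decay[OF \<alpha>] by blast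
  have "0 < 1 / \<beta>" using \<beta> by simp
  then obtain q' where q': "0 < q'" "q' < 1" "\<And>x. 0 \<le> x \<Longrightarrow> g (x + 1 / \<beta>) \<le> q' * g x"
    using decay by blast
  define B where "B = (g 0)\<^sup>2 / ((1 - q) * (1 - q'))"
  have B: "0 \<le> B" using q q' by (simp add: B_def)
  have "sum (energy \<alpha> \<beta> h) J \<le> (B + 1) / \<beta> * (L2_norm h)\<^sup>2"
    if h: "h \<in> borel_measurable borel" "integrable lborel (\<lambda>x. (cmod (h x))\<^sup>2)"
      "\<And>x. x \<notin> {a..<a + real N / \<beta>} \<Longrightarrow> h x = 0" and J: "finite J" for a N h J
  proof -
    have "sum (energy \<alpha> \<beta> h) J \<le> (B * (L2_norm h)\<^sup>2) / \<beta>"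
    proof (rule energy_finite_sum_le[OF \<beta> h _ J])
      fix I :: "int set" assume I: "finite I"
      have norm_h: "(L2_norm h)\<^sup>2 = (LINT x|period_measure a \<beta>. (\<Sum>k<N. (cmod (h (x + real k / \<beta>)))\<^sup>2))"
        by (rule L2_norm_fiber[OF \<beta> measurable abs_bounded h])
      have "(LINT x|period_measure a \<beta>. (\<Sum>m\<in>I. (cmod (fiber g \<alpha> \<beta> N h m x))\<^sup>2))
          \<le> (LINT x|period_measure a \<beta>. B * (\<Sum>k<N. (cmod (h (x + real k / \<beta>)))\<^sup>2))"
      proof (intro integral_mono)
        show "integrable (period_measure a \<beta>) (\<lambda>x. \<Sum>m\<in>I. (cmod (fiber g \<alpha> \<beta> N h m x))\<^sup>2)"
          by (rule integrable_sum_fiber[OF \<beta> h])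
        show "integrable (period_measure a \<beta>) (\<lambda>x. B * (\<Sum>k<N. (cmod (h (x + real k / \<beta>)))\<^sup>2))"
          using integrable_fiber_norm[OF \<beta> measurable abs_bounded h] by (rule integrable_mult_right)
        show "(\<Sum>m\<in>I. (cmod (fiber g \<alpha> \<beta> N h m x))\<^sup>2) \<le> B * (\<Sum>k<N. (cmod (h (x + real k / \<beta>)))\<^sup>2)" for x
          unfolding fiber_def B_def
          by (rule sampled_upper_bound[OF zero nonneg bounded _ _ _ _ \<alpha> q(3) \<beta> q'(3) I]) (use q q' in auto)
      qed
      then show "(LINT x|period_measure a \<beta>. (\<Sum>m\<in>I. (cmod (fiber g \<alpha> \<beta> N h m x))\<^sup>2)) \<le> B * (L2_norm h)\<^sup>2"
        by (simp add: norm_h)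
    qed
    also have "\<dots> \<le> (B + 1) / \<beta> * (L2_norm h)\<^sup>2"
      using \<beta> by (simp add: divide_right_mono mult_right_mono)
    finally show ?thesis .
  qed
  moreover have "(B + 1) / \<beta> > 0" using B \<beta> by simp
  ultimately show ?thesis using that by blast
qed

end

section \<open>Truncation, and sufficiency\<close>

definition truncate :: "real \<Rightarrow> (real \<Rightarrow> complex) \<Rightarrow> real \<Rightarrow> complex" where
  "truncate r h x = (if x \<in> {- r..<r} then h x else 0)"

lemma truncate_measurable [measurable]:
  assumes [measurable]: "h \<in> borel_measurable borel"
  shows "truncate r h \<in> borel_measurable borel"
  unfolding truncate_def by measurable

lemma eventually_truncate_eq:
  assumes "filterlim r at_top sequentially"
  shows "\<forall>\<^sub>F n in sequentially. truncate (r n) h x = h x"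
proof -
  have "\<forall>\<^sub>F n in sequentially. \<bar>x\<bar> < r n"
    using assms by (simp add: filterlim_at_top_dense)
  then show ?thesis by eventually_elim (auto simp: truncate_def)
qed

lemma truncate_square_integrable:
  assumes [measurable]: "h \<in> borel_measurable borel" and h2: "integrable lborel (\<lambda>x. (cmod (h x))\<^sup>2)"
  shows "integrable lborel (\<lambda>x. (cmod (truncate r h x))\<^sup>2)"
    and "integrable lborel (\<lambda>x. (cmod (h x - truncate r h x))\<^sup>2)"
  by (rule Bochner_Integration.integrable_bound[OF h2], simp, simp add: truncate_def)+

lemma L2_norm_truncate_le:
  assumes [measurable]: "h \<in> borel_measurable borel" and h2: "integrable lborel (\<lambda>x. (cmod (h x))\<^sup>2)"
  shows "(L2_norm (truncate r h))\<^sup>2 \<le> (L2_norm h)\<^sup>2"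
  using truncate_square_integrable[OF assms] h2
  by (simp add: L2_norm_square_borel) (intro integral_mono, auto simp: truncate_def)

lemma L2_norm_truncate_tendsto:
  assumes h[measurable]: "h \<in> borel_measurable borel" and h2: "integrable lborel (\<lambda>x. (cmod (h x))\<^sup>2)"
    and r: "filterlim r at_top sequentially"
  shows "(\<lambda>n. (L2_norm (truncate (r n) h))\<^sup>2) \<longlonglongrightarrow> (L2_norm h)\<^sup>2"
    and "(\<lambda>n. (L2_norm (\<lambda>x. h x - truncate (r n) h x))\<^sup>2) \<longlonglongrightarrow> 0"
proof -
  have "(\<lambda>n. LINT x|lborel. (cmod (truncate (r n) h x))\<^sup>2) \<longlonglongrightarrow> (LINT x|lborel. (cmod (h x))\<^sup>2)"
  proof (rule integral_dominated_convergence[OF _ _ h2])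
    show "AE x in lborel. (\<lambda>n. (cmod (truncate (r n) h x))\<^sup>2) \<longlonglongrightarrow> (cmod (h x))\<^sup>2"
    proof (intro AE_I2 tendsto_eventually)
      fix x
      show "\<forall>\<^sub>F n in sequentially. (cmod (truncate (r n) h x))\<^sup>2 = (cmod (h x))\<^sup>2"
        using eventually_truncate_eq[OF r, of h x] by eventually_elim simp
    qed
  qed (auto simp: truncate_def)
  then show "(\<lambda>n. (L2_norm (truncate (r n) h))\<^sup>2) \<longlonglongrightarrow> (L2_norm h)\<^sup>2"
    by (simp add: L2_norm_square_borel)
  have "(\<lambda>n. LINT x|lborel. (cmod (h x - truncate (r n) h x))\<^sup>2) \<longlonglongrightarrow> (LINT (x::real)|lborel. 0)"
  proof (rule integral_dominated_convergence[OF _ _ h2])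
    show "AE x in lborel. (\<lambda>n. (cmod (h x - truncate (r n) h x))\<^sup>2) \<longlonglongrightarrow> 0"
    proof (intro AE_I2 tendsto_eventually)
      fix x
      show "\<forall>\<^sub>F n in sequentially. (cmod (h x - truncate (r n) h x))\<^sup>2 = 0"
        using eventually_truncate_eq[OF r, of h x] by eventually_elim simp
    qed
  qed (auto simp: truncate_def)
  then show "(\<lambda>n. (L2_norm (\<lambda>x. h x - truncate (r n) h x))\<^sup>2) \<longlonglongrightarrow> 0"
    by (simp add: L2_norm_square_borel)
qed

lemma L2_inner_truncate_tendsto:
  assumes h[measurable]: "h \<in> borel_measurable borel" and h2: "integrable lborel (\<lambda>x. (cmod (h x))\<^sup>2)"
    and f[measurable]: "f \<in> borel_measurable borel" and f2: "integrable lborel (\<lambda>x. (cmod (f x))\<^sup>2)"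
    and r: "filterlim r at_top sequentially"
  shows "(\<lambda>n. L2_inner (truncate (r n) h) f) \<longlonglongrightarrow> L2_inner h f"
proof -
  have "(\<lambda>n. LINT x|lborel. truncate (r n) h x * cnj (f x)) \<longlonglongrightarrow> (LINT x|lborel. h x * cnj (f x))"
  proof (rule integral_dominated_convergence)
    show "integrable lborel (\<lambda>x. norm (h x * cnj (f x)))"
      using integrable_L2_product[OF h f h2 f2] by (rule integrable_norm)
    show "AE x in lborel. (\<lambda>n. truncate (r n) h x * cnj (f x)) \<longlonglongrightarrow> h x * cnj (f x)"
    proof (intro AE_I2 tendsto_eventually)
      fix x
      show "\<forall>\<^sub>F n in sequentially. truncate (r n) h x * cnj (f x) = h x * cnj (f x)"
        using eventually_truncate_eq[OF r, of h x] by eventually_elim simp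
    qed
  qed (auto simp: truncate_def)
  then show ?thesis by (simp add: L2_inner_borel)
qed

context decaying_window
begin

lemma truncate_supp:
  assumes "\<beta> > 0" "x \<notin> {- (real n / \<beta>)..<- (real n / \<beta>) + real (2 * n) / \<beta>}"
  shows "truncate (real n / \<beta>) h x = 0"
  using assms(2) by (auto simp: truncate_def)

lemma filterlim_truncation_radius:
  assumes "\<beta> > 0"
  shows "filterlim (\<lambda>n. real n / \<beta>) at_top sequentially"
proof -
  have "filterlim (\<lambda>n. (1 / \<beta>) * real n) at_top sequentially"
    using assms by (intro filterlim_tendsto_pos_mult_at_top[OF tendsto_const] filterlim_real_sequentially) auto
  then show ?thesis by simp
qed

lemma energy_upper:
  assumes \<alpha>: "\<alpha> > 0" and \<beta>: "\<beta> > 0"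
  obtains B where "B > 0"
    "\<And>h J. \<lbrakk>h \<in> borel_measurable borel; integrable lborel (\<lambda>x. (cmod (h x))\<^sup>2); finite J\<rbrakk>
     \<Longrightarrow> sum (energy \<alpha> \<beta> h) J \<le> B * (L2_norm h)\<^sup>2"
proof -
  obtain B where B: "B > 0"
    "\<And>a N h J. \<lbrakk>h \<in> borel_measurable borel; integrable lborel (\<lambda>x. (cmod (h x))\<^sup>2);
       \<And>x. x \<notin> {a..<a + real N / \<beta>} \<Longrightarrow> h x = 0; finite J\<rbrakk>
     \<Longrightarrow> sum (energy \<alpha> \<beta> h) J \<le> B * (L2_norm h)\<^sup>2"
    using localized_energy_upper[OF \<alpha> \<beta>] by blast
  have "sum (energy \<alpha> \<beta> h) J \<le> B * (L2_norm h)\<^sup>2"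
    if h: "h \<in> borel_measurable borel" "integrable lborel (\<lambda>x. (cmod (h x))\<^sup>2)" and J: "finite J" for h J
  proof (rule LIMSEQ_le_const2)
    note [measurable] = h(1)
    show "(\<lambda>n. sum (energy \<alpha> \<beta> (truncate (real n / \<beta>) h)) J) \<longlonglongrightarrow> sum (energy \<alpha> \<beta> h) J"
      unfolding energy_def
      by (intro tendsto_sum tendsto_power tendsto_norm L2_inner_truncate_tendsto h gabor_measurable
          gabor_square_integrable filterlim_truncation_radius \<beta>)
    have "sum (energy \<alpha> \<beta> (truncate (real n / \<beta>) h)) J \<le> B * (L2_norm h)\<^sup>2" for n
    proof -
      have "sum (energy \<alpha> \<beta> (truncate (real n / \<beta>) h)) J \<le> B * (L2_norm (truncate (real n / \<beta>) h))\<^sup>2"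
        by (rule B(2)[OF _ truncate_square_integrable(1)[OF h] truncate_supp[OF \<beta>] J]) measurable
      also have "\<dots> \<le> B * (L2_norm h)\<^sup>2"
        using B(1) L2_norm_truncate_le[OF h] by (intro mult_left_mono) auto
      finally show ?thesis .
    qed
    then show "\<exists>N. \<forall>n\<ge>N. sum (energy \<alpha> \<beta> (truncate (real n / \<beta>) h)) J \<le> B * (L2_norm h)\<^sup>2" by blast
  qed
  then show ?thesis using that B(1) by blast
qed

text \<open>
Every row picked by \<open>sampled_lower_bound\<close> for some \<open>x\<close> in the period has its index in one finite set
\<open>I\<close>, since \<open>x + k/\<beta>\<close> stays in a bounded interval.
\<close>

lemma localized_energy_lower:
  assumes \<alpha>: "\<alpha> > 0" and \<beta>: "\<beta> > 0" and dens: "\<alpha> \<le> 1 / \<beta>"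
    and \<delta>: "\<delta> > 0" "\<And>x. 0 \<le> x \<Longrightarrow> x < \<alpha> \<Longrightarrow> \<delta> \<le> g x"
  obtains A where "A > 0"
    "\<And>a N h. \<lbrakk>h \<in> borel_measurable borel; integrable lborel (\<lambda>x. (cmod (h x))\<^sup>2);
       \<And>x. x \<notin> {a..<a + real N / \<beta>} \<Longrightarrow> h x = 0; energy \<alpha> \<beta> h summable_on UNIV\<rbrakk>
     \<Longrightarrow> A * (L2_norm h)\<^sup>2 \<le> infsum (energy \<alpha> \<beta> h) UNIV"
proof -
  have "0 < 1 / \<beta>" using \<beta> by simp
  then obtain q where q: "0 < q" "q < 1" "\<And>x. 0 \<le> x \<Longrightarrow> g (x + 1 / \<beta>) \<le> q * g x"
    using decay by blast
  define C where "C = (2 / (\<delta> * (1 - q)))\<^sup>2"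
  have C: "C > 0" using q \<delta> by (simp add: C_def)
  have "1 / (C * \<beta>) * (L2_norm h)\<^sup>2 \<le> infsum (energy \<alpha> \<beta> h) UNIV"
    if h: "h \<in> borel_measurable borel" "integrable lborel (\<lambda>x. (cmod (h x))\<^sup>2)"
      "\<And>x. x \<notin> {a..<a + real N / \<beta>} \<Longrightarrow> h x = 0" and summ: "energy \<alpha> \<beta> h summable_on UNIV"
    for a N h
  proof -
    define I where "I = {\<lfloor>a / \<alpha>\<rfloor>..\<lfloor>(a + (1 + real N) / \<beta>) / \<alpha>\<rfloor>}"
    have I: "finite I" by (simp add: I_def)
    let ?S = "\<lambda>x. \<Sum>m\<in>I. (cmod (fiber g \<alpha> \<beta> N h m x))\<^sup>2"
    have norm_h: "(L2_norm h)\<^sup>2 = (LINT x|period_measure a \<beta>. (\<Sum>k<N. (cmod (h (x + real k / \<beta>)))\<^sup>2))"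
      by (rule L2_norm_fiber[OF \<beta> measurable abs_bounded h])
    also have "\<dots> \<le> (LINT x|period_measure a \<beta>. C * ?S x)"
    proof (rule integral_mono_AE)
      show "integrable (period_measure a \<beta>) (\<lambda>x. \<Sum>k<N. (cmod (h (x + real k / \<beta>)))\<^sup>2)"
        by (rule integrable_fiber_norm[OF \<beta> measurable abs_bounded h])
      show "integrable (period_measure a \<beta>) (\<lambda>x. C * ?S x)"
        by (rule integrable_mult_right[OF integrable_sum_fiber[OF \<beta> h]])
      show "AE x in period_measure a \<beta>. (\<Sum>k<N. (cmod (h (x + real k / \<beta>)))\<^sup>2) \<le> C * ?S x"
        using AE_period[of a \<beta>]
      proof eventually_elim
        case (elim x)
        show ?case
          unfolding C_def fiber_def
        proof (rule sampled_lower_bound[OF \<alpha> \<beta> dens \<delta> q I])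
          fix k assume k: "k < N"
          have "real k / \<beta> \<le> real N / \<beta>" "0 \<le> real k / \<beta>" using k \<beta> by (auto intro: divide_right_mono)
          then have "a \<le> x + real k / \<beta>" "x + real k / \<beta> \<le> a + (1 + real N) / \<beta>"
            using elim by (auto simp: add_divide_distrib)
          then show "\<lfloor>(x + real k / \<beta>) / \<alpha>\<rfloor> \<in> I"
            unfolding I_def using \<alpha> by (auto intro!: floor_mono divide_right_mono)
        qed
      qed
    qed
    also have "\<dots> = C * \<beta> * ((LINT x|period_measure a \<beta>. ?S x) / \<beta>)"
      using \<beta> by simp
    also have "(LINT x|period_measure a \<beta>. ?S x) / \<beta> \<le> infsum (energy \<alpha> \<beta> h) UNIV"
    proof (rule has_sum_mono2)
      show "(energy \<alpha> \<beta> h has_sum (LINT x|period_measure a \<beta>. ?S x) / \<beta>) (I \<times> UNIV)"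
        by (rule energy_finite_shifts_has_sum[OF \<beta> h I summ])
      show "(energy \<alpha> \<beta> h has_sum infsum (energy \<alpha> \<beta> h) UNIV) UNIV"
        using summ by (rule has_sum_infsum)
    qed (auto simp: energy_nonneg)
    finally have "(L2_norm h)\<^sup>2 \<le> C * \<beta> * infsum (energy \<alpha> \<beta> h) UNIV"
      using C \<beta> by (simp add: mult_left_mono)
    then show ?thesis using C \<beta> by (simp add: field_simps)
  qed
  moreover have "1 / (C * \<beta>) > 0" using C \<beta> by simp
  ultimately show ?thesis using that by blast
qed

text \<open>
For general \<open>h = u + v\<close> with \<open>u\<close> a truncation of \<open>h\<close>, the termwise inequality
\<open>|(u,e)|\<^sup>2 \<le> 2|(h,e)|\<^sup>2 + 2|(v,e)|\<^sup>2\<close> and the upper bound for \<open>v\<close> transfer the lower bound from \<open>u\<close>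
to \<open>h\<close>, at the price of a factor \<open>2\<close>.
\<close>

theorem gabor_frame_if:
  assumes \<alpha>: "\<alpha> > 0" and \<beta>: "\<beta> > 0" and dens: "\<alpha> \<le> 1 / \<beta>"
    and \<delta>: "\<delta> > 0" "\<And>x. 0 \<le> x \<Longrightarrow> x < \<alpha> \<Longrightarrow> \<delta> \<le> g x"
  shows "L2_frame (gabor \<alpha> \<beta>)"
proof -
  obtain B where B: "B > 0"
    "\<And>h J. \<lbrakk>h \<in> borel_measurable borel; integrable lborel (\<lambda>x. (cmod (h x))\<^sup>2); finite J\<rbrakk>
     \<Longrightarrow> sum (energy \<alpha> \<beta> h) J \<le> B * (L2_norm h)\<^sup>2"
    using energy_upper[OF \<alpha> \<beta>] by blast
  obtain A where A: "A > 0"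
    "\<And>a N h. \<lbrakk>h \<in> borel_measurable borel; integrable lborel (\<lambda>x. (cmod (h x))\<^sup>2);
       \<And>x. x \<notin> {a..<a + real N / \<beta>} \<Longrightarrow> h x = 0; energy \<alpha> \<beta> h summable_on UNIV\<rbrakk>
     \<Longrightarrow> A * (L2_norm h)\<^sup>2 \<le> infsum (energy \<alpha> \<beta> h) UNIV"
    using localized_energy_lower[OF \<alpha> \<beta> dens \<delta>] by blast
  have summ: "energy \<alpha> \<beta> h summable_on UNIV"
    and upper: "infsum (energy \<alpha> \<beta> h) UNIV \<le> B * (L2_norm h)\<^sup>2"
    if h: "h \<in> borel_measurable borel" "integrable lborel (\<lambda>x. (cmod (h x))\<^sup>2)" for h
  proof -
    show s: "energy \<alpha> \<beta> h summable_on UNIV"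
      using B(2)[OF h] by (intro nonneg_bdd_above_summable_on bdd_aboveI2) (auto simp: energy_nonneg)
    show "infsum (energy \<alpha> \<beta> h) UNIV \<le> B * (L2_norm h)\<^sup>2"
      using B(2)[OF h] by (intro infsum_le_finite_sums[OF s]) auto
  qed
  have lower: "A / 2 * (L2_norm h)\<^sup>2 \<le> infsum (energy \<alpha> \<beta> h) UNIV"
    if h: "h \<in> borel_measurable borel" "integrable lborel (\<lambda>x. (cmod (h x))\<^sup>2)" for h
  proof -
    note [measurable] = h(1)
    define u where "u n = truncate (real n / \<beta>) h" for n
    define v where "v n x = h x - u n x" for n x
    have u: "u n \<in> borel_measurable borel" "integrable lborel (\<lambda>x. (cmod (u n x))\<^sup>2)" for n
      unfolding u_def using truncate_square_integrable(1)[OF h] by auto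
    have v: "v n \<in> borel_measurable borel" "integrable lborel (\<lambda>x. (cmod (v n x))\<^sup>2)" for n
      unfolding u_def v_def using truncate_square_integrable(2)[OF h] by auto
    have split: "energy \<alpha> \<beta> (u n) i \<le> 2 * energy \<alpha> \<beta> h i + 2 * energy \<alpha> \<beta> (v n) i" for n i
    proof -
      note int = integrable_L2_product[OF _ gabor_measurable _ gabor_square_integrable]
      have "L2_inner (v n) (gabor \<alpha> \<beta> i) = L2_inner h (gabor \<alpha> \<beta> i) - L2_inner (u n) (gabor \<alpha> \<beta> i)"
        using Bochner_Integration.integral_diff[OF int[OF h] int[OF u]]
        by (simp add: L2_inner_borel[OF _ gabor_measurable] h u v)
          (simp add: v_def left_diff_distrib)
      then show ?thesis
        using cmod_diff_square_triangle[of "L2_inner (u n) (gabor \<alpha> \<beta> i)" 0 "L2_inner h (gabor \<alpha> \<beta> i)"]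
        by (simp add: energy_def norm_minus_commute[of "L2_inner h (gabor \<alpha> \<beta> i)"])
    qed
    have est: "A * (L2_norm (u n))\<^sup>2 \<le> 2 * infsum (energy \<alpha> \<beta> h) UNIV + 2 * (B * (L2_norm (v n))\<^sup>2)" for n
    proof -
      have "A * (L2_norm (u n))\<^sup>2 \<le> infsum (energy \<alpha> \<beta> (u n)) UNIV"
        using truncate_supp[OF \<beta>, of _ n h]
        by (intro A(2)[where a = "- (real n / \<beta>)" and N = "2 * n", OF u _ summ[OF u]]) (simp add: u_def)
      also have "\<dots> \<le> infsum (\<lambda>i. 2 * energy \<alpha> \<beta> h i + 2 * energy \<alpha> \<beta> (v n) i) UNIV"
        using summ[OF h] summ[OF v] summ[OF u]
        by (intro infsum_mono split summable_on_add summable_on_cmult_right)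
      also have "\<dots> = 2 * infsum (energy \<alpha> \<beta> h) UNIV + 2 * infsum (energy \<alpha> \<beta> (v n)) UNIV"
        using summ[OF h] summ[OF v]
        by (subst infsum_add) (auto intro!: summable_on_cmult_right simp: infsum_cmult_right)
      finally show ?thesis using upper[OF v, of n] by linarith
    qed
    have "A * (L2_norm h)\<^sup>2 \<le> 2 * infsum (energy \<alpha> \<beta> h) UNIV + 2 * (B * 0)"
    proof (rule LIMSEQ_le)
      show "(\<lambda>n. A * (L2_norm (u n))\<^sup>2) \<longlonglongrightarrow> A * (L2_norm h)\<^sup>2"
        unfolding u_def
        by (intro tendsto_mult tendsto_const L2_norm_truncate_tendsto(1) h filterlim_truncation_radius \<beta>)
      show "(\<lambda>n. 2 * infsum (energy \<alpha> \<beta> h) UNIV + 2 * (B * (L2_norm (v n))\<^sup>2))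
          \<longlonglongrightarrow> 2 * infsum (energy \<alpha> \<beta> h) UNIV + 2 * (B * 0)"
        unfolding u_def v_def
        by (intro tendsto_add tendsto_mult tendsto_const L2_norm_truncate_tendsto(2) h
            filterlim_truncation_radius \<beta>)
    qed (use est in auto)
    then show ?thesis by simp
  qed
  show ?thesis
    unfolding L2_frame_def
  proof (intro exI conjI ballI)
    fix h assume "h \<in> L2"
    then obtain h' where h': "h' \<in> borel_measurable borel" "integrable lborel (\<lambda>x. (cmod (h' x))\<^sup>2)"
      "L2_norm h = L2_norm h'" "\<forall>f\<in>borel_measurable borel. L2_inner h f = L2_inner h' f"
      by (rule L2_ex_borel)
    have eq: "(\<lambda>i. (cmod (L2_inner h (gabor \<alpha> \<beta> i)))\<^sup>2) = energy \<alpha> \<beta> h'"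
      using h'(4) by (simp add: energy_def fun_eq_iff)
    show "(\<lambda>i. (cmod (L2_inner h (gabor \<alpha> \<beta> i)))\<^sup>2) summable_on UNIV"
      unfolding eq by (rule summ[OF h'(1,2)])
    show "A / 2 * (L2_norm h)\<^sup>2 \<le> (\<Sum>\<^sub>\<infinity>i. (cmod (L2_inner h (gabor \<alpha> \<beta> i)))\<^sup>2)"
      unfolding eq h'(3) by (rule lower[OF h'(1,2)])
    show "(\<Sum>\<^sub>\<infinity>i. (cmod (L2_inner h (gabor \<alpha> \<beta> i)))\<^sup>2) \<le> B * (L2_norm h)\<^sup>2"
      unfolding eq h'(3) by (rule upper[OF h'(1,2)])
  qed (use A B in auto)
qed

end

section \<open>Necessity\<close>

lemma underdetermined_system:
  fixes a :: "'m \<Rightarrow> 'n \<Rightarrow> real"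
  assumes "finite R" "finite J" "card R < card J"
  shows "\<exists>c. (\<exists>j\<in>J. c j \<noteq> 0) \<and> (\<forall>m\<in>R. (\<Sum>j\<in>J. a m j * c j) = 0)"
  using assms
proof (induction R arbitrary: a J rule: finite_induct)
  case empty
  then have "J \<noteq> {}" by auto
  then show ?case by (intro exI[of _ "\<lambda>_. 1"]) auto
next
  case (insert r R)
  show ?case
  proof (cases "\<forall>j\<in>J. a r j = 0")
    case True
    have "card R < card J" using insert by simp
    then obtain c where "\<exists>j\<in>J. c j \<noteq> 0" "\<forall>m\<in>R. (\<Sum>j\<in>J. a m j * c j) = 0"
      using insert.IH[of J a] insert.prems by auto
    then show ?thesis using True by (intro exI[of _ c]) auto
  next
    case False
    then obtain p where p: "p \<in> J" "a r p \<noteq> 0" by blast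
    define J' where "J' = J - {p}"
    define a' where "a' m j = a m j - a m p * a r j / a r p" for m j
    have "card R < card J'" using insert p by (simp add: J'_def)
    then obtain c' where c': "\<exists>j\<in>J'. c' j \<noteq> 0" "\<forall>m\<in>R. (\<Sum>j\<in>J'. a' m j * c' j) = 0"
      using insert.IH[of J' a'] insert.prems by (auto simp: J'_def)
    define s where "s = (\<Sum>j\<in>J'. a r j * c' j)"
    define c where "c = c'(p := - s / a r p)"
    have sum_c: "(\<Sum>j\<in>J. a m j * c j) = a m p * (- s / a r p) + (\<Sum>j\<in>J'. a m j * c' j)" for m
    proof -
      have "(\<Sum>j\<in>J. a m j * c j) = a m p * c p + (\<Sum>j\<in>J'. a m j * c j)"
        unfolding J'_def using p insert.prems by (intro sum.remove) auto
      also have "(\<Sum>j\<in>J'. a m j * c j) = (\<Sum>j\<in>J'. a m j * c' j)"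
        by (intro sum.cong) (auto simp: c_def J'_def)
      finally show ?thesis by (simp add: c_def)
    qed
    have "(\<Sum>j\<in>J. a m j * c j) = 0" if "m \<in> R" for m
    proof -
      have "0 = (\<Sum>j\<in>J'. a' m j * c' j)" using c' that by simp
      also have "\<dots> = (\<Sum>j\<in>J'. a m j * c' j - a m p / a r p * (a r j * c' j))"
        by (intro sum.cong) (auto simp: a'_def algebra_simps)
      also have "\<dots> = (\<Sum>j\<in>J'. a m j * c' j) - a m p / a r p * s"
        by (simp add: sum_subtractf sum_distrib_left s_def)
      finally show ?thesis unfolding sum_c by simp
    qed
    moreover have "(\<Sum>j\<in>J. a r j * c j) = 0"
      unfolding sum_c using p by (simp add: s_def)
    moreover have "\<exists>j\<in>J. c j \<noteq> 0" using c'(1) by (auto simp: c_def J'_def)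
    ultimately show ?thesis by (intro exI[of _ c]) auto
  qed
qed

context decaying_window
begin

text \<open>
The test function takes the value \<open>c\<^sub>k\<close> on the interval \<open>(a + k/\<beta>, a + k/\<beta> + \<epsilon>)\<close>, so the vector of
its values over \<open>x\<close> is \<open>c\<close> for \<open>x\<close> in \<open>(a, a + \<epsilon>)\<close> and \<open>0\<close> elsewhere in the period. The length \<open>\<epsilon>\<close>
cancels: a frame bounds the matrix from below on every vector, over every interval.
\<close>

lemma frame_fiber_test:
  assumes frame: "L2_frame (gabor \<alpha> \<beta>)" and \<beta>: "\<beta> > 0"
  obtains A where "A > 0"
    "\<And>a \<epsilon> N c \<eta>. \<lbrakk>0 < \<epsilon>; \<epsilon> \<le> 1 / \<beta>;
      \<And>x I. \<lbrakk>a < x; x < a + \<epsilon>; finite I\<rbrakk> \<Longrightarrow>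
        (\<Sum>m\<in>I. (cmod (\<Sum>k<N. c k * of_real (g (x + real k / \<beta> - \<alpha> * of_int m))))\<^sup>2) \<le> \<eta>\<rbrakk>
     \<Longrightarrow> A * (\<Sum>k<N. (cmod (c k))\<^sup>2) \<le> \<eta>"
proof -
  obtain A where A: "A > 0" "\<And>h. h \<in> L2 \<Longrightarrow> energy \<alpha> \<beta> h summable_on UNIV"
      "\<And>h. h \<in> L2 \<Longrightarrow> A * (L2_norm h)\<^sup>2 \<le> infsum (energy \<alpha> \<beta> h) UNIV"
    using frame unfolding L2_frame_def energy_def by blast
  have "A * \<beta> * (\<Sum>k<N. (cmod (c k))\<^sup>2) \<le> \<eta>"
    if \<epsilon>: "0 < \<epsilon>" "\<epsilon> \<le> 1 / \<beta>" and
      test: "\<And>x I. \<lbrakk>a < x; x < a + \<epsilon>; finite I\<rbrakk> \<Longrightarrow>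
        (\<Sum>m\<in>I. (cmod (\<Sum>k<N. c k * of_real (g (x + real k / \<beta> - \<alpha> * of_int m))))\<^sup>2) \<le> \<eta>"
    for a \<epsilon> N c \<eta>
  proof -
    define \<phi> where "\<phi> = (indicator {a<..<a + \<epsilon>} :: real \<Rightarrow> real)"
    define h where "h x = (\<Sum>k<N. c k * of_real (\<phi> (x - real k / \<beta>)))" for x
    let ?V = "\<Sum>k<N. (cmod (c k))\<^sup>2"
    have step: "real j / \<beta> + 1 / \<beta> \<le> real k / \<beta>" if "j < k" for j k :: nat
    proof -
      have "(real j + 1) / \<beta> \<le> real k / \<beta>" using that \<beta> by (intro divide_right_mono) auto
      then show ?thesis by (simp add: add_divide_distrib)
    qed
    have \<eta>: "0 \<le> \<eta>" using test[of "a + \<epsilon> / 2" "{}"] \<epsilon> by simp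
    have [measurable]: "\<phi> \<in> borel_measurable borel" by (simp add: \<phi>_def)
    have h[measurable]: "h \<in> borel_measurable borel" unfolding h_def by measurable
    have \<phi>_sq: "(\<phi> x)\<^sup>2 = \<phi> x" for x by (simp add: \<phi>_def indicator_def)
    have \<phi>_int: "integrable lborel \<phi>"
      unfolding \<phi>_def using \<epsilon> by (intro integrable_real_indicator) auto
    have \<phi>_period: "integrable (period_measure a \<beta>) \<phi>" "integral\<^sup>L (period_measure a \<beta>) \<phi> = \<epsilon>"
    proof -
      have eq: "indicator {a..<a + 1 / \<beta>} x *\<^sub>R \<phi> x = \<phi> x" for x
        using \<epsilon> by (auto simp: \<phi>_def indicator_def)
      show "integrable (period_measure a \<beta>) \<phi>"
        by (subst integrable_period_measure) (simp_all add: eq \<phi>_int del: real_scaleR_def)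
      have "integral\<^sup>L (period_measure a \<beta>) \<phi> = integral\<^sup>L lborel \<phi>"
        by (subst integral_period_measure) (simp_all add: eq del: real_scaleR_def)
      then show "integral\<^sup>L (period_measure a \<beta>) \<phi> = \<epsilon>" using \<epsilon> by (simp add: \<phi>_def)
    qed
    have h2: "integrable lborel (\<lambda>x. (cmod (h x))\<^sup>2)"
    proof (rule Bochner_Integration.integrable_bound)
      have "integrable lborel (\<lambda>x. \<phi> (x - real k / \<beta>))" for k
        using lborel_integrable_real_affine[OF \<phi>_int, of 1 "- (real k / \<beta>)"] by simp
      then show "integrable lborel (\<lambda>x. real N * (\<Sum>k<N. (cmod (c k))\<^sup>2 * \<phi> (x - real k / \<beta>)))"
        by (intro integrable_mult_right Bochner_Integration.integrable_sum) auto
      have "(cmod (h x))\<^sup>2 \<le> real N * (\<Sum>k<N. (cmod (c k))\<^sup>2 * \<phi> (x - real k / \<beta>))" for x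
        using cmod_sum_squared_le[of "\<lambda>k. c k * of_real (\<phi> (x - real k / \<beta>))" N]
        by (simp add: h_def norm_mult power_mult_distrib \<phi>_sq)
      then show "AE x in lborel. norm ((cmod (h x))\<^sup>2)
          \<le> norm (real N * (\<Sum>k<N. (cmod (c k))\<^sup>2 * \<phi> (x - real k / \<beta>)))"
        by (auto intro!: always_eventually order_trans[OF _ abs_ge_self])
    qed measurable
    have supp: "h x = 0" if x: "x \<notin> {a..<a + real N / \<beta>}" for x
      unfolding h_def
    proof (intro sum.neutral ballI)
      fix k assume "k \<in> {..<N}"
      then have "real k / \<beta> + 1 / \<beta> \<le> real N / \<beta>" "0 \<le> real k / \<beta>"
        using \<beta> step[of k N] by auto
      then have "x - real k / \<beta> \<notin> {a<..<a + \<epsilon>}" using x \<epsilon> by auto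
      then show "c k * of_real (\<phi> (x - real k / \<beta>)) = 0" by (simp add: \<phi>_def)
    qed
    have cell: "h (x + real k / \<beta>) = c k * of_real (\<phi> x)" if x: "x \<in> {a..<a + 1 / \<beta>}" and k: "k < N" for x k
    proof -
      have "h (x + real k / \<beta>) = (\<Sum>j<N. if j = k then c k * of_real (\<phi> x) else 0)"
        unfolding h_def
      proof (intro sum.cong refl)
        fix j
        show "c j * of_real (\<phi> (x + real k / \<beta> - real j / \<beta>)) = (if j = k then c k * of_real (\<phi> x) else 0)"
        proof (cases "j = k")
          case False
          have "x + real k / \<beta> - real j / \<beta> \<notin> {a<..<a + \<epsilon>}"
          proof (cases "j < k")
            case True
            then show ?thesis using x \<epsilon> step[of j k] by auto
          next
            case False
            then show ?thesis using x step[of k j] \<open>j \<noteq> k\<close> by auto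
          qed
          then show ?thesis using False by (simp add: \<phi>_def)
        qed simp
      qed
      then show ?thesis using k by simp
    qed
    have norm_h: "(L2_norm h)\<^sup>2 = \<epsilon> * ?V"
    proof -
      have "(L2_norm h)\<^sup>2 = (LINT x|period_measure a \<beta>. (\<Sum>k<N. (cmod (h (x + real k / \<beta>)))\<^sup>2))"
        by (rule L2_norm_fiber[OF \<beta> measurable abs_bounded h h2 supp])
      also have "\<dots> = (LINT x|period_measure a \<beta>. ?V * \<phi> x)"
      proof (rule integral_cong_AE)
        show "AE x in period_measure a \<beta>. (\<Sum>k<N. (cmod (h (x + real k / \<beta>)))\<^sup>2) = ?V * \<phi> x"
          using AE_period[of a \<beta>]
          by eventually_elim (simp add: cell norm_mult power_mult_distrib \<phi>_sq sum_distrib_right)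
      qed measurable
      finally show ?thesis using \<phi>_period by simp
    qed
    have h_L2: "h \<in> L2" by (rule borel_in_L2[OF h h2])
    have "sum (energy \<alpha> \<beta> h) J \<le> (\<eta> * \<epsilon>) / \<beta>" if J: "finite J" for J
    proof (rule energy_finite_sum_le[OF \<beta> h h2 supp _ J])
      fix I :: "int set" assume I: "finite I"
      have "(LINT x|period_measure a \<beta>. (\<Sum>m\<in>I. (cmod (fiber g \<alpha> \<beta> N h m x))\<^sup>2))
          \<le> (LINT x|period_measure a \<beta>. \<eta> * \<phi> x)"
      proof (rule integral_mono_AE)
        show "integrable (period_measure a \<beta>) (\<lambda>x. \<Sum>m\<in>I. (cmod (fiber g \<alpha> \<beta> N h m x))\<^sup>2)"
          by (rule integrable_sum_fiber[OF \<beta> h h2 supp])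
        show "integrable (period_measure a \<beta>) (\<lambda>x. \<eta> * \<phi> x)" using \<phi>_period by simp
        show "AE x in period_measure a \<beta>. (\<Sum>m\<in>I. (cmod (fiber g \<alpha> \<beta> N h m x))\<^sup>2) \<le> \<eta> * \<phi> x"
          using AE_period[of a \<beta>]
        proof eventually_elim
          case (elim x)
          have fib: "fiber g \<alpha> \<beta> N h m x
              = of_real (\<phi> x) * (\<Sum>k<N. c k * of_real (g (x + real k / \<beta> - \<alpha> * of_int m)))" for m
            unfolding fiber_def by (simp add: cell[OF elim] sum_distrib_left mult_ac)
          show ?case
          proof (cases "x \<in> {a<..<a + \<epsilon>}")
            case True
            then show ?thesis using test[of x I] I unfolding fib by (simp add: \<phi>_def)
          qed (simp add: fib \<phi>_def)
        qed
      qed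
      then show "(LINT x|period_measure a \<beta>. (\<Sum>m\<in>I. (cmod (fiber g \<alpha> \<beta> N h m x))\<^sup>2)) \<le> \<eta> * \<epsilon>"
        using \<phi>_period by simp
    qed
    then have "infsum (energy \<alpha> \<beta> h) UNIV \<le> (\<eta> * \<epsilon>) / \<beta>"
      by (intro infsum_le_finite_sums A(2) h_L2) auto
    then have "A * (\<epsilon> * ?V) \<le> (\<eta> * \<epsilon>) / \<beta>"
      using A(3)[OF h_L2] norm_h by simp
    then have "\<epsilon> * (A * \<beta> * ?V) \<le> \<epsilon> * \<eta>" using \<beta> by (simp add: field_simps)
    then show ?thesis using \<epsilon> by simp
  qed
  moreover have "A * \<beta> > 0" using A(1) \<beta> by simp
  ultimately show ?thesis using that by blast
qed

text \<open>
The translate of \<open>g\<close> by \<open>s\<close>, cut off at \<open>0\<close>, decays with the same ratios as \<open>g\<close> but starts from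
\<open>g s\<close>; the bound is therefore proportional to \<open>(g s)\<^sup>2\<close> with a constant independent of \<open>s\<close>.
\<close>

lemma shifted_sampled_upper_bound:
  assumes \<alpha>: "\<alpha> > 0" and \<beta>: "\<beta> > 0"
  obtains D where "D > 0"
    "\<And>s N c y I. \<lbrakk>0 \<le> s; finite I\<rbrakk> \<Longrightarrow>
      (\<Sum>m\<in>I. (cmod (\<Sum>k<N. c k * of_real
        ((if y + real k / \<beta> - \<alpha> * of_int m < 0 then 0 else g (y + real k / \<beta> - \<alpha> * of_int m + s)))))\<^sup>2)
      \<le> (g s)\<^sup>2 * D * (\<Sum>k<N. (cmod (c k))\<^sup>2)"
proof -
  obtain q where q: "0 < q" "q < 1" "\<And>x. 0 \<le> x \<Longrightarrow> g (x + \<alpha>) \<le> q * g x"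
    using decay[OF \<alpha>] by blast
  have "0 < 1 / \<beta>" using \<beta> by simp
  then obtain q' where q': "0 < q'" "q' < 1" "\<And>x. 0 \<le> x \<Longrightarrow> g (x + 1 / \<beta>) \<le> q' * g x"
    using decay by blast
  define D where "D = 1 / ((1 - q) * (1 - q'))"
  have "D > 0" using q q' by (simp add: D_def)
  moreover have "(\<Sum>m\<in>I. (cmod (\<Sum>k<N. c k * of_real
        ((if y + real k / \<beta> - \<alpha> * of_int m < 0 then 0 else g (y + real k / \<beta> - \<alpha> * of_int m + s)))))\<^sup>2)
      \<le> (g s)\<^sup>2 * D * (\<Sum>k<N. (cmod (c k))\<^sup>2)"
    if s: "0 \<le> s" and I: "finite I" for s N c y I
  proof -
    define \<gamma> where "\<gamma> u = (if u < 0 then 0 else g (u + s))" for u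
    have "(\<Sum>m\<in>I. (cmod (\<Sum>k<N. c k * of_real (\<gamma> (y + real k / \<beta> - \<alpha> * of_int m))))\<^sup>2)
        \<le> (g s)\<^sup>2 / ((1 - q) * (1 - q')) * (\<Sum>k<N. (cmod (c k))\<^sup>2)"
    proof (rule sampled_upper_bound[OF _ _ _ _ _ _ _ \<alpha> _ \<beta> _ I])
      show "\<gamma> u \<le> g s" for u using s nonneg by (auto simp: \<gamma>_def intro!: antimono)
      show "\<gamma> (u + \<alpha>) \<le> q * \<gamma> u" if "0 \<le> u" for u
        using q(3)[of "u + s"] that s \<alpha> by (simp add: \<gamma>_def algebra_simps)
      show "\<gamma> (u + 1 / \<beta>) \<le> q' * \<gamma> u" if "0 \<le> u" for u
      proof -
        have "0 \<le> u + 1 / \<beta>" using that \<beta> by simp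
        then show ?thesis using q'(3)[of "u + s"] that s by (simp add: \<gamma>_def algebra_simps)
      qed
    qed (use q q' nonneg in \<open>auto simp: \<gamma>_def\<close>)
    then show ?thesis by (simp add: \<gamma>_def D_def)
  qed
  ultimately show ?thesis using that by blast
qed

text \<open>
For \<open>x\<close> in \<open>(s, \<alpha>)\<close> all translates with \<open>m > 0\<close> vanish at \<open>x\<close>, and those with \<open>m \<le> 0\<close> sample \<open>g\<close> at and
beyond \<open>x\<close>. Hence the single column over \<open>x\<close> has square norm at most \<open>D (g s)\<^sup>2\<close>, and the lower frame
bound \<open>A\<close> forces \<open>g s \<ge> sqrt (A/D)\<close>.
\<close>

theorem frame_imp_bounded_below:
  assumes frame: "L2_frame (gabor \<alpha> \<beta>)" and \<alpha>: "\<alpha> > 0" and \<beta>: "\<beta> > 0"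
  shows "\<exists>\<delta>>0. \<forall>x. 0 \<le> x \<longrightarrow> x < \<alpha> \<longrightarrow> \<delta> \<le> g x"
proof -
  obtain A where A: "A > 0"
    "\<And>a \<epsilon> N c \<eta>. \<lbrakk>0 < \<epsilon>; \<epsilon> \<le> 1 / \<beta>;
      \<And>x I. \<lbrakk>a < x; x < a + \<epsilon>; finite I\<rbrakk> \<Longrightarrow>
        (\<Sum>m\<in>I. (cmod (\<Sum>k<N. c k * of_real (g (x + real k / \<beta> - \<alpha> * of_int m))))\<^sup>2) \<le> \<eta>\<rbrakk>
     \<Longrightarrow> A * (\<Sum>k<N. (cmod (c k))\<^sup>2) \<le> \<eta>"
    using frame_fiber_test[OF frame \<beta>] by blast
  obtain D where D: "D > 0"
    "\<And>s N c y I. \<lbrakk>0 \<le> s; finite I\<rbrakk> \<Longrightarrow>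
      (\<Sum>m\<in>I. (cmod (\<Sum>k<N. c k * of_real
        ((if y + real k / \<beta> - \<alpha> * of_int m < 0 then 0 else g (y + real k / \<beta> - \<alpha> * of_int m + s)))))\<^sup>2)
      \<le> (g s)\<^sup>2 * D * (\<Sum>k<N. (cmod (c k))\<^sup>2)"
    using shifted_sampled_upper_bound[OF \<alpha> \<beta>] by blast
  have "sqrt (A / D) \<le> g s" if s: "0 \<le> s" "s < \<alpha>" for s
  proof -
    have "A * (\<Sum>k<1::nat. (cmod 1)\<^sup>2) \<le> (g s)\<^sup>2 * D"
    proof (rule A(2)[where a = s and \<epsilon> = "min (\<alpha> - s) (1 / \<beta>)"])
      fix x and I :: "int set"
      assume x: "s < x" "x < s + min (\<alpha> - s) (1 / \<beta>)" and I: "finite I"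
      let ?\<gamma> = "\<lambda>m k. if 0 + real k / \<beta> - \<alpha> * of_int m < 0 then 0
        else g (0 + real k / \<beta> - \<alpha> * of_int m + x)"
      have "g (x + real k / \<beta> - \<alpha> * of_int m) = ?\<gamma> m k" if "k < 1" for m :: int and k :: nat
      proof (cases "m \<le> 0")
        case True
        then have "0 \<le> - (\<alpha> * of_int m)" using \<alpha> by (simp add: mult_nonneg_nonpos)
        then show ?thesis using that by (simp add: add.commute)
      next
        case False
        then have "\<alpha> * 1 \<le> \<alpha> * of_int m" using \<alpha> by (intro mult_left_mono) auto
        moreover have "x < \<alpha>" using x by simp
        ultimately have "x - \<alpha> * of_int m < 0" "- (\<alpha> * of_int m) < 0" using \<alpha> by linarith+
        then show ?thesis using that by (simp add: zero)
      qed
      then have "(\<Sum>k<1::nat. 1 * complex_of_real (g (x + real k / \<beta> - \<alpha> * of_int m)))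
          = (\<Sum>k<1::nat. 1 * complex_of_real (?\<gamma> m k))" for m :: int
        by (intro sum.cong refl) (simp only: lessThan_iff)
      then have "(\<Sum>m\<in>I. (cmod (\<Sum>k<1::nat. 1 * of_real (g (x + real k / \<beta> - \<alpha> * of_int m))))\<^sup>2)
          = (\<Sum>m\<in>I. (cmod (\<Sum>k<1::nat. 1 * of_real (?\<gamma> m k)))\<^sup>2)"
        by (simp only:)
      also have "\<dots> \<le> (g x)\<^sup>2 * D * (\<Sum>k<1::nat. (cmod 1)\<^sup>2)"
        using x s I by (intro D(2)) auto
      also have "\<dots> = (g x)\<^sup>2 * D" by simp
      also have "\<dots> \<le> (g s)\<^sup>2 * D"
        using x s D(1) antimono[of s x] nonneg by (intro mult_right_mono power_mono) auto
      finally show "(\<Sum>m\<in>I. (cmod (\<Sum>k<1::nat. 1 * of_real (g (x + real k / \<beta> - \<alpha> * of_int m))))\<^sup>2)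
          \<le> (g s)\<^sup>2 * D" .
    qed (use s \<alpha> \<beta> in auto)
    then have "A / D \<le> (g s)\<^sup>2" using D(1) by (simp add: pos_divide_le_eq)
    then show ?thesis using nonneg[of s] by (intro real_le_lsqrt) auto
  qed
  moreover have "sqrt (A / D) > 0" using A(1) D(1) by simp
  ultimately show ?thesis by blast
qed

lemma countable_discontinuities: "countable {x. \<not> isCont g x}"
proof -
  have "mono_on {0<..} (\<lambda>x. - g x)"
    by (intro mono_onI) (auto intro!: antimono)
  then have "countable {x \<in> {0<..}. \<not> isCont (\<lambda>x. - g x) x}"
    by (intro mono_on_ctble_discont_open) auto
  moreover have "isCont g x" if "x < 0" for x
  proof -
    have "\<forall>\<^sub>F y in nhds x. g y = 0"
      using eventually_nhds_in_open[of "{..<0}" x] that by (auto elim!: eventually_mono intro: zero)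
    then show ?thesis by (simp add: isCont_cong[of g "\<lambda>_. 0"])
  qed
  moreover have "isCont g x" if "isCont (\<lambda>x. - g x) x" for x
    using continuous_minus[OF that] by simp
  ultimately have "{x. \<not> isCont g x} \<subseteq> insert 0 {x \<in> {0<..}. \<not> isCont (\<lambda>x. - g x) x}"
    by (smt (verit) greaterThan_iff insert_iff mem_Collect_eq subsetI)
  with \<open>countable {x \<in> {0<..}. \<not> isCont (\<lambda>x. - g x) x}\<close> show ?thesis
    by (meson countable_insert countable_subset)
qed

end

context decaying_window
begin

text \<open>
For \<open>x\<close> in the first period and \<open>N\<close> columns, rows with \<open>\<alpha>m > N/\<beta>\<close> vanish, and rows with \<open>m \<le> -l\<close>
carry at most the fraction \<open>A/2\<close> of the square norm when \<open>l\<close> is large, independently of \<open>N\<close>. The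
remaining rows number about \<open>N/(\<alpha>\<beta>) + l\<close>, fewer than \<open>N\<close> for large \<open>N\<close> if \<open>\<alpha>\<beta> > 1\<close>; hence some
\<open>c \<noteq> 0\<close> is annihilated by all of them at a given \<open>x\<close>. A test function needs this on an
interval: \<open>g\<close> is monotone on \<open>[0,\<infinity>)\<close>, so almost every \<open>x\<close> makes all matrix entries in question
continuous at \<open>x\<close>, and to the right of \<open>x\<close> the rows stay small.
\<close>

theorem frame_imp_density:
  assumes frame: "L2_frame (gabor \<alpha> \<beta>)" and \<alpha>: "\<alpha> > 0" and \<beta>: "\<beta> > 0"
  shows "\<alpha> \<le> 1 / \<beta>"
proof (rule ccontr)
  assume "\<not> \<alpha> \<le> 1 / \<beta>"
  then have dens: "\<alpha> * \<beta> > 1" using \<beta> by (simp add: field_simps not_le)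
  obtain A where A: "A > 0"
    "\<And>a \<epsilon> N c \<eta>. \<lbrakk>0 < \<epsilon>; \<epsilon> \<le> 1 / \<beta>;
      \<And>x I. \<lbrakk>a < x; x < a + \<epsilon>; finite I\<rbrakk> \<Longrightarrow>
        (\<Sum>m\<in>I. (cmod (\<Sum>k<N. c k * of_real (g (x + real k / \<beta> - \<alpha> * of_int m))))\<^sup>2) \<le> \<eta>\<rbrakk>
     \<Longrightarrow> A * (\<Sum>k<N. (cmod (c k))\<^sup>2) \<le> \<eta>"
    using frame_fiber_test[OF frame \<beta>] by blast
  obtain D where D: "D > 0"
    "\<And>s N c y I. \<lbrakk>0 \<le> s; finite I\<rbrakk> \<Longrightarrow>
      (\<Sum>m\<in>I. (cmod (\<Sum>k<N. c k * of_real
        ((if y + real k / \<beta> - \<alpha> * of_int m < 0 then 0 else g (y + real k / \<beta> - \<alpha> * of_int m + s)))))\<^sup>2)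
      \<le> (g s)\<^sup>2 * D * (\<Sum>k<N. (cmod (c k))\<^sup>2)"
    using shifted_sampled_upper_bound[OF \<alpha> \<beta>] by blast
  obtain q where q: "0 < q" "q < 1" "\<And>x. 0 \<le> x \<Longrightarrow> g (x + \<alpha>) \<le> q * g x"
    using decay[OF \<alpha>] by blast
  have "(\<lambda>l. (q ^ l * g 0)\<^sup>2 * D) \<longlonglongrightarrow> (0 * g 0)\<^sup>2 * D"
    by (intro tendsto_intros LIMSEQ_power_zero) (use q in auto)
  then have "\<forall>\<^sub>F l in sequentially. (q ^ l * g 0)\<^sup>2 * D < A / 2"
    by (rule order_tendstoD(2)) (use A in simp)
  then obtain l where l: "(q ^ l * g 0)\<^sup>2 * D < A / 2" by (auto simp: eventually_sequentially)
  have "g (0 + \<alpha> * real l) \<le> q ^ l * g 0"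
    using q by (intro geometric_decay_iterate[where \<gamma> = g, OF \<alpha>]) auto
  then have tail: "(g (\<alpha> * real l))\<^sup>2 * D \<le> A / 2"
    using l D(1) nonneg[of "\<alpha> * real l"] power_mono[of "g (\<alpha> * real l)" "q ^ l * g 0" 2]
    by (smt (verit) add_0 mult_right_mono)
  \<comment> \<open>About \<open>(1 - \<theta>) N\<close> rows meet the \<open>N\<close> columns above the tail, so \<open>N > l/\<theta>\<close> leaves room for \<open>l\<close> more.\<close>
  define \<theta> where "\<theta> = 1 - 1 / (\<alpha> * \<beta>)"
  have \<theta>: "\<theta> > 0" using dens by (simp add: \<theta>_def)
  obtain N :: nat where "real l / \<theta> < real N" using reals_Archimedean2 by blast
  then have "real l < real N * \<theta>" using \<theta> by (simp add: pos_divide_less_eq)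
  then have N: "real N / (\<alpha> * \<beta>) + real l < real N" by (simp add: \<theta>_def algebra_simps)
  define T where "T = \<lfloor>real N / (\<alpha> * \<beta>)\<rfloor>"
  define R where "R = {- int l<..T}"
  have "T \<ge> 0" using \<alpha> \<beta> by (simp add: T_def)
  moreover have "of_int T \<le> real N / (\<alpha> * \<beta>)" by (simp add: T_def)
  ultimately have "card R < N" using N by (simp add: R_def nat_less_iff)
  then have card: "card R < card {..<N}" by simp
  have R: "finite R" by (simp add: R_def)
  \<comment> \<open>The points at which some entry of the finite matrix fails to be continuous.\<close>
  define Z where "Z = (\<Union>k\<in>{..<N}. \<Union>m\<in>R. (\<lambda>u. u - real k / \<beta> + \<alpha> * of_int m) ` {u. \<not> isCont g u})"
  have "countable Z"
    unfolding Z_def using R countable_discontinuities by (intro countable_UN countable_image) auto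
  moreover have "uncountable {0<..<1 / \<beta>}" using \<beta> by (simp add: uncountable_open_interval)
  ultimately have "\<not> {0<..<1 / \<beta>} \<subseteq> Z" using countable_subset by blast
  then obtain x where x: "0 < x" "x < 1 / \<beta>" "x \<notin> Z"
    by (meson greaterThanLessThan_iff subsetI)
  have cont: "isCont g (x + real k / \<beta> - \<alpha> * of_int m)" if "k < N" "m \<in> R" for k m
  proof (rule ccontr)
    assume "\<not> isCont g (x + real k / \<beta> - \<alpha> * of_int m)"
    then have "x \<in> (\<lambda>u. u - real k / \<beta> + \<alpha> * of_int m) ` {u. \<not> isCont g u}"
      by (intro image_eqI[of _ _ "x + real k / \<beta> - \<alpha> * of_int m"]) auto
    then show False using x(3) that unfolding Z_def by blast
  qed
  obtain c where c: "\<exists>k<N. c k \<noteq> 0"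
    "\<And>m. m \<in> R \<Longrightarrow> (\<Sum>k<N. g (x + real k / \<beta> - \<alpha> * of_int m) * c k) = 0"
    using underdetermined_system[OF R _ card, of "\<lambda>m k. g (x + real k / \<beta> - \<alpha> * of_int m)"] by auto
  define c' where "c' k = complex_of_real (c k)" for k
  define V where "V = (\<Sum>k<N. (cmod (c' k))\<^sup>2)"
  obtain k\<^sub>0 where "k\<^sub>0 < N" "c k\<^sub>0 \<noteq> 0" using c(1) by blast
  then have V: "V > 0"
    unfolding V_def by (intro sum_pos2[of _ k\<^sub>0]) (auto simp: c'_def)
  define F where "F y m = (cmod (\<Sum>k<N. c' k * of_real (g (y + real k / \<beta> - \<alpha> * of_int m))))\<^sup>2" for y m
  define \<Phi> where "\<Phi> y = (\<Sum>m\<in>R. F y m)" for y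
  have "F x m = 0" if "m \<in> R" for m
  proof -
    have "(\<Sum>k<N. c' k * of_real (g (x + real k / \<beta> - \<alpha> * of_int m)))
        = of_real (\<Sum>k<N. g (x + real k / \<beta> - \<alpha> * of_int m) * c k)"
      by (simp add: c'_def mult.commute)
    then show ?thesis using c(2)[OF that] by (simp add: F_def)
  qed
  then have "\<Phi> x = 0" by (simp add: \<Phi>_def)
  have "isCont \<Phi> x"
    unfolding \<Phi>_def F_def
  proof (intro continuous_intros)
    fix m k assume mk: "m \<in> R" "k \<in> {..<N}"
    have "isCont (\<lambda>y. y + real k / \<beta> - \<alpha> * of_int m) x" by (intro continuous_intros)
    then show "isCont (\<lambda>y. g (y + real k / \<beta> - \<alpha> * of_int m)) x"
      by (rule isCont_o2[where g = g]) (use cont mk in auto)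
  qed
  then have "\<forall>\<^sub>F y in at x. \<Phi> y < A / 4 * V"
    using A V \<open>\<Phi> x = 0\<close> unfolding isCont_def by (intro order_tendstoD(2)) auto
  then obtain d where d: "d > 0" "\<And>y. y \<noteq> x \<Longrightarrow> dist y x < d \<Longrightarrow> \<Phi> y < A / 4 * V"
    unfolding eventually_at by auto
  have "A * V \<le> A / 4 * V + A / 2 * V"
    unfolding V_def
  proof (rule A(2)[where a = x and \<epsilon> = "min d (1 / \<beta> - x)"])
    fix y and I :: "int set"
    assume y: "x < y" "y < x + min d (1 / \<beta> - x)" and I: "finite I"
    define I1 where "I1 = {m \<in> I. T < m}"
    define I2 where "I2 = {m \<in> I. m \<in> R}"
    define I3 where "I3 = {m \<in> I. m \<le> - int l}"
    have "\<Phi> y < A / 4 * V" using d(2)[of y] y by (simp add: dist_real_def)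
    moreover have "(\<Sum>m\<in>I2. F y m) \<le> \<Phi> y"
      unfolding \<Phi>_def using R by (intro sum_mono2) (auto simp: I2_def F_def)
    ultimately have s2: "(\<Sum>m\<in>I2. F y m) \<le> A / 4 * V" by linarith
    have s1: "(\<Sum>m\<in>I1. F y m) = 0"
    proof (rule sum.neutral, rule ballI)
      fix m assume "m \<in> I1"
      then have "real N / (\<alpha> * \<beta>) < of_int m" unfolding I1_def T_def by (simp add: floor_less_iff)
      then have m: "real N / \<beta> < \<alpha> * of_int m" using \<alpha> \<beta> by (simp add: field_simps)
      have "g (y + real k / \<beta> - \<alpha> * of_int m) = 0" if "k < N" for k
      proof (rule zero)
        have "(real k + 1) / \<beta> \<le> real N / \<beta>" using that \<beta> by (intro divide_right_mono) auto
        then have "real k / \<beta> + 1 / \<beta> \<le> real N / \<beta>" by (simp add: add_divide_distrib)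
        moreover have "y < 1 / \<beta>" using y by simp
        ultimately show "y + real k / \<beta> - \<alpha> * of_int m < 0" using m by linarith
      qed
      then show "F y m = 0" by (simp add: F_def)
    qed
    have s3: "(\<Sum>m\<in>I3. F y m) \<le> A / 2 * V"
    proof -
      let ?\<gamma> = "\<lambda>k m. if y + real k / \<beta> - \<alpha> * of_int m < 0 then 0
        else g (y + real k / \<beta> - \<alpha> * of_int m + \<alpha> * real l)"
      have "(\<Sum>m\<in>I3. F y m) = (\<Sum>m\<in>(\<lambda>m. m + int l) ` I3. F y (m - int l))"
        by (subst sum.reindex) (auto simp: inj_on_def)
      also have "\<dots> = (\<Sum>m\<in>(\<lambda>m. m + int l) ` I3. (cmod (\<Sum>k<N. c' k * of_real (?\<gamma> k m)))\<^sup>2)"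
      proof (intro sum.cong refl)
        fix m assume "m \<in> (\<lambda>m. m + int l) ` I3"
        then have "m \<le> 0" by (auto simp: I3_def)
        then have "\<alpha> * of_int m \<le> 0" using \<alpha> by (simp add: mult_nonneg_nonpos)
        have "g (y + real k / \<beta> - \<alpha> * of_int (m - int l)) = ?\<gamma> k m" for k
        proof -
          have "0 \<le> real k / \<beta>" using \<beta> by simp
          then have "\<not> y + real k / \<beta> - \<alpha> * of_int m < 0"
            using x(1) y(1) \<open>\<alpha> * of_int m \<le> 0\<close> by linarith
          then show ?thesis by (simp add: algebra_simps)
        qed
        then show "F y (m - int l) = (cmod (\<Sum>k<N. c' k * of_real (?\<gamma> k m)))\<^sup>2"
          unfolding F_def by (simp only:)
      qed
      also have "\<dots> \<le> (g (\<alpha> * real l))\<^sup>2 * D * V"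
        unfolding V_def using \<alpha> I by (intro D(2)) (auto simp: I3_def)
      also have "\<dots> \<le> A / 2 * V" using tail V by (intro mult_right_mono) auto
      finally show ?thesis .
    qed
    have "I = I1 \<union> I2 \<union> I3" by (auto simp: I1_def I2_def I3_def R_def)
    then have "(\<Sum>m\<in>I. F y m) = (\<Sum>m\<in>I1 \<union> I2 \<union> I3. F y m)" by simp
    also have "\<dots> = (\<Sum>m\<in>I1. F y m) + (\<Sum>m\<in>I2. F y m) + (\<Sum>m\<in>I3. F y m)"
      using I \<open>T \<ge> 0\<close> by (subst sum.union_disjoint, auto simp: I1_def I2_def I3_def R_def)+
    finally have "(\<Sum>m\<in>I. F y m) \<le> A / 4 * V + A / 2 * V" using s1 s2 s3 by linarith
    then show "(\<Sum>m\<in>I. (cmod (\<Sum>k<N. c' k * of_real (g (y + real k / \<beta> - \<alpha> * of_int m))))\<^sup>2)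
        \<le> A / 4 * (\<Sum>k<N. (cmod (c' k))\<^sup>2) + A / 2 * (\<Sum>k<N. (cmod (c' k))\<^sup>2)"
      unfolding F_def V_def .
  qed (use d x in auto)
  then have "A * V \<le> 0" by simp
  then show False using A V by (simp add: mult_le_0_iff)
qed

theorem gabor_frame_iff:
  assumes \<alpha>: "\<alpha> > 0" and \<beta>: "\<beta> > 0"
  shows "L2_frame (gabor \<alpha> \<beta>) \<longleftrightarrow>
    \<alpha> * \<beta> \<le> 1 \<and> (\<exists>\<delta>>0. \<forall>x. 0 \<le> x \<longrightarrow> x < \<alpha> \<longrightarrow> \<delta> \<le> g x)"
proof -
  have "\<alpha> \<le> 1 / \<beta> \<longleftrightarrow> \<alpha> * \<beta> \<le> 1" using \<beta> by (simp add: field_simps)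
  then show ?thesis
    using frame_imp_density[OF _ \<alpha> \<beta>] frame_imp_bounded_below[OF _ \<alpha> \<beta>] gabor_frame_if[OF \<alpha> \<beta>] by blast
qed

section \<open>The end of the support\<close>

lemma pos_below_support_end:
  assumes "0 \<le> x" "ennreal x < support_end g"
  shows "0 < g x"
proof -
  obtain y where "0 \<le> y" "0 < g y" "ennreal x < ennreal y"
    using assms(2) unfolding support_end_def less_SUP_iff by auto
  then show ?thesis using antimono[of x y] assms(1) by (simp add: ennreal_less_iff)
qed

lemma zero_above_support_end:
  assumes "support_end g < ennreal x"
  shows "g x = 0"
proof (rule ccontr)
  assume "g x \<noteq> 0"
  then have "0 < g x" using nonneg[of x] by simp
  moreover have "0 \<le> x" using zero[of x] \<open>g x \<noteq> 0\<close> by force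
  ultimately have "ennreal x \<le> support_end g"
    unfolding support_end_def by (intro SUP_upper) auto
  then show False using assms by simp
qed

end

text \<open>
By \<open>gabor_frame_iff\<close> it remains to decide when \<open>g\<close> is bounded away from \<open>0\<close> on \<open>[0,\<alpha>)\<close>. Below
\<open>x\<^sub>0\<close> the value \<open>g \<alpha> > 0\<close> is a bound, beyond \<open>x\<^sub>0\<close> the window vanishes, and for \<open>\<alpha> = x\<^sub>0\<close> the
infimum of \<open>g\<close> over \<open>[0,\<alpha>)\<close> is its left-hand limit at \<open>x\<^sub>0\<close>.
\<close>

theorem theorem1p1:
  fixes g :: "real \<Rightarrow> real" and x\<^sub>0 :: ennreal and \<alpha> \<beta> :: real
  assumes "(\<lambda>x. complex_of_real (g x)) \<in> L2"
    and "\<And>x. x < 0 \<Longrightarrow> g x = 0"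
    and "stably_decreasing g"
    and "x\<^sub>0 = support_end g"
    and "\<alpha> > 0" and "\<beta> > 0"
  shows "(x\<^sub>0 = \<infinity> \<longrightarrow>
            (L2_frame (gabor_system (\<lambda>x. complex_of_real (g x)) \<alpha> \<beta>) \<longleftrightarrow> \<alpha> * \<beta> \<le> 1)) \<and>
         (x\<^sub>0 < \<infinity> \<and> (\<exists>L>0. (g \<longlongrightarrow> L) (at_left (enn2real x\<^sub>0))) \<longrightarrow>
            (L2_frame (gabor_system (\<lambda>x. complex_of_real (g x)) \<alpha> \<beta>) \<longleftrightarrow>
               \<alpha> * \<beta> \<le> 1 \<and> ennreal \<alpha> \<le> x\<^sub>0)) \<and>
         (x\<^sub>0 < \<infinity> \<and> (g \<longlongrightarrow> 0) (at_left (enn2real x\<^sub>0)) \<longrightarrow>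
            (L2_frame (gabor_system (\<lambda>x. complex_of_real (g x)) \<alpha> \<beta>) \<longleftrightarrow>
               \<alpha> * \<beta> \<le> 1 \<and> ennreal \<alpha> < x\<^sub>0))"
proof -
  note \<alpha> = \<open>\<alpha> > 0\<close> and \<beta> = \<open>\<beta> > 0\<close> and x\<^sub>0 = \<open>x\<^sub>0 = support_end g\<close>
  interpret decaying_window g
    by unfold_locales (use assms in auto)
  define below where "below \<longleftrightarrow> (\<exists>\<delta>>0. \<forall>x. 0 \<le> x \<longrightarrow> x < \<alpha> \<longrightarrow> \<delta> \<le> g x)"
  have frame: "L2_frame (gabor_system (\<lambda>x. complex_of_real (g x)) \<alpha> \<beta>) \<longleftrightarrow> \<alpha> * \<beta> \<le> 1 \<and> below"
    using gabor_frame_iff[OF \<alpha> \<beta>] by (simp add: gabor_def below_def)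
  have below_if: below if "ennreal \<alpha> < x\<^sub>0"
    unfolding below_def
  proof (intro exI conjI allI impI)
    show "0 < g \<alpha>" using that \<alpha> by (intro pos_below_support_end) (auto simp: x\<^sub>0)
    show "g \<alpha> \<le> g x" if "0 \<le> x" "x < \<alpha>" for x using that by (intro antimono) auto
  qed
  have le_if: "ennreal \<alpha> \<le> x\<^sub>0" if below
  proof (rule ccontr)
    assume "\<not> ennreal \<alpha> \<le> x\<^sub>0"
    then have "x\<^sub>0 < ennreal \<alpha>" by simp
    then obtain y where y: "0 \<le> y" "x\<^sub>0 = ennreal y" "y < \<alpha>"
      by (cases x\<^sub>0) (auto simp: ennreal_less_iff)
    then have "g ((y + \<alpha>) / 2) = 0"
      by (intro zero_above_support_end) (simp add: x\<^sub>0[symmetric] ennreal_less_iff)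
    then show False using that y unfolding below_def by (auto dest!: spec[of _ "(y + \<alpha>) / 2"])
  qed
  have finite_end: "below \<longleftrightarrow> ennreal \<alpha> < x\<^sub>0 \<or> ennreal \<alpha> = x\<^sub>0 \<and> L > 0"
    if fin: "x\<^sub>0 < \<infinity>" and lim: "(g \<longlongrightarrow> L) (at_left (enn2real x\<^sub>0))" and L: "0 \<le> L" for L
  proof (cases "ennreal \<alpha> = x\<^sub>0")
    case True
    then have lim: "(g \<longlongrightarrow> L) (at_left \<alpha>)" using lim \<alpha> by (metis enn2real_ennreal less_imp_le)
    have ev: "\<forall>\<^sub>F x in at_left \<alpha>. 0 \<le> x \<and> x < \<alpha>"
      using \<alpha> eventually_at_left[OF \<alpha>] by (auto intro!: exI[of _ 0])
    have "below \<longleftrightarrow> L > 0"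
    proof
      assume below
      then obtain \<delta> where \<delta>: "\<delta> > 0" "\<And>x. 0 \<le> x \<Longrightarrow> x < \<alpha> \<Longrightarrow> \<delta> \<le> g x" unfolding below_def by auto
      have "\<delta> \<le> L"
        using ev by (intro tendsto_lowerbound[OF lim]) (auto elim!: eventually_mono intro: \<delta>)
      then show "L > 0" using \<delta>(1) by simp
    next
      assume "L > 0"
      have "L \<le> g x" if x: "0 \<le> x" "x < \<alpha>" for x
      proof (rule tendsto_upperbound[OF lim])
        have "\<forall>\<^sub>F y in at_left \<alpha>. x < y" using eventually_at_left[OF x(2)] x(2) by auto
        then show "\<forall>\<^sub>F y in at_left \<alpha>. g y \<le> g x"
          by eventually_elim (use x in \<open>auto intro!: antimono\<close>)
      qed simp
      then show below unfolding below_def using \<open>L > 0\<close> by blast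
    qed
    then show ?thesis using True by simp
  next
    case False
    then show ?thesis using below_if le_if by (auto simp: less_le)
  qed
  show ?thesis
  proof (intro conjI impI)
    assume "x\<^sub>0 = \<infinity>"
    then show "L2_frame (gabor_system (\<lambda>x. complex_of_real (g x)) \<alpha> \<beta>) \<longleftrightarrow> \<alpha> * \<beta> \<le> 1"
      using below_if by (simp add: frame less_top[symmetric])
  next
    assume "x\<^sub>0 < \<infinity> \<and> (\<exists>L>0. (g \<longlongrightarrow> L) (at_left (enn2real x\<^sub>0)))"
    then obtain L where "x\<^sub>0 < \<infinity>" "L > 0" "(g \<longlongrightarrow> L) (at_left (enn2real x\<^sub>0))" by auto
    then show "L2_frame (gabor_system (\<lambda>x. complex_of_real (g x)) \<alpha> \<beta>) \<longleftrightarrow>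
        \<alpha> * \<beta> \<le> 1 \<and> ennreal \<alpha> \<le> x\<^sub>0"
      using finite_end[of L] by (auto simp: frame le_less)
  next
    assume "x\<^sub>0 < \<infinity> \<and> (g \<longlongrightarrow> 0) (at_left (enn2real x\<^sub>0))"
    then show "L2_frame (gabor_system (\<lambda>x. complex_of_real (g x)) \<alpha> \<beta>) \<longleftrightarrow>
        \<alpha> * \<beta> \<le> 1 \<and> ennreal \<alpha> < x\<^sub>0"
      using finite_end[of 0] by (auto simp: frame)
  qed
qed

end
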